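(* Let $\phi=(f_1,\ldots,f_n)\in\mathbb{Q}(x_1,\ldots,x_m)^n$, let $X=\overline{\mathrm{im}(\phi)}\subseteq\mathbb{C}^n$, and let $\epsilon>0$. On input $\phi$ and $\epsilon$, the randomized Algorithm 1 described in the context returns a basis for $\mathfrak{g}_X$ with probability at least $1-\epsilon$.
   Context: Closures are Zariski closures; $\phi$ is regarded as a rational map $\mathbb{C}^m\dashrightarrow\mathbb{C}^n$. $\mathfrak{g}_X\subseteq\mathfrak{gl}_n(\mathbb{C})$ is the Lie algebra of the Zariski closed group $G_X=\{g\in\mathrm{GL}_n(\mathbb{C})\mid gX=X\}$. Since $\phi$ is defined over $\mathbb{Q}$, $\mathfrak{g}_X$ is the $\mathbb{C}$-span of $\mathfrak{g}_{X,\mathbb{Q}}=\mathfrak{g}_X\cap\mathfrak{gl}_n(\mathbb{Q})$, and the algorithm outputs matrices with rational entries. Algorithm 1 (input: $\phi$ and $\epsilon>0$). Write $f_i=a_i/b_i$ with $a_i,b_i\in\mathbb{Q}[x_1,\ldots,x_m]$. (1) Let $d\ge1$ be an upper bound on the degrees of all $a_i,b_i$. (2) Let $N=\lceil \epsilon^{-1}\cdot 2\cdot n^3\cdot d\cdot(2m+1)\rceil$. (3) Let $L=\emptyset$. (4) Repeat $n^2$ times, independently: choose a uniformly random point $p\in\{1,\ldots,N\}^m$; let $q=\phi(p)$ (if $\phi$ is undefined at $p$, return "fail"); let $J=\left(\frac{\partial f_i}{\partial x_j}(p)\right)_{ij}\in\mathbb{Q}^{n\times m}$; let $E$ be a basis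 of the orthogonal complement in $\mathbb{Q}^n$ of the column space of $J$; add to $L$ the linear forms $e^TA.q$, $e\in E$, in the entries of the unknown matrix $A\in\mathfrak{gl}_n$. (5) Return a basis of the solution space of the linear system $L$ (i.e. of the set of $A\in\mathfrak{gl}_n(\mathbb{Q})$ on which all linear forms in $L$ vanish). *)

theory Defs
  imports
    "HOL-Analysis.Analysis"
    "HOL-Probability.Probability_Mass_Function"
    "HOL-Library.Poly_Mapping"
    "HOL-Computational_Algebra.Fraction_Field"
begin

text \<open>Polynomials with variables indexed by \<open>'v\<close> and coefficients in \<open>'a\<close>, as finitely
  supported functions on monomials; the library equips this type with the convolution product.
  The linear order on \<open>'v\<close> required below is only there because the library instance
  \<^class>\<open>idom\<close> asks for it, and the fraction field needs \<^class>\<open>idom\<close>.\<close>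

type_synonym ('v, 'a) mpoly = "('v \<Rightarrow>\<^sub>0 nat) \<Rightarrow>\<^sub>0 'a"

type_synonym 'v ratfun = "('v, rat) mpoly fract"

definition monom_eval :: "('v \<Rightarrow> 'k::comm_semiring_1) \<Rightarrow> ('v \<Rightarrow>\<^sub>0 nat) \<Rightarrow> 'k" where
  "monom_eval x t = (\<Prod>v\<in>Poly_Mapping.keys t. x v ^ Poly_Mapping.lookup t v)"

text \<open>Evaluation at a point \<open>x\<close> over an extension of the coefficient ring; \<open>h\<close> is the embedding
  of the coefficients.\<close>

definition mpoly_eval ::
    "('a::zero \<Rightarrow> 'k::comm_semiring_1) \<Rightarrow> ('v \<Rightarrow> 'k) \<Rightarrow> ('v, 'a) mpoly \<Rightarrow> 'k" where
  "mpoly_eval h x p =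
     (\<Sum>t\<in>Poly_Mapping.keys p. h (Poly_Mapping.lookup p t) * monom_eval x t)"

definition mpoly_deriv :: "'v \<Rightarrow> ('v, 'a::comm_ring_1) mpoly \<Rightarrow> ('v, 'a) mpoly" where
  "mpoly_deriv v p =
     (\<Sum>t\<in>Poly_Mapping.keys p. Poly_Mapping.single (t - Poly_Mapping.single v 1)
        (of_nat (Poly_Mapping.lookup t v) * Poly_Mapping.lookup p t))"

definition mpoly_degree_le :: "('v, 'a::zero) mpoly \<Rightarrow> nat \<Rightarrow> bool" where
  "mpoly_degree_le p d \<longleftrightarrow>
     (\<forall>t\<in>Poly_Mapping.keys p. (\<Sum>v\<in>Poly_Mapping.keys t. Poly_Mapping.lookup t v) \<le> d)"

lemma monom_eval_superset:
  assumes "finite V" "Poly_Mapping.keys t \<subseteq> V"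
  shows "monom_eval x t = (\<Prod>v\<in>V. x v ^ Poly_Mapping.lookup t v)"
  unfolding monom_eval_def using assms
  by (intro prod.mono_neutral_left) (auto simp: in_keys_iff)

lemma monom_eval_add: "monom_eval x (s + t) = monom_eval x s * monom_eval x t"
proof -
  let ?V = "Poly_Mapping.keys s \<union> Poly_Mapping.keys t"
  have "monom_eval x (s + t) = (\<Prod>v\<in>?V. x v ^ Poly_Mapping.lookup (s + t) v)"
    by (rule monom_eval_superset) (auto simp: keys_add)
  then show ?thesis
    by (simp add: monom_eval_superset[of ?V] lookup_add power_add prod.distrib)
qed

lemma mpoly_eval_superset:
  assumes "finite K" "Poly_Mapping.keys p \<subseteq> K" "h 0 = 0"
  shows "mpoly_eval h x p = (\<Sum>t\<in>K. h (Poly_Mapping.lookup p t) * monom_eval x t)"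
  unfolding mpoly_eval_def using assms
  by (intro sum.mono_neutral_left) (auto simp: in_keys_iff)

lemma mpoly_deriv_superset:
  assumes "finite K" "Poly_Mapping.keys p \<subseteq> K"
  shows "mpoly_deriv v p =
     (\<Sum>t\<in>K. Poly_Mapping.single (t - Poly_Mapping.single v 1)
        (of_nat (Poly_Mapping.lookup t v) * Poly_Mapping.lookup p t))"
  unfolding mpoly_deriv_def using assms
  by (intro sum.mono_neutral_left) (auto simp: in_keys_iff)

lemma mpoly_deriv_add: "mpoly_deriv v (p + q) = mpoly_deriv v p + mpoly_deriv v q"
proof -
  let ?K = "Poly_Mapping.keys p \<union> Poly_Mapping.keys q"
  have "Poly_Mapping.keys (p + q) \<subseteq> ?K" by (rule keys_add)
  then show ?thesis
    by (simp add: mpoly_deriv_superset[of ?K] lookup_add distrib_left single_add sum.distrib)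
qed

lemma mpoly_deriv_single:
  "mpoly_deriv v (Poly_Mapping.single t c) =
     Poly_Mapping.single (t - Poly_Mapping.single v 1) (of_nat (Poly_Mapping.lookup t v) * c)"
  by (subst mpoly_deriv_superset[of "{t}"]) auto

lemma mpoly_eval_single:
  "h 0 = 0 \<Longrightarrow> mpoly_eval h x (Poly_Mapping.single t c) = h c * monom_eval x t"
  by (subst mpoly_eval_superset[of "{t}"]) auto

lemma mpoly_induct [case_names single add]:
  fixes p :: "('v, 'a::comm_monoid_add) mpoly"
  assumes "\<And>t c. P (Poly_Mapping.single t c)" and "\<And>p q. P p \<Longrightarrow> P q \<Longrightarrow> P (p + q)"
  shows "P p"
proof (induction p rule: update_induct)
  case const
  then show ?case using assms(1)[of 0 0] by simp
next
  case (update p t c)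
  have "Poly_Mapping.update t c p = p + Poly_Mapping.single t c"
    using update by (intro poly_mapping_eqI)
      (auto simp: lookup_update lookup_add lookup_single in_keys_iff when_def)
  then show ?case using assms update by simp
qed

lemma mpoly_deriv_mult:
  fixes p q :: "('v, 'a::comm_ring_1) mpoly"
  shows "mpoly_deriv v (p * q) = mpoly_deriv v p * q + p * mpoly_deriv v q"
proof (induction p rule: mpoly_induct)
  case (single s a)
  show ?case
  proof (induction q rule: mpoly_induct)
    case (single t b)
    let ?e = "Poly_Mapping.single v (1::nat)"
    have shift: "s' - ?e + t' = s' + t' - ?e" if "Poly_Mapping.lookup s' v \<noteq> 0" for s' t'
      using that by (intro poly_mapping_eqI) (auto simp: lookup_add lookup_minus lookup_single when_def)
    have left: "Poly_Mapping.single (s - ?e) (of_nat (Poly_Mapping.lookup s v) * a)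
          * Poly_Mapping.single t b
        = Poly_Mapping.single (s + t - ?e) (of_nat (Poly_Mapping.lookup s v) * a * b)"
      using shift[of s t]
      by (cases "Poly_Mapping.lookup s v = 0") (auto simp: mult_single)
    have right: "Poly_Mapping.single s a
          * Poly_Mapping.single (t - ?e) (of_nat (Poly_Mapping.lookup t v) * b)
        = Poly_Mapping.single (s + t - ?e) (of_nat (Poly_Mapping.lookup t v) * a * b)"
      using shift[of t s]
      by (cases "Poly_Mapping.lookup t v = 0") (auto simp: mult_single ac_simps)
    show ?case
      unfolding mult_single[of s a t b] mpoly_deriv_single left right
      by (simp add: lookup_add single_add[symmetric] algebra_simps)
  qed (simp add: mpoly_deriv_add algebra_simps)
qed (simp add: mpoly_deriv_add algebra_simps)

lemma mpoly_eval_add: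
  assumes "h 0 = 0" "\<And>a b. h (a + b) = h a + h b"
  shows "mpoly_eval h x (p + q) = mpoly_eval h x p + mpoly_eval h x q"
proof -
  let ?K = "Poly_Mapping.keys p \<union> Poly_Mapping.keys q"
  have "Poly_Mapping.keys (p + q) \<subseteq> ?K" by (rule keys_add)
  then show ?thesis using assms
    by (simp add: mpoly_eval_superset[of ?K] lookup_add distrib_right sum.distrib)
qed

lemma mpoly_eval_mult:
  fixes p q :: "('v, 'a::comm_ring_1) mpoly"
  assumes h: "h 0 = 0" "\<And>a b. h (a + b) = h a + h b" "\<And>a b. h (a * b) = h a * h b"
  shows "mpoly_eval h x (p * q) = mpoly_eval h x p * mpoly_eval h x q"
proof (induction p rule: mpoly_induct)
  case (single s a)
  show ?case
    by (induction q rule: mpoly_induct)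
      (simp_all add: mult_single mpoly_eval_single monom_eval_add h mpoly_eval_add algebra_simps)
qed (simp add: mpoly_eval_add h algebra_simps)

lift_definition ratfun_deriv :: "'v::linorder \<Rightarrow> 'v ratfun \<Rightarrow> 'v ratfun"
  is "\<lambda>v f. (mpoly_deriv v (fst f) * snd f - fst f * mpoly_deriv v (snd f), snd f * snd f)"
proof -
  fix v :: 'v and f g :: "('v, rat) mpoly \<times> ('v, rat) mpoly"
  obtain a b c d where [simp]: "f = (a, b)" "g = (c, d)" by (cases f, cases g)
  let ?D = "mpoly_deriv v"
  assume "fractrel f g"
  then have nz: "b \<noteq> 0" "d \<noteq> 0" and e: "a * d = c * b" by auto
  have "?D a * d + a * ?D d = ?D c * b + c * ?D b"
    using arg_cong[OF e, of ?D] by (simp add: mpoly_deriv_mult)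
  then have "(?D a * d + a * ?D d) * (b * d) - a * d * (?D d * b) - a * d * (?D b * d)
      = (?D c * b + c * ?D b) * (b * d) - c * b * (?D d * b) - c * b * (?D b * d)"
    by (simp only: e)
  then have "(?D a * b - a * ?D b) * (d * d) = (?D c * d - c * ?D d) * (b * b)"
    by (simp add: algebra_simps)
  then show "fractrel (?D (fst f) * snd f - fst f * ?D (snd f), snd f * snd f)
      (?D (fst g) * snd g - fst g * ?D (snd g), snd g * snd g)"
    using nz by (simp only: fractrel_iff fst_conv snd_conv \<open>f = _\<close> \<open>g = _\<close> mult_eq_0_iff) simp
qed

lemma ratfun_deriv_Fract:
  "b \<noteq> 0 \<Longrightarrow> ratfun_deriv v (Fract a b) = Fract (mpoly_deriv v a * b - a * mpoly_deriv v b) (b * b)"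
  by (simp add: Fract.abs_eq ratfun_deriv.abs_eq eq_onp_def)

text \<open>The representation \<open>a / b\<close> may depend on the point \<open>x\<close>, so this is the domain of the
  rational function itself rather than of one chosen fraction. For points over an extension field
  it is no restriction that \<open>a\<close> and \<open>b\<close> have rational coefficients: a reduced fraction stays
  reduced over the extension field, so its denominator divides every other one.\<close>

definition ratfun_defined :: "'v::linorder ratfun \<Rightarrow> ('v \<Rightarrow> 'k::field_char_0) \<Rightarrow> bool" where
  "ratfun_defined f x \<longleftrightarrow> (\<exists>a b. f = Fract a b \<and> mpoly_eval of_rat x b \<noteq> 0)"

definition ratfun_eval :: "'v::linorder ratfun \<Rightarrow> ('v \<Rightarrow> 'k::field_char_0) \<Rightarrow> 'k" where
  "ratfun_eval f x = (THE y. \<exists>a b. f = Fract a b \<and> mpoly_eval of_rat x b \<noteq> 0 \<and>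
     y = mpoly_eval of_rat x a / mpoly_eval of_rat x b)"

lemma ratfun_eval_Fract:
  assumes "mpoly_eval of_rat x b \<noteq> 0"
  shows "ratfun_eval (Fract a b) x = mpoly_eval of_rat x a / mpoly_eval of_rat x b"
  unfolding ratfun_eval_def
proof (rule the_equality)
  show "\<exists>a' b'. Fract a b = Fract a' b' \<and> mpoly_eval of_rat x b' \<noteq> 0 \<and>
      mpoly_eval of_rat x a / mpoly_eval of_rat x b = mpoly_eval of_rat x a' / mpoly_eval of_rat x b'"
    using assms by blast
next
  fix y
  assume "\<exists>a' b'. Fract a b = Fract a' b' \<and> mpoly_eval of_rat x b' \<noteq> 0 \<and>
      y = mpoly_eval of_rat x a' / mpoly_eval of_rat x b'"
  then obtain a' b' where *: "Fract a b = Fract a' b'" "mpoly_eval of_rat x b' \<noteq> 0"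
      "y = mpoly_eval of_rat x a' / mpoly_eval of_rat x b'"
    by blast
  have "b \<noteq> 0" "b' \<noteq> 0" using assms *(2) by (auto simp: mpoly_eval_def)
  then have "a * b' = a' * b" using *(1) by (simp add: eq_fract)
  from arg_cong[OF this, of "mpoly_eval of_rat x"]
  have "mpoly_eval of_rat x a' * mpoly_eval of_rat x b =
      mpoly_eval of_rat x a * mpoly_eval of_rat x b'"
    by (simp add: mpoly_eval_mult of_rat_add of_rat_mult)
  then show "y = mpoly_eval of_rat x a / mpoly_eval of_rat x b"
    unfolding *(3) using assms *(2) by (simp add: frac_eq_eq)
qed

definition zariski_closure :: "(complex ^ 'n) set \<Rightarrow> (complex ^ 'n) set" where
  "zariski_closure S = {x. \<forall>p :: ('n, complex) mpoly.
     (\<forall>y\<in>S. mpoly_eval id (($) y) p = 0) \<longrightarrow> mpoly_eval id (($) x) p = 0}"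

definition ratmap_defined ::
    "('m ratfun) ^ 'n \<Rightarrow> ('k::field_char_0) ^ ('m::{finite,linorder}) \<Rightarrow> bool" where
  "ratmap_defined \<phi> x \<longleftrightarrow> (\<forall>i. ratfun_defined (\<phi> $ i) (($) x))"

definition ratmap_eval ::
    "('m ratfun) ^ 'n \<Rightarrow> ('k::field_char_0) ^ ('m::{finite,linorder}) \<Rightarrow> 'k ^ 'n" where
  "ratmap_eval \<phi> x = (\<chi> i. ratfun_eval (\<phi> $ i) (($) x))"

definition ratmap_image :: "('m::{finite,linorder} ratfun) ^ 'n \<Rightarrow> (complex ^ 'n) set" where
  "ratmap_image \<phi> = ratmap_eval \<phi> ` {x :: complex ^ ('m::{finite,linorder}). ratmap_defined \<phi> x}"

definition stabilizer :: "(complex ^ 'n) set \<Rightarrow> (complex ^ 'n ^ 'n) set" where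
  "stabilizer X = {g. invertible g \<and> (*v) g ` X = X}"

definition matrix_entries :: "'a ^ 'n ^ 'n \<Rightarrow> 'n \<times> 'n \<Rightarrow> 'a" where
  "matrix_entries A = (\<lambda>(i, j). A $ i $ j)"

text \<open>The Lie algebra of a Zariski closed subgroup \<open>G\<close> of \<open>GL\<^sub>n(\<complex>)\<close>, as the Zariski tangent
  space at the identity: the matrices annihilated by the differentials at \<open>1\<close> of all regular
  functions vanishing on \<open>G\<close>. A regular function on \<open>GL\<^sub>n\<close> is a polynomial in the entries divided
  by a power of the determinant; since the determinant is invertible on \<open>GL\<^sub>n\<close>, polynomials
  suffice.\<close>

definition lie_algebra :: "(complex ^ 'n ^ 'n) set \<Rightarrow> (complex ^ 'n ^ 'n) set" where
  "lie_algebra G = {A. \<forall>p :: ('n \<times> 'n, complex) mpoly.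
     (\<forall>g\<in>G. mpoly_eval id (matrix_entries g) p = 0) \<longrightarrow>
     (\<Sum>(i, j)\<in>UNIV. A $ i $ j *
        mpoly_eval id (matrix_entries (mat 1)) (mpoly_deriv (i, j) p)) = 0}"

definition is_basis ::
    "('a::comm_ring_1 \<Rightarrow> 'b::ab_group_add \<Rightarrow> 'b) \<Rightarrow> 'b set \<Rightarrow> 'b set \<Rightarrow> bool" where
  "is_basis smul B V \<longleftrightarrow> \<not> module.dependent smul B \<and> module.span smul B = V"

definition mscale :: "'a::comm_ring_1 \<Rightarrow> 'a ^ 'n ^ 'n \<Rightarrow> 'a ^ 'n ^ 'n" where
  "mscale c = map_matrix ((*) c)"

interpretation mat: vector_space "mscale :: 'a::field \<Rightarrow> 'a ^ 'n ^ 'n \<Rightarrow> 'a ^ 'n ^ 'n"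
  by unfold_locales (simp_all add: mscale_def map_matrix_def vec_eq_iff algebra_simps)

text \<open>Choosing a basis is not specified any further by the algorithm, so the two places where this
  happens are parameters, and these predicates say that the choices are legitimate.\<close>

definition orthogonal_complement :: "(rat ^ 'n) set \<Rightarrow> (rat ^ 'n) set" where
  "orthogonal_complement V = {e. \<forall>v\<in>V. scalar_product e v = 0}"

definition complement_basis_choice :: "(rat ^ 'm ^ 'n \<Rightarrow> (rat ^ 'n) set) \<Rightarrow> bool" where
  "complement_basis_choice E \<longleftrightarrow>
     (\<forall>J. is_basis (*s) (E J) (orthogonal_complement (module.span (*s) (columns J))))"

definition solution_basis_choice ::
    "((rat ^ 'n ^ 'n \<Rightarrow> rat) set \<Rightarrow> (rat ^ 'n ^ 'n) set) \<Rightarrow> bool" where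
  "solution_basis_choice S \<longleftrightarrow>
     (\<forall>L. finite L \<longrightarrow> (\<forall>l\<in>L. Vector_Spaces.linear mscale (*) l) \<longrightarrow>
        is_basis mscale (S L) {A. \<forall>l\<in>L. l A = 0})"

definition jacobian ::
    "('m ratfun) ^ 'n \<Rightarrow> rat ^ ('m::{finite,linorder}) \<Rightarrow> rat ^ ('m::{finite,linorder}) ^ 'n" where
  "jacobian \<phi> p = (\<chi> i j. ratfun_eval (ratfun_deriv j (\<phi> $ i)) (($) p))"

definition grid :: "nat \<Rightarrow> (rat ^ 'm) set" where
  "grid N = {p. \<forall>j. p $ j \<in> of_nat ` {1..N}}"

text \<open>\<open>None\<close> stands for the output ``fail''.\<close>

primrec collect_forms ::
    "('m ratfun) ^ 'n \<Rightarrow> (rat ^ ('m::{finite,linorder}) ^ 'n \<Rightarrow> (rat ^ 'n) set) \<Rightarrow>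
      nat \<Rightarrow> nat \<Rightarrow> (rat ^ 'n ^ 'n \<Rightarrow> rat) set \<Rightarrow> (rat ^ 'n ^ 'n \<Rightarrow> rat) set option pmf" where
  "collect_forms \<phi> E N 0 L = return_pmf (Some L)"
| "collect_forms \<phi> E N (Suc k) L =
     bind_pmf (pmf_of_set (grid N)) (\<lambda>p.
       if ratmap_defined \<phi> p
       then let q = ratmap_eval \<phi> p
            in collect_forms \<phi> E N k
                 (L \<union> (\<lambda>e A. scalar_product e (A *v q)) ` E (jacobian \<phi> p))
       else return_pmf None)"

definition algorithm1 ::
    "(rat ^ ('m::{finite,linorder}) ^ 'n \<Rightarrow> (rat ^ 'n) set) \<Rightarrow>
      ((rat ^ 'n ^ 'n \<Rightarrow> rat) set \<Rightarrow> (rat ^ 'n ^ 'n) set) \<Rightarrow>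
      nat \<Rightarrow> ('m ratfun) ^ 'n \<Rightarrow> real \<Rightarrow> (rat ^ 'n ^ 'n) set option pmf" where
  "algorithm1 E S d \<phi> \<epsilon> =
     (let n = CARD('n); m = CARD('m);
          N = nat \<lceil>inverse \<epsilon> * 2 * real n ^ 3 * real d * (2 * real m + 1)\<rceil>
      in map_pmf (map_option S) (collect_forms \<phi> E N (n\<^sup>2) {}))"

lemma grid_finite_nonempty:
  assumes "N \<ge> 1"
  shows "finite (grid N :: (rat ^ 'm::finite) set)" "grid N \<noteq> ({} :: (rat ^ 'm::finite) set)"
proof -
  have "(grid N :: (rat ^ 'm) set) \<subseteq> vec_lambda ` Pi\<^sub>E UNIV (\<lambda>_. of_nat ` {1..N})"
  proof
    fix p :: "rat ^ 'm" assume "p \<in> grid N"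
    then have "($) p \<in> Pi\<^sub>E UNIV (\<lambda>_. of_nat ` {1..N})" by (auto simp: grid_def)
    then show "p \<in> vec_lambda ` Pi\<^sub>E UNIV (\<lambda>_. of_nat ` {1..N})"
      by (intro image_eqI[of _ _ "($) p"]) auto
  qed
  then show "finite (grid N :: (rat ^ 'm) set)"
    by (rule finite_subset) (intro finite_imageI finite_PiE, auto)
  have "(\<chi> j. 1) \<in> (grid N :: (rat ^ 'm) set)"
    using assms by (auto simp: grid_def intro!: image_eqI[of _ _ 1])
  then show "grid N \<noteq> ({} :: (rat ^ 'm) set)" by blast
qed

end

theory Submission
  imports Defs "HOL-Complex_Analysis.Cauchy_Integral_Formula"
begin

text \<open>Let \<open>K = \<rat>(x\<^sub>1, \<dots>, x\<^sub>m)\<close>. The tuple \<open>\<phi>\<close> is a vector over \<open>K\<close>, the generic point of \<open>X\<close>, and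
  the columns \<open>\<partial>\<phi>/\<partial>x\<^sub>j\<close> of its Jacobian span a subspace \<open>W \<subseteq> K\<^sup>n\<close>, the tangent space of \<open>X\<close> at that
  point. Everything is compared with the space \<open>V\<close> of all rational matrices \<open>A\<close> such that
  \<open>A \<phi> \<in> W\<close> (\<open>generic_lie_algebra\<close>).

  The geometric half of the proof says that \<open>V\<close> is a rational form of \<open>\<gg>\<^sub>X\<close>: every basis of \<open>V\<close> is a
  complex basis of \<open>\<gg>\<^sub>X\<close> (\<open>generic_basis_imp_lie_algebra_basis\<close>). Write \<open>D\<^sub>A p = \<nabla>p \<cdot> A y\<close> for a
  polynomial \<open>p\<close> in \<open>y\<^sub>1, \<dots>, y\<^sub>n\<close>. If \<open>A \<in> V\<close>, then the chain rule shows that \<open>D\<^sub>A\<close> maps polynomials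
  vanishing at \<open>\<phi>\<close> to such polynomials. Hence all derivatives of \<open>t \<mapsto> p (exp (tA) x)\<close> at \<open>0\<close> vanish
  for \<open>x \<in> X\<close> and \<open>p\<close> in the ideal of \<open>X\<close>, so the one-parameter group \<open>exp (tA)\<close> stabilizes \<open>X\<close>, and
  \<open>A\<close>, being its velocity at \<open>0\<close>, lies in \<open>\<gg>\<^sub>X\<close>. Conversely, for such \<open>x\<close> and \<open>p\<close>
  the function \<open>g \<mapsto> p (g x)\<close> vanishes on the stabilizer, so \<open>D\<^sub>A\<close> preserves the ideal of \<open>X\<close> for
  every \<open>A \<in> \<gg>\<^sub>X\<close>. If \<open>A\<close> is rational, then \<open>p(\<phi>) \<mapsto> (D\<^sub>A p)(\<phi>)\<close> is therefore a well-defined derivation of \<open>\<rat>[\<phi>]\<close>. In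
  characteristic \<open>0\<close> a derivation extends to any larger finitely generated ring
  (\<open>derivation_on_extend\<close>), in particular to \<open>\<rat>[\<phi>, x\<^sub>1, \<dots>, x\<^sub>m]\<close>, where it has to be a
  \<open>K\<close>-combination of the \<open>\<partial>/\<partial>x\<^sub>j\<close>; applied to \<open>\<phi>\<close> this reads \<open>A \<phi> \<in> W\<close>. Complex matrices and complex
  polynomials are reduced to rational ones by writing their entries and coefficients in terms of
  finitely many complex numbers that are linearly independent over \<open>\<rat>\<close>.

  The probabilistic half compares the forms collected at a sample point \<open>p\<close> with the condition
  \<open>A \<phi> \<in> W\<close>: they say that \<open>A \<phi>(p)\<close> lies in the column space of the Jacobian at \<open>p\<close>. For a fixed
  \<open>A\<close> there is a nonzero polynomial \<open>Z\<close> of degree at most \<open>4nd\<close>, built from a determinant, such that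
  \<open>Z(p) \<noteq> 0\<close> implies that all matrices in \<open>V\<close> satisfy the condition at \<open>p\<close> and that \<open>A\<close> violates it
  unless \<open>A \<in> V\<close> (\<open>good_polynomial_exists\<close>). By the Schwartz--Zippel lemma \<open>Z\<close> vanishes at a random
  grid point with probability at most \<open>4nd/N\<close>. Taking for \<open>A\<close> any current solution outside \<open>V\<close>, a
  round with \<open>Z(p) \<noteq> 0\<close> keeps \<open>V\<close> inside the solution space and lowers its dimension, unless it
  equals \<open>V\<close> already. The dimension is at most \<open>n\<^sup>2\<close>, so \<open>n\<^sup>2\<close> such rounds suffice, and the
  probability that one of them fails is at most \<open>n\<^sup>2 \<cdot> 4nd/N \<le> \<epsilon>\<close>.\<close>

section \<open>Evaluation, derivatives and degrees of polynomials\<close>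

abbreviation mconst :: "'a::zero \<Rightarrow> ('v, 'a) mpoly" where
  "mconst c \<equiv> Poly_Mapping.single 0 c"

text \<open>The exponent is \<open>Suc 0\<close>, the normal form of \<open>1\<close> under simplification, so that rewrite rules
  about variables still match after simplification.\<close>

abbreviation mvar :: "'v \<Rightarrow> ('v, 'a::zero_neq_one) mpoly" where
  "mvar v \<equiv> Poly_Mapping.single (Poly_Mapping.single v (Suc 0)) 1"

text \<open>Polynomials are generated as a ring by constants and variables. Identities between ring
  homomorphisms and derivations thus need to be checked on generators only.\<close>

lemma mpoly_ring_induct [case_names const var add mult]:
  fixes p :: "('v, 'a::comm_ring_1) mpoly"
  assumes const: "\<And>c. P (mconst c)" and var: "\<And>v. P (mvar v)"
    and add: "\<And>p q. P p \<Longrightarrow> P q \<Longrightarrow> P (p + q)" and mult: "\<And>p q. P p \<Longrightarrow> P q \<Longrightarrow> P (p * q)"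
  shows "P p"
proof (induction p rule: mpoly_induct)
  case (single t c)
  have pow: "P (Poly_Mapping.single (Poly_Mapping.single v k) 1)" for v k
  proof (induction k)
    case (Suc k)
    have "Poly_Mapping.single (Poly_Mapping.single v (Suc k)) (1::'a)
        = Poly_Mapping.single (Poly_Mapping.single v k) 1 * mvar v"
      by (simp add: mult_single single_add[symmetric])
    then show ?case using mult[OF Suc var[of v]] by simp
  qed (use const[of 1] in simp)
  have "P (Poly_Mapping.single t 1)"
  proof (induction t rule: update_induct)
    case const
    then show ?case using assms(1)[of 1] by simp
  next
    case (update t v k)
    have "Poly_Mapping.update v k t = t + Poly_Mapping.single v k"
      using update by (intro poly_mapping_eqI)
        (auto simp: lookup_update lookup_add lookup_single in_keys_iff when_def)
    then show ?case
      using mult[OF update(3) pow[of v k]] by (simp add: mult_single)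
  qed
  from mult[OF const[of c] this] show ?case by (simp add: mult_single)
qed (fact add)

definition coeff_hom :: "('a::comm_ring_1 \<Rightarrow> 'k::comm_ring_1) \<Rightarrow> bool" where
  "coeff_hom h \<longleftrightarrow> h 0 = 0 \<and> h 1 = 1 \<and> (\<forall>a b. h (a + b) = h a + h b) \<and> (\<forall>a b. h (a * b) = h a * h b)"

lemma coeff_hom_of_rat [simp]: "coeff_hom (of_rat :: rat \<Rightarrow> 'k::field_char_0)"
  by (simp add: coeff_hom_def of_rat_add of_rat_mult)

lemma coeff_hom_id [simp]: "coeff_hom id" "coeff_hom (\<lambda>x. x)"
  by (simp_all add: coeff_hom_def)

lemma mpoly_eval_simps:
  assumes "coeff_hom h"
  shows "mpoly_eval h x (p + q) = mpoly_eval h x p + mpoly_eval h x q"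
    and "mpoly_eval h x (p * q) = mpoly_eval h x p * mpoly_eval h x q"
    and "mpoly_eval h x (mconst c) = h c"
    and "mpoly_eval h x (mvar v) = x v"
    and "mpoly_eval h x 1 = 1"
    and "mpoly_eval h x 0 = 0"
proof -
  have h: "h 0 = 0" "h 1 = 1" "\<And>a b. h (a + b) = h a + h b" "\<And>a b. h (a * b) = h a * h b"
    using assms by (auto simp: coeff_hom_def)
  show "mpoly_eval h x (p + q) = mpoly_eval h x p + mpoly_eval h x q"
    by (simp add: h mpoly_eval_add)
  show "mpoly_eval h x (p * q) = mpoly_eval h x p * mpoly_eval h x q"
    by (simp add: h mpoly_eval_mult)
  show c: "mpoly_eval h x (mconst c) = h c" for c
    by (simp add: mpoly_eval_single h monom_eval_def)
  show "mpoly_eval h x (mvar v) = x v"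
    by (simp add: mpoly_eval_single h monom_eval_def)
  show "mpoly_eval h x 1 = 1" using c[of 1] h by (simp flip: single_one)
  show "mpoly_eval h x 0 = 0" by (simp add: mpoly_eval_def)
qed

lemma mpoly_eval_sum:
  "coeff_hom h \<Longrightarrow> mpoly_eval h x (\<Sum>i\<in>I. f i) = (\<Sum>i\<in>I. mpoly_eval h x (f i))"
  by (induction I rule: infinite_finite_induct) (simp_all add: mpoly_eval_simps)

lemma mpoly_eval_prod:
  "coeff_hom h \<Longrightarrow> mpoly_eval h x (\<Prod>i\<in>I. f i) = (\<Prod>i\<in>I. mpoly_eval h x (f i))"
  by (induction I rule: infinite_finite_induct) (simp_all add: mpoly_eval_simps)

lemma mpoly_eval_minus:
  assumes "coeff_hom h"
  shows "mpoly_eval h x (- p) = - mpoly_eval h x p"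
  using mpoly_eval_simps(1)[OF assms, of x p "- p"] mpoly_eval_simps(6)[OF assms, of x]
  by (simp add: eq_neg_iff_add_eq_0 add.commute)

lemma mpoly_eval_indicator:
  "coeff_hom h \<Longrightarrow> mpoly_eval h x (if c then 1 else 0) = (if c then 1 else 0)"
  by (simp add: mpoly_eval_simps)

lemma mpoly_deriv_sum: "mpoly_deriv v (\<Sum>i\<in>I. f i) = (\<Sum>i\<in>I. mpoly_deriv v (f i))"
  by (induction I rule: infinite_finite_induct) (simp_all add: mpoly_deriv_add mpoly_deriv_def[of v 0])

lemma mpoly_deriv_const: "mpoly_deriv v (mconst c) = 0"
  by (simp add: mpoly_deriv_single)

lemma mpoly_deriv_var: "mpoly_deriv v (mvar w) = (if v = w then 1 else 0)"
  by (auto simp: mpoly_deriv_single lookup_single when_def)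

text \<open>A derivation of a subring \<open>R\<close> with values in the whole ring. The subring is a parameter because
  derivations are constructed along an increasing chain of subrings of a field; the closure
  properties of \<open>R\<close> are part of the definition.\<close>

definition derivation_on :: "'k::comm_ring_1 set \<Rightarrow> ('k \<Rightarrow> 'k) \<Rightarrow> bool" where
  "derivation_on R D \<longleftrightarrow> 0 \<in> R \<and> 1 \<in> R \<and>
     (\<forall>a\<in>R. - a \<in> R) \<and> (\<forall>a\<in>R. \<forall>b\<in>R. a + b \<in> R \<and> a * b \<in> R \<and>
       D (a + b) = D a + D b \<and> D (a * b) = D a * b + a * D b)"

text \<open>The chain rule, for an arbitrary derivation that kills the coefficients.\<close>

lemma derivation_on_mpoly_eval:
  fixes p :: "('v::finite, 'a::comm_ring_1) mpoly"
  assumes D: "derivation_on R D" and h: "coeff_hom h"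
    and hR: "\<And>c. h c \<in> R" "\<And>c. D (h c) = 0" and xR: "\<And>v. x v \<in> R"
  shows "mpoly_eval h x p \<in> R \<and>
    D (mpoly_eval h x p) = (\<Sum>v\<in>UNIV. mpoly_eval h x (mpoly_deriv v p) * D (x v))"
proof (induction p rule: mpoly_ring_induct)
  case (var w)
  have "(\<Sum>v\<in>UNIV. (if v = w then 1 else 0) * D (x v)) = D (x w)"
    by (simp add: if_distrib[of "\<lambda>c. c * _"] cong: if_cong)
  then show ?case using xR h
    by (simp add: mpoly_eval_simps mpoly_deriv_var mpoly_eval_indicator)
next
  case (mult p q)
  then show ?case using D h
    by (simp add: derivation_on_def mpoly_eval_simps mpoly_deriv_mult sum_distrib_left
        sum_distrib_right sum.distrib algebra_simps)
next
  case (add p q)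
  then show ?case using D h
    by (simp add: derivation_on_def mpoly_eval_simps mpoly_deriv_add sum.distrib algebra_simps)
qed (use h hR in \<open>simp add: mpoly_eval_simps mpoly_deriv_const\<close>)

lemma mpoly_eval_has_field_derivative:
  fixes p :: "('v::finite, complex) mpoly"
  assumes "\<And>v. ((\<lambda>t. x t v) has_field_derivative x' v) (at t)"
  shows "((\<lambda>t. mpoly_eval id (x t) p) has_field_derivative
     (\<Sum>v\<in>UNIV. mpoly_eval id (x t) (mpoly_deriv v p) * x' v)) (at t)"
proof (induction p rule: mpoly_ring_induct)
  case (var w)
  have "(\<Sum>v\<in>UNIV. (if v = w then 1 else 0) * x' v) = x' w"
    by (simp add: if_distrib[of "\<lambda>c. c * _"] cong: if_cong)
  then show ?case using assms
    by (simp add: mpoly_eval_simps mpoly_deriv_var mpoly_eval_indicator)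
next
  case (mult p q)
  show ?case using DERIV_mult[OF mult]
    by (simp add: mpoly_eval_simps mpoly_deriv_mult sum_distrib_left
        sum_distrib_right sum.distrib algebra_simps)
next
  case (add p q)
  show ?case using DERIV_add[OF add]
    by (simp add: mpoly_eval_simps mpoly_deriv_add sum.distrib algebra_simps)
qed (simp add: mpoly_eval_simps mpoly_deriv_const)

lemma mpoly_degree_le_iff:
  fixes p :: "('v::finite, 'a::zero) mpoly"
  shows "mpoly_degree_le p d \<longleftrightarrow>
    (\<forall>t\<in>Poly_Mapping.keys p. (\<Sum>v\<in>UNIV. Poly_Mapping.lookup t v) \<le> d)"
proof -
  have "(\<Sum>v\<in>Poly_Mapping.keys t. Poly_Mapping.lookup t v) = (\<Sum>v\<in>UNIV. Poly_Mapping.lookup t v)"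
    for t :: "'v \<Rightarrow>\<^sub>0 nat"
    by (rule sum.mono_neutral_left) (auto simp: in_keys_iff)
  then show ?thesis by (simp add: mpoly_degree_le_def)
qed

lemma mpoly_degree_le_mono: "mpoly_degree_le p d \<Longrightarrow> d \<le> e \<Longrightarrow> mpoly_degree_le p e"
  by (auto simp: mpoly_degree_le_def)

lemma mpoly_degree_le_zero: "mpoly_degree_le 0 d"
  by (simp add: mpoly_degree_le_def)

lemma mpoly_degree_le_one: "mpoly_degree_le (1 :: ('v, 'a::comm_ring_1) mpoly) d"
  by (auto simp: mpoly_degree_le_def simp flip: single_one)

lemma mpoly_degree_le_const: "mpoly_degree_le (mconst c) d"
  by (auto simp: mpoly_degree_le_def)

lemma mpoly_degree_le_add:
  "mpoly_degree_le p d \<Longrightarrow> mpoly_degree_le q d \<Longrightarrow> mpoly_degree_le (p + q) d"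
  using keys_add[of p q] by (auto simp: mpoly_degree_le_def)

lemma mpoly_degree_le_uminus:
  "mpoly_degree_le p d \<Longrightarrow> mpoly_degree_le (- p :: ('v, 'a::comm_ring_1) mpoly) d"
  by (simp add: mpoly_degree_le_def in_keys_iff)

lemma mpoly_degree_le_diff:
  "mpoly_degree_le p d \<Longrightarrow> mpoly_degree_le q d \<Longrightarrow> mpoly_degree_le (p - q :: ('v, 'a::comm_ring_1) mpoly) d"
  using mpoly_degree_le_add[of p d "- q"] mpoly_degree_le_uminus[of q d] by simp

lemma mpoly_degree_le_mult:
  fixes p q :: "('v::finite, 'a::comm_ring_1) mpoly"
  assumes "mpoly_degree_le p d" "mpoly_degree_le q e"
  shows "mpoly_degree_le (p * q) (d + e)"
  unfolding mpoly_degree_le_iff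
proof
  fix t assume "t \<in> Poly_Mapping.keys (p * q)"
  then obtain r s where rs: "r \<in> Poly_Mapping.keys p" "s \<in> Poly_Mapping.keys q" "t = r + s"
    using keys_mult[of p q] by auto
  then show "(\<Sum>v\<in>UNIV. Poly_Mapping.lookup t v) \<le> d + e"
    using assms by (auto simp: mpoly_degree_le_iff lookup_add sum.distrib intro!: add_mono)
qed

lemma mpoly_degree_le_sum:
  "(\<And>i. i \<in> I \<Longrightarrow> mpoly_degree_le (f i) d) \<Longrightarrow> mpoly_degree_le (\<Sum>i\<in>I. f i) d"
  by (induction I rule: infinite_finite_induct)
    (auto intro: mpoly_degree_le_zero mpoly_degree_le_add)

lemma mpoly_degree_le_prod:
  fixes f :: "'i \<Rightarrow> ('v::finite, 'a::comm_ring_1) mpoly"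
  shows "(\<And>i. i \<in> I \<Longrightarrow> mpoly_degree_le (f i) (d i)) \<Longrightarrow> mpoly_degree_le (\<Prod>i\<in>I. f i) (\<Sum>i\<in>I. d i)"
  by (induction I rule: infinite_finite_induct)
    (auto intro: mpoly_degree_le_one mpoly_degree_le_mult)

lemma mpoly_degree_le_deriv:
  fixes p :: "('v::finite, 'a::comm_ring_1) mpoly"
  assumes "mpoly_degree_le p d"
  shows "mpoly_degree_le (mpoly_deriv v p) d"
  unfolding mpoly_deriv_def
proof (rule mpoly_degree_le_sum)
  fix t assume t: "t \<in> Poly_Mapping.keys p"
  have "(\<Sum>w\<in>UNIV. Poly_Mapping.lookup (t - Poly_Mapping.single v 1) w) \<le> (\<Sum>w\<in>UNIV. Poly_Mapping.lookup t w)"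
    by (rule sum_mono) (simp add: lookup_minus)
  then show "mpoly_degree_le (Poly_Mapping.single (t - Poly_Mapping.single v 1)
        (of_nat (Poly_Mapping.lookup t v) * Poly_Mapping.lookup p t)) d"
    using assms t by (force simp: mpoly_degree_le_iff)
qed

text \<open>Each term of the Leibniz formula takes one entry from every row and every column, so bounds of
  the form row contribution plus column contribution add up.\<close>

lemma mpoly_degree_le_det:
  fixes M :: "('v::finite, 'a::comm_ring_1) mpoly ^ 'n ^ 'n"
  assumes "\<And>i j. mpoly_degree_le (M $ i $ j) (r i + c j)"
  shows "mpoly_degree_le (det M) ((\<Sum>i\<in>UNIV. r i) + (\<Sum>j\<in>UNIV. c j))"
  unfolding det_def
proof (rule mpoly_degree_le_sum)
  fix p :: "'n \<Rightarrow> 'n" assume "p \<in> {p. p permutes UNIV}"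
  then have p: "p permutes UNIV" by simp
  have "mpoly_degree_le (\<Prod>i\<in>UNIV. M $ i $ p i) (\<Sum>i\<in>UNIV. r i + c (p i))"
    by (rule mpoly_degree_le_prod) (rule assms)
  moreover have "(\<Sum>i\<in>UNIV. r i + c (p i)) = (\<Sum>i\<in>UNIV. r i) + (\<Sum>j\<in>UNIV. c j)"
    using sum.permute[OF p, of c] by (simp add: sum.distrib o_def)
  ultimately have "mpoly_degree_le (\<Prod>i\<in>UNIV. M $ i $ p i) ((\<Sum>i\<in>UNIV. r i) + (\<Sum>j\<in>UNIV. c j))"
    by simp
  then show "mpoly_degree_le (of_int (sign p) * (\<Prod>i\<in>UNIV. M $ i $ p i))
      ((\<Sum>i\<in>UNIV. r i) + (\<Sum>j\<in>UNIV. c j))"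
    by (auto simp: sign_def intro: mpoly_degree_le_uminus)
qed

lemma mpoly_eval_det:
  fixes M :: "('v, 'a::comm_ring_1) mpoly ^ 'n ^ 'n"
  assumes h: "coeff_hom h"
  shows "mpoly_eval h x (det M) = det (\<chi> i j. mpoly_eval h x (M $ i $ j))"
proof -
  have "mpoly_eval h x (of_int (sign p)) = of_int (sign p)" for p :: "'n \<Rightarrow> 'n"
    using h by (auto simp: sign_def mpoly_eval_simps mpoly_eval_minus)
  then show ?thesis
    by (simp add: det_def mpoly_eval_sum[OF h] mpoly_eval_simps[OF h] mpoly_eval_prod[OF h])
qed

section \<open>Rational functions at points of their domain\<close>

instance fract :: ("{idom, ring_char_0}") field_char_0
proof
  show "inj (of_nat :: nat \<Rightarrow> 'a fract)"
    by (auto simp: inj_def of_nat_fract eq_fract)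
qed

lemma of_rat_ratfun: "(of_rat q :: 'v::linorder ratfun) = Fract (mconst q) 1"
proof -
  obtain a b where q: "quotient_of q = (a, b)" by fastforce
  then have b: "b > 0" and qq: "q = of_int a / of_int b"
    by (auto simp: quotient_of_denom_pos quotient_of_div)
  have oi: "(of_int k :: 'v ratfun) = Fract (mconst (of_int k)) 1" for k
  proof (cases k rule: int_cases2)
    case (nonneg n)
    then show ?thesis by (simp add: of_nat_fract flip: single_of_nat)
  next
    case (nonpos n)
    then show ?thesis
      by (simp add: of_nat_fract single_uminus flip: single_of_nat)
  qed
  have "mconst (of_int b :: rat) \<noteq> (0 :: ('v, rat) mpoly)" using b
    by (metis lookup_single_eq lookup_zero of_int_0_eq_iff less_irrefl)
  moreover have "mconst (of_int a) = mconst q * (mconst (of_int b) :: ('v, rat) mpoly)"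
    using b by (simp add: qq mult_single del: single_of_int)
  ultimately show ?thesis
    using b by (simp add: qq of_rat_divide oi eq_fract)
qed

lemma mpoly_eval_nonzero: "mpoly_eval h x b \<noteq> 0 \<Longrightarrow> b \<noteq> 0"
  by (auto simp: mpoly_eval_def)

lemma ratfun_definedE:
  assumes "ratfun_defined f (x :: 'v::linorder \<Rightarrow> 'k::field_char_0)"
  obtains a b where "f = Fract a b" "mpoly_eval of_rat x b \<noteq> 0" "b \<noteq> 0"
    "ratfun_eval f x = mpoly_eval of_rat x a / mpoly_eval of_rat x b"
  using assms unfolding ratfun_defined_def
  by (metis ratfun_eval_Fract mpoly_eval_nonzero)

lemma ratfun_Fract:
  fixes x :: "'v::linorder \<Rightarrow> 'k::field_char_0"
  assumes "mpoly_eval of_rat x b \<noteq> 0"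
  shows "ratfun_defined (Fract a b) x"
    "ratfun_eval (Fract a b) x = mpoly_eval of_rat x a / mpoly_eval of_rat x b"
  using assms by (auto simp: ratfun_defined_def ratfun_eval_Fract)

lemma ratfun_poly:
  fixes x :: "'v::linorder \<Rightarrow> 'k::field_char_0"
  shows "ratfun_defined (Fract a 1) x" "ratfun_eval (Fract a 1) x = mpoly_eval of_rat x a"
  using ratfun_Fract[of x 1 a] by (simp_all add: mpoly_eval_simps)

lemma ratfun_const:
  fixes x :: "'v::linorder \<Rightarrow> 'k::field_char_0"
  shows "ratfun_defined (of_rat q) x" "ratfun_eval (of_rat q) x = of_rat q"
  by (simp_all add: of_rat_ratfun ratfun_poly mpoly_eval_simps)

lemma ratfun_add:
  fixes x :: "'v::linorder \<Rightarrow> 'k::field_char_0"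
  assumes "ratfun_defined f x" "ratfun_defined g x"
  shows "ratfun_defined (f + g) x" "ratfun_eval (f + g) x = ratfun_eval f x + ratfun_eval g x"
proof -
  obtain a b where f: "f = Fract a b" "mpoly_eval of_rat x b \<noteq> 0" "b \<noteq> 0"
    "ratfun_eval f x = mpoly_eval of_rat x a / mpoly_eval of_rat x b"
    using assms(1) by (rule ratfun_definedE)
  obtain c d where g: "g = Fract c d" "mpoly_eval of_rat x d \<noteq> 0" "d \<noteq> 0"
    "ratfun_eval g x = mpoly_eval of_rat x c / mpoly_eval of_rat x d"
    using assms(2) by (rule ratfun_definedE)
  have nz: "mpoly_eval of_rat x (b * d) \<noteq> 0" using f g by (simp add: mpoly_eval_simps)
  have fg: "f + g = Fract (a * d + c * b) (b * d)" using f g by simp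
  show "ratfun_defined (f + g) x" unfolding fg by (rule ratfun_Fract[OF nz])
  show "ratfun_eval (f + g) x = ratfun_eval f x + ratfun_eval g x"
    unfolding fg ratfun_Fract(2)[OF nz] using f(2,4) g(2,4) by (simp add: mpoly_eval_simps field_simps)
qed

lemma ratfun_mult:
  fixes x :: "'v::linorder \<Rightarrow> 'k::field_char_0"
  assumes "ratfun_defined f x" "ratfun_defined g x"
  shows "ratfun_defined (f * g) x" "ratfun_eval (f * g) x = ratfun_eval f x * ratfun_eval g x"
proof -
  obtain a b where f: "f = Fract a b" "mpoly_eval of_rat x b \<noteq> 0" "b \<noteq> 0"
    "ratfun_eval f x = mpoly_eval of_rat x a / mpoly_eval of_rat x b"
    using assms(1) by (rule ratfun_definedE)
  obtain c d where g: "g = Fract c d" "mpoly_eval of_rat x d \<noteq> 0" "d \<noteq> 0"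
    "ratfun_eval g x = mpoly_eval of_rat x c / mpoly_eval of_rat x d"
    using assms(2) by (rule ratfun_definedE)
  have nz: "mpoly_eval of_rat x (b * d) \<noteq> 0" using f g by (simp add: mpoly_eval_simps)
  have fg: "f * g = Fract (a * c) (b * d)" using f g by simp
  show "ratfun_defined (f * g) x" unfolding fg by (rule ratfun_Fract[OF nz])
  show "ratfun_eval (f * g) x = ratfun_eval f x * ratfun_eval g x"
    unfolding fg ratfun_Fract(2)[OF nz] using f(2,4) g(2,4) by (simp add: mpoly_eval_simps field_simps)
qed

lemma ratfun_sum:
  fixes x :: "'v::linorder \<Rightarrow> 'k::field_char_0"
  assumes "\<And>i. i \<in> I \<Longrightarrow> ratfun_defined (f i) x"
  shows "ratfun_defined (\<Sum>i\<in>I. f i) x \<and> ratfun_eval (\<Sum>i\<in>I. f i) x = (\<Sum>i\<in>I. ratfun_eval (f i) x)"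
  using assms
proof (induction I rule: infinite_finite_induct)
  case (insert i I)
  then show ?case by (simp add: ratfun_add)
qed (use ratfun_const[of 0] in auto)

lemma ratfun_prod:
  fixes x :: "'v::linorder \<Rightarrow> 'k::field_char_0"
  assumes "\<And>i. i \<in> I \<Longrightarrow> ratfun_defined (f i) x"
  shows "ratfun_defined (\<Prod>i\<in>I. f i) x \<and> ratfun_eval (\<Prod>i\<in>I. f i) x = (\<Prod>i\<in>I. ratfun_eval (f i) x)"
  using assms
proof (induction I rule: infinite_finite_induct)
  case (insert i I)
  then show ?case by (simp add: ratfun_mult)
qed (use ratfun_const[of 1] in auto)

lemma ratfun_det:
  fixes M :: "('v::linorder ratfun) ^ 'n ^ 'n" and x :: "'v::linorder \<Rightarrow> 'k::field_char_0"
  assumes "\<And>i j. ratfun_defined (M $ i $ j) x"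
  shows "ratfun_defined (det M) x \<and> ratfun_eval (det M) x = det (\<chi> i j. ratfun_eval (M $ i $ j) x)"
proof -
  have s: "ratfun_defined (of_int (sign p)) x \<and> ratfun_eval (of_int (sign p)) x = of_int (sign p)"
    for p :: "'n \<Rightarrow> 'n"
    using ratfun_const[of "of_int (sign p)" x] by simp
  have p: "ratfun_defined (\<Prod>i\<in>UNIV. M $ i $ p i) x \<and>
      ratfun_eval (\<Prod>i\<in>UNIV. M $ i $ p i) x = (\<Prod>i\<in>UNIV. ratfun_eval (M $ i $ p i) x)" for p
    by (rule ratfun_prod) (rule assms)
  have "ratfun_defined (of_int (sign p) * (\<Prod>i\<in>UNIV. M $ i $ p i)) x \<and>
     ratfun_eval (of_int (sign p) * (\<Prod>i\<in>UNIV. M $ i $ p i)) x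
       = of_int (sign p) * (\<Prod>i\<in>UNIV. ratfun_eval (M $ i $ p i) x)" for p
    using s[of p] p[of p] by (simp add: ratfun_mult)
  then show ?thesis unfolding det_def by (simp add: ratfun_sum)
qed

lemma ratfun_mpoly_eval:
  fixes x :: "'v::linorder \<Rightarrow> 'k::field_char_0"
  assumes "\<And>i. ratfun_defined (f i) x"
  shows "ratfun_defined (mpoly_eval of_rat f p) x \<and>
    ratfun_eval (mpoly_eval of_rat f p) x = mpoly_eval of_rat (\<lambda>i. ratfun_eval (f i) x) p"
  by (induction p rule: mpoly_ring_induct)
    (use assms in \<open>simp_all add: mpoly_eval_simps ratfun_add ratfun_mult ratfun_const\<close>)

text \<open>Polynomials become their own values at the generic point.\<close>

lemma mpoly_eval_generic:
  "mpoly_eval of_rat (\<lambda>v. Fract (mvar v) 1) p = (Fract p 1 :: 'v::linorder ratfun)"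
proof (induction p rule: mpoly_ring_induct)
  case (const c)
  show ?case by (simp add: mpoly_eval_simps) (simp add: of_rat_ratfun)
qed (simp_all add: mpoly_eval_simps)

text \<open>Both rules are checked on numerators and denominators, where they reduce to the rules for
  polynomials.\<close>

lemma ratfun_deriv_derivation: "derivation_on UNIV (ratfun_deriv (v :: 'v::linorder))"
proof -
  have "ratfun_deriv v (f + g) = ratfun_deriv v f + ratfun_deriv v g \<and>
     ratfun_deriv v (f * g) = ratfun_deriv v f * g + f * ratfun_deriv v g" for f g :: "'v ratfun"
  proof (cases f, cases g)
    fix a b c d assume f: "f = Fract a b" "b \<noteq> 0" and g: "g = Fract c d" "d \<noteq> 0"
    then show ?thesis
      by (simp add: ratfun_deriv_Fract eq_fract mpoly_deriv_add mpoly_deriv_mult algebra_simps)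
  qed
  then show ?thesis by (simp add: derivation_on_def)
qed

lemma ratfun_deriv_const: "ratfun_deriv (v :: 'v::linorder) (of_rat q) = 0"
proof -
  have "mpoly_deriv v (1 :: ('v, rat) mpoly) = 0"
    using mpoly_deriv_const[of v "1::rat"] by simp
  then show ?thesis
    by (simp add: of_rat_ratfun ratfun_deriv_Fract mpoly_deriv_const Zero_fract_def)
qed

lemma ratfun_deriv_mpoly_eval:
  fixes p :: "('n::finite, rat) mpoly"
  shows "ratfun_deriv v (mpoly_eval of_rat f p) =
    (\<Sum>i\<in>UNIV. mpoly_eval of_rat f (mpoly_deriv i p) * ratfun_deriv v (f i))"
  using derivation_on_mpoly_eval[OF ratfun_deriv_derivation coeff_hom_of_rat, of v f p]
  by (simp add: ratfun_deriv_const)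

section \<open>Zeros of a polynomial on a grid\<close>

text \<open>Induction on the set of variables. As a polynomial in \<open>v\<close>, the polynomial \<open>p\<close> has some degree \<open>e\<close>
  and a leading coefficient \<open>q\<close> of total degree at most \<open>D - e\<close> in the other variables. A zero of
  \<open>p\<close> lies over a zero of \<open>q\<close>, or is one of at most \<open>e\<close> roots of a nonzero univariate polynomial. The
  additional factor \<open>card S\<close> on the left avoids the exponent \<open>card V - 1\<close>.\<close>

lemma schwartz_zippel:
  fixes p :: "('v, 'a::idom) mpoly"
  assumes "finite V" "finite S" "p \<noteq> 0"
    and "\<And>t. t \<in> Poly_Mapping.keys p \<Longrightarrow> Poly_Mapping.keys t \<subseteq> V"
    and "\<And>t. t \<in> Poly_Mapping.keys p \<Longrightarrow> (\<Sum>v\<in>V. Poly_Mapping.lookup t v) \<le> D"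
  shows "card {x \<in> Pi\<^sub>E V (\<lambda>_. S). mpoly_eval id x p = 0} * card S \<le> D * card S ^ card V"
  using assms(1,3-)
proof (induction V arbitrary: p D rule: finite_induct)
  case empty
  then have "Poly_Mapping.keys p \<subseteq> {0}" by fastforce
  moreover have "Poly_Mapping.keys p \<noteq> {}" using empty by simp
  ultimately have k: "Poly_Mapping.keys p = {0}" by blast
  then have "mpoly_eval id x p \<noteq> 0" for x
    by (auto simp: mpoly_eval_def monom_eval_def in_keys_iff)
  then have "{x \<in> Pi\<^sub>E {} (\<lambda>_. S). mpoly_eval id x p = 0} = {}" by blast
  then show ?case by (simp only: card.empty)
next
  case (insert v V)
  let ?K = "Poly_Mapping.keys p"
  define e where "e = Max ((\<lambda>t. Poly_Mapping.lookup t v) ` ?K)"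
  define T where "T = {t \<in> ?K. Poly_Mapping.lookup t v = e}"
  define rest where "rest t = t - Poly_Mapping.single v (Poly_Mapping.lookup t v)" for t :: "'v \<Rightarrow>\<^sub>0 nat"
  \<comment> \<open>The coefficient of \<open>v ^ e\<close>; it is nonzero since distinct terms stay distinct without \<open>v\<close>.\<close>
  define q where "q = (\<Sum>t\<in>T. Poly_Mapping.single (rest t) (Poly_Mapping.lookup p t))"
  have le_e: "Poly_Mapping.lookup t v \<le> e" if "t \<in> ?K" for t
    using that by (auto simp: e_def)
  have "e \<in> (\<lambda>t. Poly_Mapping.lookup t v) ` ?K"
    unfolding e_def using insert.prems(1) by (intro Max_in) auto
  then obtain t0 where t0: "t0 \<in> T" by (auto simp: T_def)
  have finT: "finite T" by (simp add: T_def)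
  have lookup_rest: "Poly_Mapping.lookup (rest t) w = (if w = v then 0 else Poly_Mapping.lookup t w)" for t w
    by (auto simp: rest_def lookup_minus lookup_single when_def)
  have split_rest: "t = rest t + Poly_Mapping.single v (Poly_Mapping.lookup t v)" for t
    by (intro poly_mapping_eqI) (auto simp: lookup_add lookup_rest lookup_single when_def)
  have inj: "inj_on rest T"
    by (rule inj_onI) (metis (mono_tags, lifting) T_def mem_Collect_eq split_rest)
  have "Poly_Mapping.lookup q (rest t0) = (\<Sum>t\<in>T. if t = t0 then Poly_Mapping.lookup p t else 0)"
    unfolding q_def lookup_sum
    by (intro sum.cong refl) (use inj t0 in \<open>auto simp: lookup_single when_def dest: inj_onD\<close>)
  also have "\<dots> \<noteq> 0" using t0 finT by (auto simp: T_def in_keys_iff)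
  finally have q0: "q \<noteq> 0" by auto
  have keys_q: "Poly_Mapping.keys q \<subseteq> rest ` T"
  proof
    fix s assume "s \<in> Poly_Mapping.keys q"
    then have "(\<Sum>t\<in>T. Poly_Mapping.lookup (Poly_Mapping.single (rest t) (Poly_Mapping.lookup p t)) s) \<noteq> 0"
      by (simp add: in_keys_iff q_def lookup_sum)
    then obtain t where "t \<in> T" "Poly_Mapping.lookup (Poly_Mapping.single (rest t) (Poly_Mapping.lookup p t)) s \<noteq> 0"
      by (metis (no_types, lifting) sum.neutral)
    then show "s \<in> rest ` T" by (auto simp: lookup_single when_def split: if_splits)
  qed
  have sumV: "(\<Sum>w\<in>V. Poly_Mapping.lookup (rest t) w) = (\<Sum>w\<in>V. Poly_Mapping.lookup t w)" for t
    using insert.hyps by (intro sum.cong) (auto simp: lookup_rest)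
  have deg: "(\<Sum>w\<in>V. Poly_Mapping.lookup t w) + e \<le> D" if "t \<in> T" for t
    using insert.prems(3)[of t] insert.hyps that by (auto simp: T_def)
  define Z where "Z = {x \<in> Pi\<^sub>E V (\<lambda>_. S). mpoly_eval id x q = 0}"
  have IH: "card Z * card S \<le> (D - e) * card S ^ card V"
    unfolding Z_def
  proof (rule insert.IH[OF q0])
    fix s assume "s \<in> Poly_Mapping.keys q"
    then obtain t where t: "t \<in> T" "s = rest t" using keys_q by auto
    show "Poly_Mapping.keys s \<subseteq> V"
    proof
      fix w assume "w \<in> Poly_Mapping.keys s"
      then have "w \<noteq> v" "w \<in> Poly_Mapping.keys t"
        by (auto simp: t in_keys_iff lookup_rest split: if_splits)
      then show "w \<in> V" using insert.prems(2)[of t] t by (auto simp: T_def)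
    qed
    show "(\<Sum>w\<in>V. Poly_Mapping.lookup s w) \<le> D - e" using deg[of t] t sumV[of t] by simp
  qed
  \<comment> \<open>The polynomial \<open>p\<close> as a univariate polynomial in \<open>v\<close>, the other variables being fixed.\<close>
  define U where "U x = (\<Sum>t\<in>?K. monom (Poly_Mapping.lookup p t * monom_eval x (rest t)) (Poly_Mapping.lookup t v))" for x
  have degU: "degree (U x) \<le> e" for x
    unfolding U_def by (intro degree_sum_le) (auto intro!: order_trans[OF degree_monom_le] le_e)
  have coeffU: "coeff (U x) e = mpoly_eval id x q" for x
  proof -
    have "coeff (U x) e = (\<Sum>t\<in>?K. if t \<in> T then Poly_Mapping.lookup p t * monom_eval x (rest t) else 0)"
      unfolding U_def coeff_sum by (intro sum.cong) (auto simp: T_def)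
    also have "\<dots> = (\<Sum>t\<in>T. Poly_Mapping.lookup p t * monom_eval x (rest t))"
      by (subst sum.inter_filter[symmetric]) (auto simp: T_def intro!: sum.cong)
    finally show ?thesis
      by (simp add: q_def mpoly_eval_sum mpoly_eval_single)
  qed
  have monom_cong: "monom_eval (x(v := s)) (rest t) = monom_eval x (rest t)" for x s t
    unfolding monom_eval_def by (intro prod.cong) (auto simp: in_keys_iff lookup_rest split: if_splits)
  have polyU: "poly (U x) s = mpoly_eval id (x(v := s)) p" for x s
  proof -
    have "monom_eval (x(v := s)) t = monom_eval x (rest t) * s ^ Poly_Mapping.lookup t v" for t
    proof -
      have "monom_eval (x(v := s)) (Poly_Mapping.single v k) = s ^ k" for k
        by (cases "k = 0") (auto simp: monom_eval_def)
      then show ?thesis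
        by (subst split_rest) (simp only: monom_eval_add monom_cong)
    qed
    then show ?thesis by (simp add: U_def mpoly_eval_def poly_sum poly_monom mult.assoc)
  qed
  \<comment> \<open>The zeros of \<open>p\<close> over points where the leading coefficient does not vanish.\<close>
  define B where "B = (SIGMA x:Pi\<^sub>E V (\<lambda>_. S) - Z. {s \<in> S. poly (U x) s = 0})"
  have finPi: "finite (Pi\<^sub>E V (\<lambda>_. S))" using insert.hyps assms(2) by (intro finite_PiE) auto
  have "card B = (\<Sum>x\<in>Pi\<^sub>E V (\<lambda>_. S) - Z. card {s \<in> S. poly (U x) s = 0})"
    unfolding B_def using finPi assms(2) by (subst card_SigmaI) auto
  also have "\<dots> \<le> (\<Sum>x\<in>Pi\<^sub>E V (\<lambda>_. S) - Z. e)"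
  proof (rule sum_mono)
    fix x assume x: "x \<in> Pi\<^sub>E V (\<lambda>_. S) - Z"
    then have "U x \<noteq> 0" using coeffU[of x] by (auto simp: Z_def)
    then have "card {s. poly (U x) s = 0} \<le> degree (U x)" "finite {s. poly (U x) s = 0}"
      by (auto simp: card_poly_roots_bound poly_roots_finite)
    then show "card {s \<in> S. poly (U x) s = 0} \<le> e"
      using degU[of x] card_mono[of "{s. poly (U x) s = 0}" "{s \<in> S. poly (U x) s = 0}"] by fastforce
  qed
  also have "\<dots> \<le> card S ^ card V * e"
    using card_mono[OF finPi, of "Pi\<^sub>E V (\<lambda>_. S) - Z"] insert.hyps by (simp add: card_PiE)
  finally have cardB: "card B \<le> card S ^ card V * e" .
  have finZ: "finite Z" using finPi by (simp add: Z_def)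
  have finB: "finite B" unfolding B_def using finPi assms(2) by (intro finite_SigmaI) auto
  have "{x \<in> Pi\<^sub>E (insert v V) (\<lambda>_. S). mpoly_eval id x p = 0} \<subseteq> (\<lambda>(x, s). x(v := s)) ` (Z \<times> S \<union> B)"
  proof
    fix y assume y: "y \<in> {x \<in> Pi\<^sub>E (insert v V) (\<lambda>_. S). mpoly_eval id x p = 0}"
    then obtain s x where sx: "s \<in> S" "x \<in> Pi\<^sub>E V (\<lambda>_. S)" "y = x(v := s)"
      unfolding PiE_insert_eq by auto
    then have "poly (U x) s = 0" using y polyU[of x s] by simp
    then have "(x, s) \<in> Z \<times> S \<union> B" using sx by (auto simp: B_def)
    then show "y \<in> (\<lambda>(x, s). x(v := s)) ` (Z \<times> S \<union> B)" using sx by force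
  qed
  then have "card {x \<in> Pi\<^sub>E (insert v V) (\<lambda>_. S). mpoly_eval id x p = 0} \<le> card (Z \<times> S \<union> B)"
    using finZ finB assms(2) by (intro surj_card_le) auto
  also have "\<dots> \<le> card Z * card S + card B"
    using card_Un_le[of "Z \<times> S" B] by (simp add: card_cartesian_product)
  also have "\<dots> \<le> (D - e) * card S ^ card V + e * card S ^ card V"
    using IH cardB by (simp add: mult.commute add_mono)
  also have "\<dots> = D * card S ^ card V" using deg[OF t0] by (simp flip: distrib_right)
  finally have "card {x \<in> Pi\<^sub>E (insert v V) (\<lambda>_. S). mpoly_eval id x p = 0} * card S
      \<le> D * card S ^ card V * card S" by (rule mult_right_mono) simp
  moreover have "D * card S ^ card V * card S = D * card S ^ card (insert v V)"
    using insert.hyps by simp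
  ultimately show ?case by (simp only:)
qed

lemma grid_eq_PiE: "(grid N :: (rat ^ 'm) set) = vec_lambda ` Pi\<^sub>E UNIV (\<lambda>_. of_nat ` {1..N})"
proof (intro equalityI subsetI)
  fix p :: "rat ^ 'm" assume "p \<in> grid N"
  then have "($) p \<in> Pi\<^sub>E UNIV (\<lambda>_. of_nat ` {1..N})" by (auto simp: grid_def)
  then show "p \<in> vec_lambda ` Pi\<^sub>E UNIV (\<lambda>_. of_nat ` {1..N})"
    by (intro image_eqI[of _ _ "($) p"]) auto
qed (auto simp: grid_def PiE_def Pi_def)

lemma card_grid_zeros:
  fixes p :: "('m::finite, rat) mpoly"
  assumes "p \<noteq> 0" "mpoly_degree_le p D"
  shows "card {x \<in> grid N. mpoly_eval of_rat (($) x) p = 0} * N \<le> D * card (grid N :: (rat ^ 'm) set)"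
proof -
  let ?S = "of_nat ` {1..N} :: rat set" and ?P = "Pi\<^sub>E UNIV (\<lambda>_. of_nat ` {1..N}) :: ('m \<Rightarrow> rat) set"
  have S: "card ?S = N" by (subst card_image) (auto simp: inj_on_def)
  have inj: "inj_on vec_lambda A" for A :: "('m \<Rightarrow> rat) set"
    by (auto simp: inj_on_def vec_lambda_inject)
  have "card ?P = N ^ CARD('m)" by (simp only: card_PiE[OF finite] S prod_constant)
  then have c: "card (grid N :: (rat ^ 'm) set) = N ^ CARD('m)"
    unfolding grid_eq_PiE by (simp add: card_image[OF inj])
  have "{x \<in> grid N. mpoly_eval of_rat (($) x) p = 0} = vec_lambda ` {x \<in> ?P. mpoly_eval id x p = 0}"
  proof -
    have "($) (vec_lambda f) = f" for f :: "'m \<Rightarrow> rat" by (simp add: fun_eq_iff)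
    then show ?thesis unfolding grid_eq_PiE by (auto simp: of_rat_eq_id)
  qed
  then have "card {x \<in> grid N. mpoly_eval of_rat (($) x) p = 0} = card {x \<in> ?P. mpoly_eval id x p = 0}"
    by (simp add: card_image[OF inj])
  then show ?thesis
    using schwartz_zippel[of UNIV ?S p D] assms by (simp add: S c mpoly_degree_le_iff del: One_nat_def)
qed

lemma exists_nonzero_value:
  fixes p :: "('m::finite, rat) mpoly"
  assumes "p \<noteq> 0"
  shows "\<exists>x :: rat ^ 'm. mpoly_eval of_rat (($) x) p \<noteq> 0"
proof (rule ccontr)
  assume "\<not> ?thesis"
  then have z: "mpoly_eval of_rat (($) x) p = 0" for x :: "rat ^ 'm" by blast
  define D where "D = (\<Sum>t\<in>Poly_Mapping.keys p. \<Sum>v\<in>UNIV. Poly_Mapping.lookup t v)"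
  have "mpoly_degree_le p D"
    unfolding mpoly_degree_le_iff D_def by (auto intro: member_le_sum)
  from card_grid_zeros[OF assms this, of "Suc D"] z
  have "card (grid (Suc D) :: (rat ^ 'm) set) * Suc D \<le> D * card (grid (Suc D) :: (rat ^ 'm) set)" by simp
  moreover have "card (grid (Suc D) :: (rat ^ 'm) set) > 0"
    using grid_finite_nonempty[of "Suc D", where 'm = 'm] by (simp add: card_gt_0_iff)
  ultimately show False by simp
qed

section \<open>Extension of derivations and the generic tangent space\<close>

lemma derivation_on_0: "derivation_on R D \<Longrightarrow> D 0 = 0"
  unfolding derivation_on_def by (metis add_cancel_right_right)

lemma derivation_on_sum:
  assumes "derivation_on R D" "\<And>i. i \<in> I \<Longrightarrow> f i \<in> R"
  shows "(\<Sum>i\<in>I. f i) \<in> R \<and> D (\<Sum>i\<in>I. f i) = (\<Sum>i\<in>I. D (f i))"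
  using assms(2)
proof (induction I rule: infinite_finite_induct)
  case (insert i I)
  then show ?case using assms(1) by (simp add: derivation_on_def)
qed (use assms(1) derivation_on_0[OF assms(1)] in \<open>auto simp: derivation_on_def\<close>)

lemma derivation_on_of_nat:
  assumes "derivation_on R D" shows "of_nat k \<in> R"
  by (induction k) (use assms in \<open>auto simp: derivation_on_def\<close>)

text \<open>A derivation \<open>D\<close> of \<open>R\<close> extends to \<open>R[h]\<close>. An extension with \<open>D h = c\<close> must send \<open>Q(h)\<close> to
  \<open>Q\<^sup>D(h) + c Q'(h)\<close>, where \<open>Q\<^sup>D\<close> arises by differentiating coefficients, and this is well defined if
  it vanishes whenever \<open>Q(h) = 0\<close>. If \<open>h\<close> is transcendental over \<open>R\<close>, then any \<open>c\<close> will do. Otherwise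
  take a relation \<open>P\<close> of minimal degree: \<open>P'(h) \<noteq> 0\<close> in characteristic \<open>0\<close>, so the condition for \<open>P\<close>
  determines \<open>c\<close>, and the other relations follow by division with remainder.\<close>

lemma derivation_on_extend:
  fixes h :: "'k::field_char_0"
  assumes D: "derivation_on R D"
  shows "\<exists>R' D'. R \<subseteq> R' \<and> h \<in> R' \<and> derivation_on R' D' \<and> (\<forall>a\<in>R. D' a = D a)"
proof -
  define C where "C = {P :: 'k poly. \<forall>i. coeff P i \<in> R}"
  define ev where "ev c P = poly (map_poly D P) h + c * poly (pderiv P) h" for c P
  have D0: "D 0 = 0" using derivation_on_0[OF D] .
  have R: "0 \<in> R" "1 \<in> R" "\<And>a. a \<in> R \<Longrightarrow> - a \<in> R" "\<And>a b. a \<in> R \<Longrightarrow> b \<in> R \<Longrightarrow> a + b \<in> R"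
    "\<And>a b. a \<in> R \<Longrightarrow> b \<in> R \<Longrightarrow> a * b \<in> R" using D by (auto simp: derivation_on_def)
  have Dadd: "D (a + b) = D a + D b" and Dmult: "D (a * b) = D a * b + a * D b"
    if "a \<in> R" "b \<in> R" for a b using D that by (auto simp: derivation_on_def)
  have C_add: "P + Q \<in> C" if "P \<in> C" "Q \<in> C" for P Q using that R by (auto simp: C_def)
  have C_neg: "- P \<in> C" if "P \<in> C" for P using that R by (auto simp: C_def)
  have C_mult: "P * Q \<in> C" if "P \<in> C" "Q \<in> C" for P Q
    using that R by (auto simp: C_def coeff_mult intro!: derivation_on_sum[OF D, THEN conjunct1])
  have C_const: "[:a:] \<in> C" if "a \<in> R" for a
    using that R by (auto simp: C_def coeff_pCons split: nat.splits)
  have C_monom: "monom a k \<in> C" if "a \<in> R" for a k using that R by (auto simp: C_def)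
  have C_pderiv: "pderiv P \<in> C" if "P \<in> C" for P
    using that R(5)[OF derivation_on_of_nat[OF D]] by (auto simp: C_def coeff_pderiv simp del: of_nat_Suc)
  have md_add: "map_poly D (P + Q) = map_poly D P + map_poly D Q" if "P \<in> C" "Q \<in> C" for P Q
    using that by (intro poly_eqI) (auto simp: coeff_map_poly D0 C_def Dadd)
  have md_mult: "map_poly D (P * Q) = map_poly D P * Q + P * map_poly D Q" if "P \<in> C" "Q \<in> C" for P Q
  proof (rule poly_eqI)
    fix n
    have "coeff (map_poly D (P * Q)) n = D (\<Sum>i\<le>n. coeff P i * coeff Q (n - i))"
      by (simp add: coeff_map_poly D0 coeff_mult)
    also have "\<dots> = (\<Sum>i\<le>n. D (coeff P i * coeff Q (n - i)))"
      using that R by (intro derivation_on_sum[OF D, THEN conjunct2]) (auto simp: C_def)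
    also have "\<dots> = (\<Sum>i\<le>n. D (coeff P i) * coeff Q (n - i) + coeff P i * D (coeff Q (n - i)))"
      using that by (intro sum.cong refl Dmult) (auto simp: C_def)
    finally show "coeff (map_poly D (P * Q)) n = coeff (map_poly D P * Q + P * map_poly D Q) n"
      by (simp add: coeff_map_poly D0 coeff_mult sum.distrib)
  qed
  have ev_add: "ev c (P + Q) = ev c P + ev c Q" if "P \<in> C" "Q \<in> C" for c P Q
    using md_add[OF that] by (simp add: ev_def pderiv_add algebra_simps)
  have ev_mult: "ev c (P * Q) = ev c P * poly Q h + poly P h * ev c Q" if "P \<in> C" "Q \<in> C" for c P Q
    using md_mult[OF that] by (simp add: ev_def pderiv_mult algebra_simps)
  have "\<exists>c. \<forall>Q\<in>C. poly Q h = 0 \<longrightarrow> ev c Q = 0"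
  proof (cases "\<exists>P. P \<in> C \<and> P \<noteq> 0 \<and> poly P h = 0")
    case False
    then show ?thesis by (intro exI[of _ 0]) (auto simp: ev_def)
  next
    case True
    from ex_has_least_nat[of "\<lambda>P. P \<in> C \<and> P \<noteq> 0 \<and> poly P h = 0" _ degree] True
    obtain P where P: "P \<in> C" "P \<noteq> 0" "poly P h = 0"
      and least: "\<And>Q. Q \<in> C \<Longrightarrow> Q \<noteq> 0 \<Longrightarrow> poly Q h = 0 \<Longrightarrow> degree P \<le> degree Q" by metis
    have deg: "degree P \<noteq> 0"
    proof
      assume "degree P = 0"
      then obtain a where "P = [:a:]" by (rule degree_eq_zeroE)
      then show False using P by simp
    qed
    have "pderiv P \<noteq> 0" using deg by (simp add: pderiv_eq_0_iff)
    moreover have "degree (pderiv P) < degree P" using deg by (simp add: degree_pderiv)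
    ultimately have nz: "poly (pderiv P) h \<noteq> 0"
      using least[OF C_pderiv[OF P(1)]] by fastforce
    \<comment> \<open>The only value for which the condition holds for \<open>P\<close> itself.\<close>
    define c where "c = - poly (map_poly D P) h / poly (pderiv P) h"
    have evP: "ev c P = 0" using nz by (simp add: ev_def c_def)
    have "ev c Q = 0" if "Q \<in> C" "poly Q h = 0" for Q
      using that
    proof (induction "degree Q" arbitrary: Q rule: less_induct)
      case less
      show ?case
      proof (cases "Q = 0")
        case True
        then show ?thesis by (simp add: ev_def)
      next
        case False
        then have le: "degree P \<le> degree Q" using least less by blast
        define k where "k = degree Q - degree P"
        define A where "A = [:lead_coeff P:]"
        define B where "B = - monom (lead_coeff Q) k"
        \<comment> \<open>One step of pseudo-division, which stays within polynomials over \<open>R\<close>.\<close>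
        define Q' where "Q' = A * Q + B * P"
        have lR: "lead_coeff P \<in> R" "lead_coeff Q \<in> R" using P less by (auto simp: C_def)
        have AB: "A \<in> C" "B \<in> C" using lR C_const C_monom C_neg by (auto simp: A_def B_def)
        have Q'C: "Q' \<in> C" using AB P less C_add C_mult by (auto simp: Q'_def)
        have Q'h: "poly Q' h = 0" using P less by (simp add: Q'_def)
        have "degree Q' < degree Q \<or> Q' = 0"
        proof -
          have "degree (B * P) \<le> degree Q"
            using le degree_monom_le[of "lead_coeff Q" k] degree_mult_le[of B P] by (auto simp: B_def k_def)
          then have d: "degree Q' \<le> degree Q"
            unfolding Q'_def A_def by (intro degree_add_le) (auto simp: P)
          have "coeff (B * P) (degree Q) = - lead_coeff Q * lead_coeff P"
            using le coeff_monom_mult[of "lead_coeff Q" k P "degree Q"] by (auto simp: B_def k_def)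
          then have "coeff Q' (degree Q) = 0" by (simp add: Q'_def A_def)
          then show ?thesis using d by (metis le_neq_implies_less leading_coeff_0_iff)
        qed
        then have "ev c Q' = 0" using less.hyps[OF _ Q'C Q'h] by (auto simp: ev_def)
        moreover have "ev c Q' = lead_coeff P * ev c Q"
          unfolding Q'_def using AB P less C_mult
          by (simp add: ev_add ev_mult evP) (simp add: A_def)
        ultimately show ?thesis using P by simp
      qed
    qed
    then show ?thesis by blast
  qed
  then obtain c where c: "\<And>Q. Q \<in> C \<Longrightarrow> poly Q h = 0 \<Longrightarrow> ev c Q = 0" by blast
  define R' where "R' = (\<lambda>Q. poly Q h) ` C"
  \<comment> \<open>The choice of \<open>Q\<close> does not matter, since two choices differ by a relation.\<close>
  define D' where "D' z = ev c (SOME Q. Q \<in> C \<and> poly Q h = z)" for z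
  have D': "D' (poly Q h) = ev c Q" if Q: "Q \<in> C" for Q
  proof -
    define Q' where "Q' = (SOME Q'. Q' \<in> C \<and> poly Q' h = poly Q h)"
    have Q': "Q' \<in> C \<and> poly Q' h = poly Q h" unfolding Q'_def by (rule someI) (use Q in auto)
    have diff: "Q' + (- Q) \<in> C" using Q' Q C_add C_neg by blast
    then have "ev c (Q' + (- Q)) = 0" by (rule c) (use Q' in simp)
    then have "ev c (Q' + (- Q) + Q) = ev c Q" by (simp only: ev_add[OF diff Q] add_0)
    then show ?thesis by (simp add: D'_def flip: Q'_def)
  qed
  have "derivation_on R' D'"
    unfolding derivation_on_def
  proof (intro conjI ballI)
    show "0 \<in> R'" using C_const[of 0] R by (auto simp: R'_def intro!: image_eqI[of _ _ "[:0:]"])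
    show "1 \<in> R'" using C_const[of 1] R by (auto simp: R'_def intro!: image_eqI[of _ _ "[:1:]"])
  next
    fix a assume "a \<in> R'"
    then show "- a \<in> R'" using C_neg unfolding R'_def by (auto intro!: image_eqI[of _ _ "- _"])
  next
    fix a b assume "a \<in> R'" "b \<in> R'"
    then obtain P Q where PQ: "P \<in> C" "Q \<in> C" "a = poly P h" "b = poly Q h" by (auto simp: R'_def)
    show "a + b \<in> R'" "a * b \<in> R'"
      unfolding R'_def PQ poly_add[symmetric] poly_mult[symmetric]
      by (rule imageI C_add C_mult PQ)+
    show "D' (a + b) = D' a + D' b"
      using D'[OF C_add[OF PQ(1,2)]] D'[OF PQ(1)] D'[OF PQ(2)] ev_add[OF PQ(1,2)] PQ by simp
    show "D' (a * b) = D' a * b + a * D' b"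
      using D'[OF C_mult[OF PQ(1,2)]] D'[OF PQ(1)] D'[OF PQ(2)] ev_mult[OF PQ(1,2)] PQ by simp
  qed
  moreover have "R \<subseteq> R'"
    using C_const by (auto simp: R'_def intro!: image_eqI[of _ _ "[:_:]"])
  moreover have "h \<in> R'"
    using C_monom[of 1 1] R by (auto simp: R'_def poly_monom intro!: image_eqI[of _ _ "monom 1 1"])
  moreover have "D' a = D a" if "a \<in> R" for a
    using D'[OF C_const[OF that]] by (simp add: ev_def map_poly_pCons D0 pderiv_pCons)
  ultimately show ?thesis by blast
qed

text \<open>A vector annihilated by the gradients of all polynomial relations between the \<open>f i\<close> is tangent,
  that is, in the column space of the Jacobian: the hypothesis makes \<open>f i \<mapsto> w i\<close> a derivation of
  \<open>\<rat>[f]\<close>. Extended to the variables \<open>x\<^sub>j\<close> it takes some values \<open>c j\<close> there, and the coefficients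
  \<open>c j\<close> express \<open>w\<close> through the partial derivatives.\<close>

lemma annihilates_relations_imp_jacobian_span:
  fixes f :: "'n::finite \<Rightarrow> 'm::{finite,linorder} ratfun"
  assumes w: "\<And>p :: ('n, rat) mpoly. mpoly_eval of_rat f p = 0 \<Longrightarrow>
     (\<Sum>i\<in>UNIV. mpoly_eval of_rat f (mpoly_deriv i p) * w i) = 0"
  shows "\<exists>c. \<forall>i. w i = (\<Sum>j\<in>UNIV. c j * ratfun_deriv j (f i))"
proof -
  define ev :: "('n, rat) mpoly \<Rightarrow> 'm ratfun" where "ev = mpoly_eval of_rat f"
  define d where "d p = (\<Sum>i\<in>UNIV. ev (mpoly_deriv i p) * w i)" for p
  define R0 where "R0 = range ev"
  \<comment> \<open>Well defined by the hypothesis on \<open>w\<close>, although \<open>z\<close> has many representations.\<close>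
  define D0 where "D0 z = d (SOME p. ev p = z)" for z
  note ev_simps = mpoly_eval_simps[OF coeff_hom_of_rat, of f, folded ev_def]
  have ev_minus: "ev (- p) = - ev p" for p
    using mpoly_eval_minus[OF coeff_hom_of_rat, of f p] by (simp add: ev_def)
  have d_add: "d (p + q) = d p + d q" for p q
    by (simp add: d_def mpoly_deriv_add ev_simps distrib_right sum.distrib)
  have d_mult: "d (p * q) = d p * ev q + ev p * d q" for p q
    by (simp add: d_def mpoly_deriv_mult ev_simps sum_distrib_left sum_distrib_right
        sum.distrib algebra_simps)
  have D0: "D0 (ev p) = d p" for p
  proof -
    define q where "q = (SOME q. ev q = ev p)"
    have q: "ev q = ev p" unfolding q_def by (rule someI) (rule refl)
    have "d (q + - p) = 0" unfolding d_def ev_def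
      by (rule w) (use q in \<open>simp add: ev_def[symmetric] ev_simps ev_minus del: add_uminus_conv_diff\<close>)
    then have "d (q + - p + p) = d p" unfolding d_add by simp
    then show ?thesis by (simp add: D0_def q_def)
  qed
  have der0: "derivation_on R0 D0"
    unfolding derivation_on_def R0_def
  proof (intro conjI ballI; (elim rangeE)?)
    show "0 \<in> range ev" "1 \<in> range ev" using ev_simps(5,6) by (metis rangeI)+
  next
    fix a p assume "a = ev p" then show "- a \<in> range ev" using ev_minus[of p] by (metis rangeI)
  next
    fix a b p q assume *: "a = ev p" "b = ev q"
    show "a + b \<in> range ev" "a * b \<in> range ev" unfolding * using ev_simps(1,2) by (metis rangeI)+
    show "D0 (a + b) = D0 a + D0 b" unfolding * D0 d_add[symmetric] ev_simps(1)[symmetric] ..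
    show "D0 (a * b) = D0 a * b + a * D0 b" unfolding * D0 d_mult[symmetric] ev_simps(2)[symmetric] ..
  qed
  have "\<exists>R D. R0 \<subseteq> R \<and> (\<forall>j\<in>J. Fract (mvar j) 1 \<in> R) \<and> derivation_on R D \<and> (\<forall>a\<in>R0. D a = D0 a)"
    for J :: "'m set"
  proof (induction J rule: infinite_finite_induct)
    case (insert j J)
    then obtain R D where RD: "R0 \<subseteq> R" "\<And>j. j \<in> J \<Longrightarrow> Fract (mvar j) 1 \<in> R" "derivation_on R D"
      "\<And>a. a \<in> R0 \<Longrightarrow> D a = D0 a" by blast
    obtain R' D' where "R \<subseteq> R'" "Fract (mvar j) 1 \<in> R'" "derivation_on R' D'" "\<And>a. a \<in> R \<Longrightarrow> D' a = D a"
      using derivation_on_extend[OF RD(3), of "Fract (mvar j) 1"] by blast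
    then show ?case using RD by (intro exI[of _ R'] exI[of _ D']) auto
  qed (use der0 in auto)
  from this[of UNIV] obtain R D where RD: "R0 \<subseteq> R" "\<And>j. Fract (mvar j) 1 \<in> R" "derivation_on R D"
    "\<And>a. a \<in> R0 \<Longrightarrow> D a = D0 a" by blast
  have const: "of_rat q \<in> R0" "D (of_rat q) = 0" for q
  proof -
    have q: "of_rat q = ev (mconst q)" by (simp add: ev_simps)
    then show "of_rat q \<in> R0" by (simp add: R0_def)
    then have "D (of_rat q) = d (mconst q)" using RD(4) q D0 by simp
    then show "D (of_rat q) = 0" by (simp add: d_def mpoly_deriv_const ev_simps)
  qed
  have fi: "f i \<in> R0" "D (f i) = w i" for i
  proof -
    have i: "f i = ev (mvar i)" by (simp add: ev_simps)
    then show "f i \<in> R0" by (simp add: R0_def)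
    then have "D (f i) = d (mvar i)" using RD(4) i D0 by simp
    also have "\<dots> = (\<Sum>k\<in>UNIV. if k = i then w k else 0)"
      unfolding d_def by (intro sum.cong) (auto simp: mpoly_deriv_var ev_simps)
    finally show "D (f i) = w i" by simp
  qed
  have poly: "Fract p 1 \<in> R \<and> D (Fract p 1) = (\<Sum>j\<in>UNIV. Fract (mpoly_deriv j p) 1 * D (Fract (mvar j) 1))"
    for p :: "('m, rat) mpoly"
    using derivation_on_mpoly_eval[OF RD(3) coeff_hom_of_rat, of "\<lambda>j. Fract (mvar j) 1" p] const RD(1,2)
    by (auto simp: mpoly_eval_generic)
  have pd: "ratfun_deriv j (Fract p 1) = Fract (mpoly_deriv j p) 1" for j and p :: "('m, rat) mpoly"
    using mpoly_deriv_const[of j "1::rat"] by (simp add: ratfun_deriv_Fract)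
  define c where "c j = D (Fract (mvar j) 1)" for j
  have "w i = (\<Sum>j\<in>UNIV. c j * ratfun_deriv j (f i))" for i
  proof (cases "f i")
    case (Fract a b)
    \<comment> \<open>Apply the derivation, and every partial derivative, to \<open>a = b \<cdot> f i\<close>. As \<open>a\<close> and \<open>b\<close> are polynomials
    in the \<open>x\<^sub>j\<close>, the chain rule computes both sides, and comparison leaves \<open>w i\<close>.\<close>
    have e: "Fract a 1 = Fract b 1 * f i" and bnz: "Fract b 1 \<noteq> 0"
      using Fract by (auto simp: eq_fract Zero_fract_def)
    have "D (Fract a 1) = D (Fract b 1) * f i + Fract b 1 * w i"
      unfolding e using RD(1,3) poly[of b] fi[of i] by (auto simp: derivation_on_def)
    moreover have "D (Fract a 1) = (\<Sum>j\<in>UNIV. (Fract (mpoly_deriv j b) 1 * f i + Fract b 1 * ratfun_deriv j (f i)) * c j)"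
    proof -
      have "Fract (mpoly_deriv j a) 1 = Fract (mpoly_deriv j b) 1 * f i + Fract b 1 * ratfun_deriv j (f i)" for j
        using arg_cong[OF e, of "ratfun_deriv j"] ratfun_deriv_derivation[of j]
        by (simp only: pd derivation_on_def) (simp add: pd)
      then show ?thesis using poly[of a] by (simp add: c_def)
    qed
    moreover have "D (Fract b 1) = (\<Sum>j\<in>UNIV. Fract (mpoly_deriv j b) 1 * c j)"
      using poly[of b] by (simp add: c_def)
    ultimately have "Fract b 1 * w i = Fract b 1 * (\<Sum>j\<in>UNIV. c j * ratfun_deriv j (f i))"
      by (simp add: distrib_right sum.distrib sum_distrib_left sum_distrib_right algebra_simps)
    then show ?thesis using bnz by simp
  qed
  then show ?thesis by blast
qed

section \<open>Complex numbers as a rational vector space\<close>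

interpretation rat_complex: vector_space "\<lambda>(q::rat) (z::complex). of_rat q * z"
  by unfold_locales (simp_all add: of_rat_add of_rat_mult algebra_simps)

definition rat_independent :: "complex set \<Rightarrow> bool" where
  "rat_independent C \<longleftrightarrow> finite C \<and>
     (\<forall>r. (\<Sum>c\<in>C. of_rat (r c) * c) = 0 \<longrightarrow> (\<forall>c\<in>C. r c = 0))"

lemma rational_coordinates:
  fixes z :: "'i \<Rightarrow> complex"
  assumes "finite I"
  obtains C q where "rat_independent C" "\<And>i. i \<in> I \<Longrightarrow> z i = (\<Sum>c\<in>C. of_rat (q i c) * c)"
proof -
  obtain C where C: "C \<subseteq> z ` I" "rat_complex.independent C" "z ` I \<subseteq> rat_complex.span C"
    using rat_complex.maximal_independent_subset[of "z ` I"] by auto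
  have fin: "finite C" using C(1) assms by (auto intro: finite_subset)
  have "\<exists>r. z i = (\<Sum>c\<in>C. of_rat (r c) * c)" if "i \<in> I" for i
    using C(3) that unfolding rat_complex.span_finite[OF fin] by auto
  then obtain q where "\<And>i. i \<in> I \<Longrightarrow> z i = (\<Sum>c\<in>C. of_rat (q i c) * c)" by metis
  moreover have "rat_independent C"
    using C(2) fin by (auto simp: rat_independent_def rat_complex.dependent_finite)
  ultimately show thesis by (rule that[rotated])
qed

text \<open>A complex polynomial is a combination of rational ones with \<open>\<rat>\<close>-independent coefficients. It
  vanishes at a rational point only if all these rational polynomials do.\<close>

lemma mpoly_rational_coordinates:
  fixes p :: "('n, complex) mpoly"
  obtains C P where "rat_independent C"
    "\<And>x. mpoly_eval id x p = (\<Sum>c\<in>C. mpoly_eval of_rat x (P c) * c)"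
    "\<And>i x. mpoly_eval id x (mpoly_deriv i p) = (\<Sum>c\<in>C. mpoly_eval of_rat x (mpoly_deriv i (P c)) * c)"
proof -
  let ?K = "Poly_Mapping.keys p"
  obtain C q where C: "rat_independent C"
    and q: "\<And>t. t \<in> ?K \<Longrightarrow> Poly_Mapping.lookup p t = (\<Sum>c\<in>C. of_rat (q t c) * c)"
    using rational_coordinates[of ?K "Poly_Mapping.lookup p"] by auto
  define P where "P c = (\<Sum>t\<in>?K. Poly_Mapping.single t (q t c))" for c
  have 1: "mpoly_eval id x p = (\<Sum>c\<in>C. mpoly_eval of_rat x (P c) * c)" for x
  proof -
    have "mpoly_eval id x p = (\<Sum>t\<in>?K. (\<Sum>c\<in>C. of_rat (q t c) * c) * monom_eval x t)"
      by (simp add: mpoly_eval_def q)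
    also have "\<dots> = (\<Sum>c\<in>C. \<Sum>t\<in>?K. of_rat (q t c) * monom_eval x t * c)"
      unfolding sum_distrib_right by (subst sum.swap) (simp add: mult_ac)
    finally show ?thesis
      by (simp add: P_def mpoly_eval_sum mpoly_eval_single sum_distrib_right)
  qed
  have 2: "mpoly_eval id x (mpoly_deriv i p) = (\<Sum>c\<in>C. mpoly_eval of_rat x (mpoly_deriv i (P c)) * c)" for i x
  proof -
    let ?d = "\<lambda>t. t - Poly_Mapping.single i 1"
    have "mpoly_eval id x (mpoly_deriv i p)
       = (\<Sum>t\<in>?K. of_nat (Poly_Mapping.lookup t i) * (\<Sum>c\<in>C. of_rat (q t c) * c) * monom_eval x (?d t))"
      by (simp add: mpoly_deriv_def mpoly_eval_sum mpoly_eval_single q)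
    also have "\<dots> = (\<Sum>c\<in>C. \<Sum>t\<in>?K. of_nat (Poly_Mapping.lookup t i) * of_rat (q t c) * monom_eval x (?d t) * c)"
      unfolding sum_distrib_right sum_distrib_left by (subst sum.swap) (simp add: mult_ac)
    finally show ?thesis
      by (simp add: P_def mpoly_deriv_sum mpoly_deriv_single mpoly_eval_sum mpoly_eval_single
          sum_distrib_right of_rat_mult)
  qed
  show thesis using that[OF C 1 2] .
qed

lemma mscale_nth [simp]: "mscale c A $ i $ j = c * A $ i $ j"
  by (simp add: mscale_def map_matrix_def)

lemma map_matrix_nth [simp]: "map_matrix f A $ i $ j = f (A $ i $ j)"
  by (simp add: map_matrix_def)

lemma matrix_sum_nth: "(\<Sum>k\<in>I. F k) $ i $ j = (\<Sum>k\<in>I. F k $ i $ j :: 'a::comm_monoid_add)"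
  by (induction I rule: infinite_finite_induct) auto

lemma matrix_rational_coordinates:
  fixes A :: "complex ^ 'n ^ 'n"
  obtains C Q where "rat_independent C" "A = (\<Sum>c\<in>C. mscale c (map_matrix of_rat (Q c)))"
proof -
  obtain C q where C: "rat_independent C"
    and q: "\<And>ij. A $ fst ij $ snd ij = (\<Sum>c\<in>C. of_rat (q ij c) * c)"
    using rational_coordinates[of UNIV "\<lambda>ij. A $ fst ij $ snd ij"] by auto
  have "A = (\<Sum>c\<in>C. mscale c (map_matrix of_rat (\<chi> i j. q (i, j) c)))"
    using q[of "(_, _)"] by (simp add: vec_eq_iff matrix_sum_nth mult.commute)
  then show thesis by (rule that[OF C, of "\<lambda>c. \<chi> i j. q (i, j) c"])
qed

text \<open>When \<open>V\<close> is the set of rational points of \<open>W\<close>, in the strong sense that the rational components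
  of every element of \<open>W\<close> lie in \<open>V\<close>, a rational basis of \<open>V\<close> is a complex basis of \<open>W\<close>. Spanning is
  seen on the components of an element; for independence, a complex relation between rational
  matrices splits into rational relations.\<close>

lemma is_basis_complexification:
  fixes W :: "(complex ^ 'n ^ 'n) set" and V :: "(rat ^ 'n ^ 'n) set"
  assumes B: "is_basis mscale B V"
    and W: "mat.subspace W"
    and VW: "\<And>A. A \<in> V \<Longrightarrow> map_matrix of_rat A \<in> W"
    and WV: "\<And>C Q c. rat_independent C \<Longrightarrow> (\<Sum>c\<in>C. mscale c (map_matrix of_rat (Q c))) \<in> W \<Longrightarrow> c \<in> C \<Longrightarrow> Q c \<in> V"
  shows "is_basis mscale (map_matrix of_rat ` B) W"
proof -
  let ?h = "map_matrix of_rat :: rat ^ 'n ^ 'n \<Rightarrow> complex ^ 'n ^ 'n"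
  have indB: "mat.independent B" and spanB: "mat.span B = V" using B by (auto simp: is_basis_def)
  have inj: "inj ?h" by (auto simp: inj_def vec_eq_iff)
  have span_h: "?h A \<in> mat.span (?h ` B)" if "A \<in> mat.span B" for A
    using that
  proof (induction rule: mat.span_induct_alt)
    case base
    have "?h 0 = 0" by (simp add: vec_eq_iff)
    then show ?case by (simp add: mat.span_zero)
  next
    case (step c x y)
    have "?h (mscale c x + y) = mscale (of_rat c) (?h x) + ?h y"
      by (simp add: vec_eq_iff of_rat_add of_rat_mult)
    then show ?case using step by (auto intro: mat.span_add mat.span_scale mat.span_base)
  qed
  have "mat.span (?h ` B) = W"
  proof
    show "mat.span (?h ` B) \<subseteq> W"
      using VW spanB mat.span_base[of _ B] by (intro mat.span_minimal W) auto
    show "W \<subseteq> mat.span (?h ` B)"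
    proof
      fix A assume A: "A \<in> W"
      obtain C Q where C: "rat_independent C" and AQ: "A = (\<Sum>c\<in>C. mscale c (?h (Q c)))"
        by (rule matrix_rational_coordinates)
      show "A \<in> mat.span (?h ` B)"
        unfolding AQ using WV[OF C] A AQ spanB
        by (intro mat.span_sum mat.span_scale span_h) auto
    qed
  qed
  moreover have "mat.independent (?h ` B)"
    unfolding mat.dependent_explicit
  proof (rule notI, elim exE conjE bexE)
    fix t u v assume t: "finite t" "t \<subseteq> ?h ` B" and sum0: "(\<Sum>v\<in>t. mscale (u v) v) = 0"
      and v: "v \<in> t" "u v \<noteq> 0"
    obtain T where T: "T \<subseteq> B" "t = ?h ` T" using t(2) by (meson subset_imageE)
    have finT: "finite T" using t(1) T(2) inj by (simp add: finite_image_iff inj_on_subset)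
    obtain C q where C: "rat_independent C"
      and q: "\<And>b. b \<in> T \<Longrightarrow> u (?h b) = (\<Sum>c\<in>C. of_rat (q b c) * c)"
      using rational_coordinates[OF finT, of "\<lambda>b. u (?h b)"] by auto
    have "(\<Sum>b\<in>T. mscale (q b c) b) = 0" if c: "c \<in> C" for c
    proof -
      have "(\<Sum>b\<in>T. mscale (q b c) b) $ i $ j = 0" for i j
      proof -
        have "0 = (\<Sum>b\<in>T. u (?h b) * of_rat (b $ i $ j))"
          using arg_cong[OF sum0, of "\<lambda>M. M $ i $ j"] inj
          by (simp add: T(2) sum.reindex inj_on_subset[OF inj] matrix_sum_nth)
        also have "\<dots> = (\<Sum>b\<in>T. \<Sum>c\<in>C. of_rat (q b c) * c * of_rat (b $ i $ j))"
          by (intro sum.cong) (auto simp: q sum_distrib_right)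
        also have "\<dots> = (\<Sum>c\<in>C. \<Sum>b\<in>T. of_rat (q b c) * c * of_rat (b $ i $ j))"
          by (rule sum.swap)
        also have "\<dots> = (\<Sum>c\<in>C. of_rat (\<Sum>b\<in>T. q b c * b $ i $ j) * c)"
          by (intro sum.cong refl) (simp add: of_rat_sum of_rat_mult sum_distrib_left mult_ac)
        finally have zero: "(\<Sum>c\<in>C. of_rat (\<Sum>b\<in>T. q b c * b $ i $ j) * c) = 0" by (rule sym)
        have independent: "\<forall>c\<in>C. r c = 0" if "(\<Sum>c\<in>C. of_rat (r c) * c) = 0" for r
          using C that unfolding rat_independent_def by blast
        have "\<forall>c\<in>C. (\<Sum>b\<in>T. q b c * b $ i $ j) = 0"
          by (rule independent) (fact zero)
        then show ?thesis using c by (simp add: matrix_sum_nth)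
      qed
      then show ?thesis by (simp add: vec_eq_iff)
    qed
    then have "q b c = 0" if "b \<in> T" "c \<in> C" for b c
      by (rule mat.independentD[OF indB finT T(1)]) (use that in auto)
    then have "u (?h b) = 0" if "b \<in> T" for b using q[OF that] that by simp
    then show False using v T(2) by auto
  qed
  ultimately show ?thesis by (simp add: is_basis_def)
qed

section \<open>One-parameter groups and the Lie algebra of a stabilizer\<close>

primrec matrix_power :: "complex ^ 'n ^ 'n \<Rightarrow> nat \<Rightarrow> complex ^ 'n ^ 'n" where
  "matrix_power A 0 = mat 1"
| "matrix_power A (Suc k) = A ** matrix_power A k"

definition matrix_exp :: "complex ^ 'n ^ 'n \<Rightarrow> complex \<Rightarrow> complex ^ 'n ^ 'n" where
  "matrix_exp A t = (\<chi> i j. suminf (\<lambda>k. matrix_power A k $ i $ j / fact k * t ^ k))"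

lemma matrix_power_commute: "matrix_power A k ** A = A ** matrix_power A k"
  by (induction k) (simp_all add: matrix_mul_assoc[symmetric])

lemma matrix_power_bound:
  "norm (matrix_power A k $ i $ j) \<le> (\<Sum>i\<in>UNIV. \<Sum>l\<in>UNIV. norm (A $ i $ l)) ^ k"
proof (induction k arbitrary: i j)
  case 0
  show ?case by (simp add: mat_def)
next
  case (Suc k)
  let ?a = "\<Sum>i\<in>UNIV. \<Sum>l\<in>UNIV. norm (A $ i $ l)"
  have a: "0 \<le> ?a" by (intro sum_nonneg) auto
  have "norm (matrix_power A (Suc k) $ i $ j) \<le> (\<Sum>l\<in>UNIV. norm (A $ i $ l * matrix_power A k $ l $ j))"
    by (simp add: matrix_matrix_mult_def norm_sum)
  also have "\<dots> \<le> (\<Sum>l\<in>UNIV. norm (A $ i $ l) * ?a ^ k)"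
    by (intro sum_mono) (auto simp: norm_mult intro!: mult_left_mono Suc)
  also have "\<dots> = (\<Sum>l\<in>UNIV. norm (A $ i $ l)) * ?a ^ k" by (simp add: sum_distrib_right)
  also have "\<dots> \<le> ?a * ?a ^ k"
    using a by (intro mult_right_mono member_le_sum[of i UNIV "\<lambda>i. \<Sum>l\<in>UNIV. norm (A $ i $ l)"])
      (auto intro: sum_nonneg)
  finally show ?case by simp
qed

lemma summable_matrix_exp: "summable (\<lambda>k. matrix_power A k $ i $ j / fact k * t ^ k)"
proof (rule summable_comparison_test')
  let ?a = "\<Sum>i\<in>UNIV. \<Sum>l\<in>UNIV. norm (A $ i $ l)"
  show "summable (\<lambda>k. inverse (fact k) * (?a * norm t) ^ k)" by (rule summable_exp)
  fix k :: nat
  have "norm (matrix_power A k $ i $ j / fact k * t ^ k)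
      = norm (matrix_power A k $ i $ j) * (inverse (fact k) * norm t ^ k)"
    by (simp add: norm_mult norm_inverse norm_power divide_inverse)
  also have "\<dots> \<le> ?a ^ k * (inverse (fact k) * norm t ^ k)"
    by (intro mult_right_mono matrix_power_bound) simp
  finally show "norm (matrix_power A k $ i $ j / fact k * t ^ k) \<le> inverse (fact k) * (?a * norm t) ^ k"
    by (simp add: power_mult_distrib mult_ac)
qed

lemma matrix_exp_mult_left:
  "(A ** matrix_exp A t) $ i $ j = (suminf (\<lambda>k. matrix_power A (Suc k) $ i $ j / fact k * t ^ k))"
proof -
  have "(A ** matrix_exp A t) $ i $ j
      = (\<Sum>l\<in>UNIV. A $ i $ l * (suminf (\<lambda>k. matrix_power A k $ l $ j / fact k * t ^ k)))"
    by (simp add: matrix_matrix_mult_def matrix_exp_def)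
  also have "\<dots> = (\<Sum>l\<in>UNIV. suminf (\<lambda>k. A $ i $ l * (matrix_power A k $ l $ j / fact k * t ^ k)))"
    by (intro sum.cong refl suminf_mult[symmetric] summable_matrix_exp)
  also have "\<dots> = (suminf (\<lambda>k. \<Sum>l\<in>UNIV. A $ i $ l * (matrix_power A k $ l $ j / fact k * t ^ k)))"
    by (intro suminf_sum[symmetric] summable_mult summable_matrix_exp)
  finally show ?thesis
    by (simp add: matrix_matrix_mult_def sum_distrib_left sum_distrib_right sum_divide_distrib mult_ac)
qed

lemma matrix_exp_mult_right:
  "(matrix_exp A t ** A) $ i $ j = (suminf (\<lambda>k. matrix_power A (Suc k) $ i $ j / fact k * t ^ k))"
proof -
  have "(matrix_exp A t ** A) $ i $ j
      = (\<Sum>l\<in>UNIV. (suminf (\<lambda>k. matrix_power A k $ i $ l / fact k * t ^ k)) * A $ l $ j)"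
    by (simp add: matrix_matrix_mult_def matrix_exp_def)
  also have "\<dots> = (\<Sum>l\<in>UNIV. suminf (\<lambda>k. matrix_power A k $ i $ l / fact k * t ^ k * A $ l $ j))"
    by (intro sum.cong refl suminf_mult2 summable_matrix_exp)
  also have "\<dots> = (suminf (\<lambda>k. \<Sum>l\<in>UNIV. matrix_power A k $ i $ l / fact k * t ^ k * A $ l $ j))"
    by (intro suminf_sum[symmetric] summable_mult2 summable_matrix_exp)
  also have "\<dots> = (suminf (\<lambda>k. (matrix_power A k ** A) $ i $ j / fact k * t ^ k))"
    by (simp add: matrix_matrix_mult_def sum_distrib_left sum_distrib_right sum_divide_distrib mult_ac)
  finally show ?thesis by (simp add: matrix_power_commute)
qed

lemma matrix_exp_0: "matrix_exp A 0 = mat 1"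
  using powser_zero[of "\<lambda>k. matrix_power A k $ _ $ _ / fact k"]
  by (simp add: matrix_exp_def vec_eq_iff)

lemma matrix_exp_has_field_derivative:
  "((\<lambda>t. matrix_exp A t $ i $ j) has_field_derivative (A ** matrix_exp A t) $ i $ j) (at t)"
proof -
  let ?c = "\<lambda>k. matrix_power A k $ i $ j / fact k"
  have "((\<lambda>t. suminf (\<lambda>k. ?c k * t ^ k)) has_field_derivative (suminf (\<lambda>k. diffs ?c k * t ^ k))) (at t)"
    by (rule termdiffs_strong_converges_everywhere) (rule summable_matrix_exp)
  moreover have "diffs ?c k = matrix_power A (Suc k) $ i $ j / fact k" for k
    by (simp add: diffs_def field_simps del: matrix_power.simps of_nat_Suc) 
  ultimately show ?thesis unfolding matrix_exp_mult_left by (simp add: matrix_exp_def)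
qed

text \<open>The product is constant since its derivative is \<open>-A e\<^sup>-\<^sup>t\<^sup>A e\<^sup>t\<^sup>A + e\<^sup>-\<^sup>t\<^sup>A A e\<^sup>t\<^sup>A = 0\<close>.\<close>

lemma matrix_exp_inverse: "matrix_exp A (- t) ** matrix_exp A t = mat 1"
proof -
  have commute: "A ** matrix_exp A t = matrix_exp A t ** A" for t
    by (simp add: vec_eq_iff matrix_exp_mult_left matrix_exp_mult_right)
  have "(matrix_exp A (- t) ** matrix_exp A t) $ i $ j = (mat 1 :: complex ^ 'a ^ 'a) $ i $ j" for i j
  proof -
    let ?M = "\<lambda>t. (matrix_exp A (- t) ** matrix_exp A t) $ i $ j"
    have M_eq: "?M = (\<lambda>t. \<Sum>l\<in>UNIV. matrix_exp A (- t) $ i $ l * matrix_exp A t $ l $ j)"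
      by (simp add: matrix_matrix_mult_def)
    have "(?M has_field_derivative 0) (at t)" for t
    proof -
      have neg: "((\<lambda>t. matrix_exp A (- t) $ i $ l) has_field_derivative - (A ** matrix_exp A (- t)) $ i $ l) (at t)" for l
        using DERIV_chain2[OF matrix_exp_has_field_derivative[of A i l "- t"] DERIV_minus[OF DERIV_ident]] by simp
      have "(?M has_field_derivative
          (\<Sum>l\<in>UNIV. - (A ** matrix_exp A (- t)) $ i $ l * matrix_exp A t $ l $ j
             + (A ** matrix_exp A t) $ l $ j * matrix_exp A (- t) $ i $ l)) (at t)"
        unfolding M_eq by (intro DERIV_sum DERIV_mult neg matrix_exp_has_field_derivative)
      moreover have "(\<Sum>l\<in>UNIV. - (A ** matrix_exp A (- t)) $ i $ l * matrix_exp A t $ l $ j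
             + (A ** matrix_exp A t) $ l $ j * matrix_exp A (- t) $ i $ l)
         = - ((A ** matrix_exp A (- t)) ** matrix_exp A t) $ i $ j
             + (matrix_exp A (- t) ** (A ** matrix_exp A t)) $ i $ j"
        by (simp add: matrix_matrix_mult_def[of "_ ** _" "matrix_exp A t"]
            matrix_matrix_mult_def[of _ "A ** _"] sum.distrib sum_negf sum_subtractf mult_ac)
      moreover have "(A ** matrix_exp A (- t)) ** matrix_exp A t = matrix_exp A (- t) ** (A ** matrix_exp A t)"
        by (simp add: commute[of "- t"] matrix_mul_assoc)
      ultimately show ?thesis by simp
    qed
    then obtain c where c: "\<And>t. ?M t = c"
      using has_field_derivative_zero_constant[of UNIV ?M] by auto
    show ?thesis using c[of t] c[of 0] by (simp add: matrix_exp_0)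
  qed
  then show ?thesis by (simp add: vec_eq_iff)
qed

text \<open>The polynomial \<open>D\<^sub>A p = \<nabla>p \<cdot> A y\<close>.\<close>

lemma matrix_derivation_mpoly:
  fixes p :: "('n::finite, complex) mpoly" and A :: "complex ^ 'n ^ 'n"
  obtains q where "\<And>x. mpoly_eval id (($) x) q = (\<Sum>i\<in>UNIV. mpoly_eval id (($) x) (mpoly_deriv i p) * (A *v x) $ i)"
proof
  show "mpoly_eval id (($) x) (\<Sum>i\<in>UNIV. mpoly_deriv i p * (\<Sum>j\<in>UNIV. mconst (A $ i $ j) * mvar j))
     = (\<Sum>i\<in>UNIV. mpoly_eval id (($) x) (mpoly_deriv i p) * (A *v x) $ i)" for x
    by (simp add: mpoly_eval_sum mpoly_eval_simps matrix_vector_mult_def)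
qed

text \<open>If \<open>D\<^sub>A\<close> preserves the ideal of \<open>X\<close>, then the orbit of \<open>x \<in> X\<close> under \<open>exp (tA)\<close> satisfies all
  equations of \<open>X\<close>: the derivative of \<open>t \<mapsto> p (exp (tA) x)\<close> is \<open>t \<mapsto> (D\<^sub>A p) (exp (tA) x)\<close>, so all
  derivatives vanish at \<open>0\<close>, and the function is entire.\<close>

lemma exp_orbit_in_zariski_closed:
  fixes A :: "complex ^ 'n ^ 'n"
  assumes tangent: "\<And>p x. (\<And>y. y \<in> X \<Longrightarrow> mpoly_eval id (($) y) p = 0) \<Longrightarrow> x \<in> X \<Longrightarrow>
      (\<Sum>i\<in>UNIV. mpoly_eval id (($) x) (mpoly_deriv i p) * (A *v x) $ i) = 0"
    and p: "\<And>y. y \<in> X \<Longrightarrow> mpoly_eval id (($) y) p = 0" and x: "x \<in> X"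
  shows "mpoly_eval id (($) (matrix_exp A t *v x)) p = 0"
proof -
  define g where "g p t = mpoly_eval id (($) (matrix_exp A t *v x)) p" for p t
  have curve: "((\<lambda>t. (matrix_exp A t *v x) $ i) has_field_derivative (A *v (matrix_exp A t *v x)) $ i) (at t)" for t i
  proof -
    have "((\<lambda>t. \<Sum>j\<in>UNIV. matrix_exp A t $ i $ j * x $ j) has_field_derivative
        (\<Sum>j\<in>UNIV. (A ** matrix_exp A t) $ i $ j * x $ j)) (at t)"
      by (intro DERIV_sum DERIV_cmult_right matrix_exp_has_field_derivative)
    then show ?thesis
      by (simp add: matrix_vector_mul_assoc) (simp add: matrix_vector_mult_def)
  qed
  have g_deriv: "(g p has_field_derivative
      (\<Sum>i\<in>UNIV. mpoly_eval id (($) (matrix_exp A t *v x)) (mpoly_deriv i p) * (A *v (matrix_exp A t *v x)) $ i)) (at t)"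
    for p t
    unfolding g_def by (rule mpoly_eval_has_field_derivative) (rule curve)
  have "(deriv ^^ n) (g p) 0 = 0" if "\<And>y. y \<in> X \<Longrightarrow> mpoly_eval id (($) y) p = 0" for n p
    using that
  proof (induction n arbitrary: p)
    case 0
    then show ?case using x by (simp add: g_def matrix_exp_0 id_def)
  next
    case (Suc n)
    obtain q where q: "\<And>x. mpoly_eval id (($) x) q = (\<Sum>i\<in>UNIV. mpoly_eval id (($) x) (mpoly_deriv i p) * (A *v x) $ i)"
      by (rule matrix_derivation_mpoly[of p A]) (rule that)
    have "deriv (g p) = g q"
      using DERIV_imp_deriv[OF g_deriv[of p]] by (auto simp: g_def q)
    moreover have "(deriv ^^ n) (g q) 0 = 0"
      by (rule Suc.IH) (use tangent Suc.prems q in \<open>auto simp: id_def\<close>)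
    ultimately show ?case by (simp add: funpow_Suc_right del: funpow.simps)
  qed
  moreover have "g p holomorphic_on UNIV"
    using g_deriv by (auto simp: holomorphic_on_open)
  ultimately have "g p t = 0"
    using holomorphic_fun_eq_0_on_connected[of "g p" UNIV 0 t] p by auto
  then show ?thesis by (simp add: g_def)
qed

text \<open>The curve \<open>exp (tA)\<close> runs inside the stabilizer, by the preceding lemma for \<open>t\<close> and \<open>-t\<close>. Regular
  functions vanishing on the stabilizer vanish along the curve, and so does their derivative at
  \<open>t = 0\<close> in the direction \<open>A\<close>.\<close>

lemma in_lie_algebra_stabilizer:
  fixes A :: "complex ^ 'n ^ 'n"
  assumes closed: "zariski_closure X \<subseteq> X"
    and tangent: "\<And>p x. (\<And>y. y \<in> X \<Longrightarrow> mpoly_eval id (($) y) p = 0) \<Longrightarrow> x \<in> X \<Longrightarrow>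
      (\<Sum>i\<in>UNIV. mpoly_eval id (($) x) (mpoly_deriv i p) * (A *v x) $ i) = 0"
  shows "A \<in> lie_algebra (stabilizer X)"
proof -
  have maps: "matrix_exp A t *v x \<in> X" if "x \<in> X" for t x
    using exp_orbit_in_zariski_closed[OF tangent _ that] closed
    by (auto simp: zariski_closure_def)
  have inv: "matrix_exp A t ** matrix_exp A (- t) = mat 1" for t
    using matrix_exp_inverse[of A "- t"] by simp
  have stab: "matrix_exp A t \<in> stabilizer X" for t
    unfolding stabilizer_def
  proof (intro CollectI conjI equalityI subsetI)
    show "invertible (matrix_exp A t)"
      using inv matrix_exp_inverse unfolding invertible_def by blast
    fix x assume "x \<in> X"
    then have "matrix_exp A (- t) *v x \<in> X" by (rule maps)
    moreover have "x = matrix_exp A t *v (matrix_exp A (- t) *v x)"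
      by (simp add: matrix_vector_mul_assoc inv)
    ultimately show "x \<in> (*v) (matrix_exp A t) ` X" by blast
  qed (use maps in auto)
  show ?thesis
    unfolding lie_algebra_def
  proof (intro CollectI allI impI)
    fix p :: "('n \<times> 'n, complex) mpoly"
    assume p: "\<forall>g\<in>stabilizer X. mpoly_eval id (matrix_entries g) p = 0"
    have entries: "((\<lambda>t. matrix_entries (matrix_exp A t) ij) has_field_derivative
        matrix_entries (A ** matrix_exp A t) ij) (at t)" for t ij
      by (cases ij) (simp add: matrix_entries_def matrix_exp_has_field_derivative)
    have "((\<lambda>t. mpoly_eval id (matrix_entries (matrix_exp A t)) p) has_field_derivative
        (\<Sum>ij\<in>UNIV. mpoly_eval id (matrix_entries (matrix_exp A 0)) (mpoly_deriv ij p)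
           * matrix_entries (A ** matrix_exp A 0) ij)) (at 0)"
      by (rule mpoly_eval_has_field_derivative) (rule entries)
    moreover have "(\<lambda>t. mpoly_eval id (matrix_entries (matrix_exp A t)) p) = (\<lambda>t. 0)"
      using p stab by auto
    ultimately have "((\<lambda>t. 0) has_field_derivative
        (\<Sum>ij\<in>UNIV. mpoly_eval id (matrix_entries (mat 1)) (mpoly_deriv ij p) * matrix_entries A ij)) (at (0::complex))"
      by (simp add: matrix_exp_0)
    then have "(\<Sum>ij\<in>UNIV. mpoly_eval id (matrix_entries (mat 1)) (mpoly_deriv ij p) * matrix_entries A ij) = 0"
      using DERIV_unique[OF _ DERIV_const] by blast
    then show "(\<Sum>(i, j)\<in>UNIV. A $ i $ j * mpoly_eval id (matrix_entries (mat 1)) (mpoly_deriv (i, j) p)) = 0"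
      by (simp add: matrix_entries_def case_prod_unfold mult.commute)
  qed
qed

text \<open>The polynomial \<open>q\<close> in the entries of \<open>g\<close> is the pullback of \<open>p\<close> along the orbit map \<open>g \<mapsto> g x\<close>; the
  second conjunct is the chain rule for this map.\<close>

definition orbit_pullback ::
    "complex ^ 'n \<Rightarrow> ('n, complex) mpoly \<Rightarrow> ('n \<times> 'n, complex) mpoly \<Rightarrow> bool" where
  "orbit_pullback x p q \<longleftrightarrow> (\<forall>g.
     mpoly_eval id (matrix_entries g) q = mpoly_eval id (($) (g *v x)) p \<and>
     (\<forall>A. (\<Sum>(i, j)\<in>UNIV. A $ i $ j * mpoly_eval id (matrix_entries g) (mpoly_deriv (i, j) q))
        = (\<Sum>i\<in>UNIV. mpoly_eval id (($) (g *v x)) (mpoly_deriv i p) * (A *v x) $ i)))"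

lemma orbit_pullback_exists:
  fixes p :: "('n::finite, complex) mpoly"
  shows "\<exists>q. orbit_pullback x p q"
proof (induction p rule: mpoly_ring_induct)
  case (const c)
  show ?case
    by (rule exI[of _ "mconst c"]) (simp add: orbit_pullback_def mpoly_eval_simps mpoly_deriv_const)
next
  case (var k)
  let ?q = "\<Sum>j\<in>UNIV. mconst (x $ j) * mvar (k, j)"
  have d: "mpoly_eval id (matrix_entries g) (mpoly_deriv (i, j) ?q) = (if i = k then x $ j else 0)" for g i j
  proof -
    have "mpoly_eval id (matrix_entries g) (mpoly_deriv (i, j) ?q) = (\<Sum>j'\<in>UNIV. if j = j' then (if i = k then x $ j' else 0) else 0)"
      unfolding mpoly_deriv_sum mpoly_eval_sum[OF coeff_hom_id(1)]
      by (intro sum.cong refl) (simp add: mpoly_deriv_mult mpoly_deriv_const mpoly_deriv_var mpoly_eval_simps)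
    then show ?thesis by simp
  qed
  have "(\<Sum>(i, j)\<in>UNIV. A $ i $ j * mpoly_eval id (matrix_entries g) (mpoly_deriv (i, j) ?q)) = (A *v x) $ k" for g A
  proof -
    have "(\<Sum>(i, j)\<in>UNIV. A $ i $ j * mpoly_eval id (matrix_entries g) (mpoly_deriv (i, j) ?q))
       = (\<Sum>i\<in>UNIV. \<Sum>j\<in>UNIV. A $ i $ j * (if i = k then x $ j else 0))"
      unfolding d sum.cartesian_product by simp
    also have "\<dots> = (\<Sum>i\<in>UNIV. if i = k then (A *v x) $ i else 0)"
      by (intro sum.cong refl) (simp add: matrix_vector_mult_def)
    finally show ?thesis by simp
  qed
  moreover have "(\<Sum>i\<in>UNIV. mpoly_eval id (($) (g *v x)) (mpoly_deriv i (mvar k)) * (A *v x) $ i) = (A *v x) $ k" for g A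
  proof -
    have "(\<Sum>i\<in>UNIV. mpoly_eval id (($) (g *v x)) (mpoly_deriv i (mvar k)) * (A *v x) $ i)
       = (\<Sum>i\<in>UNIV. if i = k then (A *v x) $ i else 0)"
      by (intro sum.cong refl) (simp add: mpoly_deriv_var mpoly_eval_simps)
    then show ?thesis by simp
  qed
  moreover have "mpoly_eval id (matrix_entries g) ?q = mpoly_eval id (($) (g *v x)) (mvar k)" for g
    by (simp add: mpoly_eval_sum mpoly_eval_simps matrix_entries_def matrix_vector_mult_def mult.commute)
  ultimately show ?case unfolding orbit_pullback_def by (intro exI[of _ ?q]) simp
next
  case (add p q)
  then obtain p' q' where pq: "orbit_pullback x p p'" "orbit_pullback x q q'" by blast
  have "orbit_pullback x (p + q) (p' + q')"
    using pq unfolding orbit_pullback_def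
    by (simp add: mpoly_eval_simps mpoly_deriv_add case_prod_unfold distrib_left distrib_right sum.distrib)
  then show ?case by blast
next
  case (mult p q)
  then obtain p' q' where pq: "orbit_pullback x p p'" "orbit_pullback x q q'" by blast
  have "(\<Sum>ij\<in>UNIV. A $ fst ij $ snd ij * mpoly_eval id (matrix_entries g) (mpoly_deriv ij (p' * q')))
     = (\<Sum>ij\<in>UNIV. A $ fst ij $ snd ij * mpoly_eval id (matrix_entries g) (mpoly_deriv ij p')) * mpoly_eval id (matrix_entries g) q'
     + mpoly_eval id (matrix_entries g) p' * (\<Sum>ij\<in>UNIV. A $ fst ij $ snd ij * mpoly_eval id (matrix_entries g) (mpoly_deriv ij q'))" for g A
    by (simp add: mpoly_eval_simps mpoly_deriv_mult sum_distrib_left sum_distrib_right sum.distrib algebra_simps)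
  moreover have "(\<Sum>i\<in>UNIV. mpoly_eval id (($) (g *v x)) (mpoly_deriv i (p * q)) * (A *v x) $ i)
    = (\<Sum>i\<in>UNIV. mpoly_eval id (($) (g *v x)) (mpoly_deriv i p) * (A *v x) $ i) * mpoly_eval id (($) (g *v x)) q
     + mpoly_eval id (($) (g *v x)) p * (\<Sum>i\<in>UNIV. mpoly_eval id (($) (g *v x)) (mpoly_deriv i q) * (A *v x) $ i)" for g A
    by (simp add: mpoly_eval_simps mpoly_deriv_mult sum_distrib_left sum_distrib_right sum.distrib algebra_simps)
  ultimately have "orbit_pullback x (p * q) (p' * q')"
    using pq unfolding orbit_pullback_def by (simp add: mpoly_eval_simps case_prod_unfold)
  then show ?case by blast
qed

text \<open>The pullback of \<open>p\<close> along \<open>g \<mapsto> g x\<close> vanishes on the stabilizer, and its differential at \<open>1\<close>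
  sends \<open>A\<close> to \<open>(D\<^sub>A p)(x)\<close>.\<close>

lemma lie_algebra_stabilizer_tangent:
  fixes A :: "complex ^ 'n ^ 'n"
  assumes A: "A \<in> lie_algebra (stabilizer X)"
    and p: "\<And>y. y \<in> X \<Longrightarrow> mpoly_eval id (($) y) p = 0" and x: "x \<in> X"
  shows "(\<Sum>i\<in>UNIV. mpoly_eval id (($) x) (mpoly_deriv i p) * (A *v x) $ i) = 0"
proof -
  obtain q :: "('n \<times> 'n, complex) mpoly" where q:
     "\<And>g. mpoly_eval id (matrix_entries g) q = mpoly_eval id (($) (g *v x)) p"
     "\<And>g A. (\<Sum>(i, j)\<in>UNIV. A $ i $ j * mpoly_eval id (matrix_entries g) (mpoly_deriv (i, j) q))
        = (\<Sum>i\<in>UNIV. mpoly_eval id (($) (g *v x)) (mpoly_deriv i p) * (A *v x) $ i)"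
    using orbit_pullback_exists[of x p] unfolding orbit_pullback_def by blast
  have "mpoly_eval id (matrix_entries g) q = 0" if "g \<in> stabilizer X" for g
    unfolding q using that x by (intro p) (auto simp: stabilizer_def)
  then have "(\<Sum>(i, j)\<in>UNIV. A $ i $ j * mpoly_eval id (matrix_entries (mat 1)) (mpoly_deriv (i, j) q)) = 0"
    using A by (simp add: lie_algebra_def)
  then show ?thesis by (simp add: q)
qed

section \<open>The Lie algebra in terms of the generic point\<close>

definition generic_jacobian_column :: "('m::{finite,linorder} ratfun) ^ 'n \<Rightarrow> 'm \<Rightarrow> ('m ratfun) ^ 'n" where
  "generic_jacobian_column \<phi> j = (\<chi> i. ratfun_deriv j (\<phi> $ i))"

definition generic_tangent_space :: "('m::{finite,linorder} ratfun) ^ 'n \<Rightarrow> (('m ratfun) ^ 'n) set" where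
  "generic_tangent_space \<phi> = vec.span (range (generic_jacobian_column \<phi>))"

definition generic_lie_algebra :: "('m::{finite,linorder} ratfun) ^ 'n \<Rightarrow> (rat ^ 'n ^ 'n) set" where
  "generic_lie_algebra \<phi> = {A. map_matrix of_rat A *v \<phi> \<in> generic_tangent_space \<phi>}"

lemma generic_tangent_space_iff:
  "w \<in> generic_tangent_space \<phi> \<longleftrightarrow>
     (\<exists>c. \<forall>i. w $ i = (\<Sum>j\<in>UNIV. c j * ratfun_deriv j (\<phi> $ i)))"
proof
  assume "w \<in> generic_tangent_space \<phi>"
  then show "\<exists>c. \<forall>i. w $ i = (\<Sum>j\<in>UNIV. c j * ratfun_deriv j (\<phi> $ i))"
    unfolding generic_tangent_space_def
  proof (induction rule: vec.span_induct_alt)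
    case base
    show ?case by (rule exI[of _ "\<lambda>_. 0"]) simp
  next
    case (step k x y)
    then obtain j0 c where "x = generic_jacobian_column \<phi> j0"
      "\<And>i. y $ i = (\<Sum>j\<in>UNIV. c j * ratfun_deriv j (\<phi> $ i))" by blast
    moreover have "k * ratfun_deriv j0 f = (\<Sum>j\<in>UNIV. (if j = j0 then k else 0) * ratfun_deriv j f)" for f
      by (simp add: if_distrib[of "\<lambda>c. c * _"] cong: if_cong)
    ultimately show ?case
      by (intro exI[of _ "\<lambda>j. (if j = j0 then k else 0) + c j"])
        (simp add: generic_jacobian_column_def distrib_right sum.distrib)
  qed
next
  assume "\<exists>c. \<forall>i. w $ i = (\<Sum>j\<in>UNIV. c j * ratfun_deriv j (\<phi> $ i))"
  then obtain c where "\<And>i. w $ i = (\<Sum>j\<in>UNIV. c j * ratfun_deriv j (\<phi> $ i))" by blast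
  then have "w = (\<Sum>j\<in>UNIV. c j *s generic_jacobian_column \<phi> j)"
    by (simp add: vec_eq_iff generic_jacobian_column_def sum_component)
  then show "w \<in> generic_tangent_space \<phi>"
    unfolding generic_tangent_space_def
    by (simp only:) (intro vec.span_sum vec.span_scale vec.span_base rangeI)
qed

lemma mpoly_eval_of_rat_point:
  "mpoly_eval of_rat (\<lambda>i. of_rat (y i)) p = (of_rat (mpoly_eval of_rat y p) :: 'k::field_char_0)"
  for y :: "'v \<Rightarrow> rat"
  by (induction p rule: mpoly_ring_induct) (simp_all add: mpoly_eval_simps of_rat_add of_rat_mult)

lemma ratfun_of_rat_point:
  fixes x :: "'v::linorder \<Rightarrow> rat"
  assumes "ratfun_defined f x"
  shows "ratfun_defined f (\<lambda>i. of_rat (x i) :: 'k::field_char_0)"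
    and "ratfun_eval f (\<lambda>i. of_rat (x i)) = (of_rat (ratfun_eval f x) :: 'k)"
proof -
  obtain a b where ab: "f = Fract a b" "mpoly_eval of_rat x b \<noteq> 0"
    "ratfun_eval f x = mpoly_eval of_rat x a / mpoly_eval of_rat x b"
    using assms by (rule ratfun_definedE)
  then have nz: "mpoly_eval of_rat (\<lambda>i. of_rat (x i) :: 'k) b \<noteq> 0"
    by (simp add: mpoly_eval_of_rat_point)
  show "ratfun_defined f (\<lambda>i. of_rat (x i) :: 'k)"
    unfolding ab(1) by (rule ratfun_Fract[OF nz])
  show "ratfun_eval f (\<lambda>i. of_rat (x i)) = (of_rat (ratfun_eval f x) :: 'k)"
    unfolding ab(3) unfolding ab(1) ratfun_Fract(2)[OF nz]
    by (simp add: mpoly_eval_of_rat_point of_rat_divide)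
qed

text \<open>\<open>P\<close> is \<open>p\<close> with its coefficients regarded as complex numbers.\<close>

lemma mpoly_complexification:
  fixes p :: "('n::finite, rat) mpoly"
  shows "\<exists>P. \<forall>z. mpoly_eval id z P = mpoly_eval of_rat z p \<and>
     (\<forall>i. mpoly_eval id z (mpoly_deriv i P) = (mpoly_eval of_rat z (mpoly_deriv i p) :: complex))"
  unfolding id_def
proof (induction p rule: mpoly_ring_induct)
  case (const c)
  show ?case
    by (rule exI[of _ "mconst (of_rat c)"]) (simp add: mpoly_eval_simps mpoly_deriv_const)
next
  case (var v)
  show ?case
    by (rule exI[of _ "mvar v"]) (simp add: mpoly_eval_simps mpoly_deriv_var mpoly_eval_indicator)
next
  case (add p q)
  then obtain P Q where "\<forall>z. mpoly_eval (\<lambda>x. x) z P = mpoly_eval of_rat z p \<and>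
     (\<forall>i. mpoly_eval (\<lambda>x. x) z (mpoly_deriv i P) = (mpoly_eval of_rat z (mpoly_deriv i p) :: complex))"
     "\<forall>z. mpoly_eval (\<lambda>x. x) z Q = mpoly_eval of_rat z q \<and>
     (\<forall>i. mpoly_eval (\<lambda>x. x) z (mpoly_deriv i Q) = (mpoly_eval of_rat z (mpoly_deriv i q) :: complex))"
    by blast
  then show ?case by (intro exI[of _ "P + Q"]) (simp add: mpoly_eval_simps mpoly_deriv_add)
next
  case (mult p q)
  then obtain P Q where "\<forall>z. mpoly_eval (\<lambda>x. x) z P = mpoly_eval of_rat z p \<and>
     (\<forall>i. mpoly_eval (\<lambda>x. x) z (mpoly_deriv i P) = (mpoly_eval of_rat z (mpoly_deriv i p) :: complex))"
     "\<forall>z. mpoly_eval (\<lambda>x. x) z Q = mpoly_eval of_rat z q \<and>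
     (\<forall>i. mpoly_eval (\<lambda>x. x) z (mpoly_deriv i Q) = (mpoly_eval of_rat z (mpoly_deriv i q) :: complex))"
    by blast
  then show ?case by (intro exI[of _ "P * Q"]) (simp add: mpoly_eval_simps mpoly_deriv_mult)
qed

text \<open>If \<open>f\<close> were nonzero, then the product of its numerator, its denominator and the denominators of
  \<open>\<phi>\<close> would be a nonzero polynomial and thus have a nonzero value at some rational point.\<close>

lemma ratfun_eq_0I:
  fixes f :: "'m::{finite,linorder} ratfun" and \<phi> :: "('m::{finite,linorder} ratfun) ^ 'n"
  assumes "\<And>x :: rat ^ 'm::{finite,linorder}. ratmap_defined \<phi> x \<Longrightarrow> ratfun_defined f (($) x) \<Longrightarrow> ratfun_eval f (($) x) = 0"
  shows "f = 0"
proof (rule ccontr)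
  assume f0: "f \<noteq> 0"
  obtain a b where ab: "f = Fract a b" "b \<noteq> 0" by (cases f)
  then have "a \<noteq> 0" using f0 by (auto simp: Zero_fract_def eq_fract)
  have "\<forall>i. \<exists>n d. \<phi> $ i = Fract n d \<and> d \<noteq> 0" by (metis Fract_cases)
  then obtain N D where ND: "\<And>i. \<phi> $ i = Fract (N i) (D i)" "\<And>i. D i \<noteq> 0" by metis
  have "a * b * (\<Prod>i\<in>UNIV. D i) \<noteq> 0" using \<open>a \<noteq> 0\<close> ab ND by simp
  from exists_nonzero_value[OF this] obtain x :: "rat ^ 'm::{finite,linorder}" where
    x: "mpoly_eval of_rat (($) x) a \<noteq> 0" "mpoly_eval of_rat (($) x) b \<noteq> 0"
      "\<And>i. mpoly_eval of_rat (($) x) (D i) \<noteq> 0"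
    by (auto simp: mpoly_eval_simps mpoly_eval_prod)
  have "ratmap_defined \<phi> x" unfolding ratmap_defined_def ND using ratfun_Fract(1)[OF x(3)] by blast
  then show False using assms[of x] ratfun_Fract[OF x(2), of a] x by (simp add: ab)
qed

lemma ratmap_mpoly_eval:
  fixes x :: "'k::field_char_0 ^ 'm::{finite,linorder}"
  assumes "ratmap_defined \<phi> x"
  shows "ratfun_defined (mpoly_eval of_rat (($) \<phi>) p) (($) x)"
    and "ratfun_eval (mpoly_eval of_rat (($) \<phi>) p) (($) x) = mpoly_eval of_rat (($) (ratmap_eval \<phi> x)) p"
proof -
  have "($) (ratmap_eval \<phi> x) = (\<lambda>i. ratfun_eval (\<phi> $ i) (($) x))" by (simp add: ratmap_eval_def fun_eq_iff)
  then show "ratfun_defined (mpoly_eval of_rat (($) \<phi>) p) (($) x)"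
    "ratfun_eval (mpoly_eval of_rat (($) \<phi>) p) (($) x) = mpoly_eval of_rat (($) (ratmap_eval \<phi> x)) p"
    using ratfun_mpoly_eval[of "($) \<phi>" "($) x" p] assms by (simp_all add: ratmap_defined_def)
qed

lemma ratmap_linear:
  fixes x :: "'k::field_char_0 ^ 'm::{finite,linorder}" and A :: "rat ^ 'n ^ 'n"
  assumes "ratmap_defined \<phi> x"
  shows "ratfun_defined ((map_matrix of_rat A *v \<phi>) $ i) (($) x)"
    and "ratfun_eval ((map_matrix of_rat A *v \<phi>) $ i) (($) x) = (map_matrix of_rat A *v ratmap_eval \<phi> x) $ i"
proof -
  have t: "ratfun_defined (of_rat (A $ i $ j) * \<phi> $ j) (($) x) \<and>
     ratfun_eval (of_rat (A $ i $ j) * \<phi> $ j) (($) x) = of_rat (A $ i $ j) * ratmap_eval \<phi> x $ j" for j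
    using assms by (simp add: ratfun_mult ratfun_const ratmap_defined_def ratmap_eval_def)
  have e: "(map_matrix of_rat A *v \<phi>) $ i = (\<Sum>j\<in>UNIV. of_rat (A $ i $ j) * \<phi> $ j)"
    by (simp add: matrix_vector_mult_def)
  have "ratfun_defined ((map_matrix of_rat A *v \<phi>) $ i) (($) x) \<and>
    ratfun_eval ((map_matrix of_rat A *v \<phi>) $ i) (($) x) = (\<Sum>j\<in>UNIV. of_rat (A $ i $ j) * ratmap_eval \<phi> x $ j)"
    unfolding e using ratfun_sum[of UNIV "\<lambda>j. of_rat (A $ i $ j) * \<phi> $ j" "($) x"] t by simp
  then show "ratfun_defined ((map_matrix of_rat A *v \<phi>) $ i) (($) x)"
     "ratfun_eval ((map_matrix of_rat A *v \<phi>) $ i) (($) x) = (map_matrix of_rat A *v ratmap_eval \<phi> x) $ i"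
    by (simp_all add: matrix_vector_mult_def)
qed

text \<open>The element \<open>(D\<^sub>A p)(\<phi>)\<close> of \<open>K\<close>.\<close>

definition generic_derivative ::
   "('m::{finite,linorder} ratfun) ^ 'n \<Rightarrow> rat ^ 'n ^ 'n \<Rightarrow> ('n, rat) mpoly \<Rightarrow> 'm ratfun" where
  "generic_derivative \<phi> A p =
     (\<Sum>i\<in>UNIV. mpoly_eval of_rat (($) \<phi>) (mpoly_deriv i p) * (map_matrix of_rat A *v \<phi>) $ i)"

lemma generic_derivative_eval:
  fixes x :: "'k::field_char_0 ^ 'm::{finite,linorder}"
  assumes "ratmap_defined \<phi> x"
  shows "ratfun_eval (generic_derivative \<phi> A p) (($) x) =
    (\<Sum>i\<in>UNIV. mpoly_eval of_rat (($) (ratmap_eval \<phi> x)) (mpoly_deriv i p) *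
       (map_matrix of_rat A *v ratmap_eval \<phi> x) $ i)"
proof -
  let ?g = "\<lambda>i. mpoly_eval of_rat (($) \<phi>) (mpoly_deriv i p) * (map_matrix of_rat A *v \<phi>) $ i"
  have "ratfun_defined (?g i) (($) x)" "ratfun_eval (?g i) (($) x) =
     mpoly_eval of_rat (($) (ratmap_eval \<phi> x)) (mpoly_deriv i p) * (map_matrix of_rat A *v ratmap_eval \<phi> x) $ i" for i
    using assms by (simp_all add: ratfun_mult ratmap_mpoly_eval ratmap_linear)
  then show ?thesis
    unfolding generic_derivative_def using ratfun_sum[of UNIV ?g "($) x"] by simp
qed

text \<open>With \<open>A \<phi> = \<Sum>\<^sub>j c\<^sub>j \<partial>\<phi>/\<partial>x\<^sub>j\<close> the chain rule turns \<open>(D\<^sub>A p)(\<phi>)\<close> into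
  \<open>\<Sum>\<^sub>j c\<^sub>j \<partial>(p(\<phi>))/\<partial>x\<^sub>j\<close>.\<close>

lemma generic_derivative_eq_0:
  assumes A: "A \<in> generic_lie_algebra \<phi>" and p: "mpoly_eval of_rat (($) \<phi>) p = 0"
  shows "generic_derivative \<phi> A p = 0"
proof -
  obtain c where c: "\<And>i. (map_matrix of_rat A *v \<phi>) $ i = (\<Sum>j\<in>UNIV. c j * ratfun_deriv j (\<phi> $ i))"
    using A by (auto simp: generic_lie_algebra_def generic_tangent_space_iff)
  have "generic_derivative \<phi> A p = (\<Sum>i\<in>UNIV. \<Sum>j\<in>UNIV. c j *
      (mpoly_eval of_rat (($) \<phi>) (mpoly_deriv i p) * ratfun_deriv j (\<phi> $ i)))"
    by (simp add: generic_derivative_def c sum_distrib_left mult_ac)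
  also have "\<dots> = (\<Sum>j\<in>UNIV. c j * ratfun_deriv j (mpoly_eval of_rat (($) \<phi>) p))"
    by (subst sum.swap) (simp add: ratfun_deriv_mpoly_eval sum_distrib_left)
  also have "\<dots> = 0" by (simp add: p derivation_on_0[OF ratfun_deriv_derivation])
  finally show ?thesis .
qed

lemma zariski_closure_subset: "S \<subseteq> zariski_closure S"
  by (auto simp: zariski_closure_def)

lemma zariski_closure_vanishes:
  "(\<And>y. y \<in> S \<Longrightarrow> mpoly_eval id (($) y) p = 0) \<Longrightarrow> x \<in> zariski_closure S \<Longrightarrow> mpoly_eval id (($) x) p = 0"
  by (auto simp: zariski_closure_def)

lemma zariski_closure_idem: "zariski_closure (zariski_closure S) \<subseteq> zariski_closure S"
  by (auto simp: zariski_closure_def)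

lemma ratmap_rational_point:
  fixes x :: "rat ^ 'm::{finite,linorder}"
  assumes "ratmap_defined \<phi> x"
  shows "(\<chi> i. of_rat (ratmap_eval \<phi> x $ i)) \<in> ratmap_image \<phi>"
proof -
  let ?x = "(\<chi> j. of_rat (x $ j)) :: complex ^ 'm::{finite,linorder}"
  have x: "($) ?x = (\<lambda>j. of_rat (x $ j))" by (simp add: fun_eq_iff)
  have "ratmap_defined \<phi> ?x"
    using assms ratfun_of_rat_point(1) unfolding ratmap_defined_def x by blast
  moreover have "ratmap_eval \<phi> ?x = (\<chi> i. of_rat (ratmap_eval \<phi> x $ i))"
    using assms unfolding ratmap_defined_def ratmap_eval_def x
    by (simp add: vec_eq_iff ratfun_of_rat_point(2))
  ultimately show ?thesis unfolding ratmap_image_def by (metis (mono_tags) image_eqI mem_Collect_eq)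
qed

lemma rat_independent_zero:
  assumes "rat_independent C" "(\<Sum>c\<in>C. of_rat (r c) * c) = 0" "c \<in> C"
  shows "r c = 0"
  using assms unfolding rat_independent_def by blast

text \<open>It has to be shown that \<open>D\<^sub>A\<close> preserves the complex ideal of \<open>X\<close>. The rational components of a
  polynomial in this ideal vanish at the images of rational points and hence at the generic point
  \<open>\<phi>\<close>. So \<open>D\<^sub>A\<close> maps them to polynomials vanishing at \<open>\<phi>\<close>, thus on the image of \<open>\<phi>\<close> and on its closure.\<close>

lemma generic_lie_algebra_imp_lie_algebra:
  fixes \<phi> :: "('m::{finite,linorder} ratfun) ^ 'n"
  assumes A: "A \<in> generic_lie_algebra \<phi>"
  shows "map_matrix of_rat A \<in> lie_algebra (stabilizer (zariski_closure (ratmap_image \<phi>)))"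
proof (rule in_lie_algebra_stabilizer[OF zariski_closure_idem])
  fix p :: "('n, complex) mpoly" and x
  assume p: "\<And>y. y \<in> zariski_closure (ratmap_image \<phi>) \<Longrightarrow> mpoly_eval id (($) y) p = 0"
    and x: "x \<in> zariski_closure (ratmap_image \<phi>)"
  let ?A = "map_matrix of_rat A :: complex ^ 'n ^ 'n"
  obtain C P where C: "rat_independent C"
    and P: "\<And>x. mpoly_eval id x p = (\<Sum>c\<in>C. mpoly_eval of_rat x (P c) * c)"
    "\<And>i x. mpoly_eval id x (mpoly_deriv i p) = (\<Sum>c\<in>C. mpoly_eval of_rat x (mpoly_deriv i (P c)) * c)"
    using mpoly_rational_coordinates[of p] by blast
  have P0: "mpoly_eval of_rat (($) \<phi>) (P c) = 0" if c: "c \<in> C" for c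
  proof (rule ratfun_eq_0I[of \<phi>])
    fix u :: "rat ^ 'm::{finite,linorder}" assume u: "ratmap_defined \<phi> u"
    have "mpoly_eval id (($) (\<chi> i. of_rat (ratmap_eval \<phi> u $ i))) p = 0"
      using p zariski_closure_subset ratmap_rational_point[OF u] by blast
    then have "(\<Sum>c\<in>C. of_rat (mpoly_eval of_rat (($) (ratmap_eval \<phi> u)) (P c)) * c) = 0"
      unfolding P using mpoly_eval_of_rat_point[of "($) (ratmap_eval \<phi> u)", where 'k = complex]
      by (simp add: vec_lambda_beta[abs_def])
    from rat_independent_zero[OF C this c]
    show "ratfun_eval (mpoly_eval of_rat (($) \<phi>) (P c)) (($) u) = 0"
      by (simp add: ratmap_mpoly_eval[OF u])
  qed
  obtain q where q: "\<And>x. mpoly_eval id (($) x) q =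
      (\<Sum>i\<in>UNIV. mpoly_eval id (($) x) (mpoly_deriv i p) * (?A *v x) $ i)"
    by (rule matrix_derivation_mpoly[of p ?A]) (rule that)
  have "mpoly_eval id (($) y) q = 0" if "y \<in> ratmap_image \<phi>" for y
  proof -
    obtain u where u: "ratmap_defined \<phi> u" and y: "y = ratmap_eval \<phi> u"
      using \<open>y \<in> ratmap_image \<phi>\<close> by (auto simp: ratmap_image_def)
    have "mpoly_eval id (($) y) q = (\<Sum>i\<in>UNIV. \<Sum>c\<in>C. mpoly_eval of_rat (($) y) (mpoly_deriv i (P c)) * c * (?A *v y) $ i)"
      by (simp add: q P sum_distrib_right)
    also have "\<dots> = (\<Sum>c\<in>C. c * (\<Sum>i\<in>UNIV. mpoly_eval of_rat (($) y) (mpoly_deriv i (P c)) * (?A *v y) $ i))"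
      by (subst sum.swap) (simp add: sum_distrib_left mult_ac)
    also have "\<dots> = (\<Sum>c\<in>C. c * ratfun_eval (generic_derivative \<phi> A (P c)) (($) u))"
      by (simp add: generic_derivative_eval[OF u] y)
    also have "\<dots> = 0"
      using generic_derivative_eq_0[OF A P0] ratfun_const(2)[of 0 "($) u"] by simp
    finally show ?thesis .
  qed
  from zariski_closure_vanishes[OF this x]
  show "(\<Sum>i\<in>UNIV. mpoly_eval id (($) x) (mpoly_deriv i p) * (?A *v x) $ i) = 0"
    by (simp add: q)
qed

text \<open>The rational components of an element of \<open>\<gg>\<^sub>X\<close> belong to \<open>V\<close>: if \<open>p(\<phi>) = 0\<close>, then \<open>D\<^sub>A p\<close> vanishes at
  the image of every rational point; there its value is a combination of the rational numbers
  \<open>D\<^sub>Q p\<close>, for the components \<open>Q\<close>, with \<open>\<rat>\<close>-independent coefficients. So each \<open>D\<^sub>Q p\<close> vanishes at the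
  generic point, and \<open>Q \<phi>\<close> is tangent.\<close>

lemma lie_algebra_imp_generic_lie_algebra:
  fixes \<phi> :: "('m::{finite,linorder} ratfun) ^ 'n"
  assumes C: "rat_independent C"
    and A: "(\<Sum>c\<in>C. mscale c (map_matrix of_rat (Q c)))
      \<in> lie_algebra (stabilizer (zariski_closure (ratmap_image \<phi>)))"
    and c: "c \<in> C"
  shows "Q c \<in> generic_lie_algebra \<phi>"
proof -
  let ?A = "\<Sum>c\<in>C. mscale c (map_matrix of_rat (Q c)) :: complex ^ 'n ^ 'n"
  have "generic_derivative \<phi> (Q c) p = 0" if p: "mpoly_eval of_rat (($) \<phi>) p = 0" for p
  proof (rule ratfun_eq_0I[of \<phi>])
    fix u :: "rat ^ 'm::{finite,linorder}" assume u: "ratmap_defined \<phi> u"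
    define y where "y = ratmap_eval \<phi> u"
    define z :: "complex ^ 'n" where "z = (\<chi> i. of_rat (y $ i))"
    have z: "($) z = (\<lambda>i. of_rat (y $ i))" by (simp add: z_def fun_eq_iff)
    have zX: "z \<in> zariski_closure (ratmap_image \<phi>)"
      using zariski_closure_subset ratmap_rational_point[OF u] by (auto simp: z_def y_def)
    obtain P where P: "\<And>z. mpoly_eval id z P = mpoly_eval of_rat z p"
      "\<And>z i. mpoly_eval id z (mpoly_deriv i P) = (mpoly_eval of_rat z (mpoly_deriv i p) :: complex)"
      using mpoly_complexification[of p] by blast
    have "mpoly_eval id (($) w) P = 0" if w: "w \<in> ratmap_image \<phi>" for w
    proof -
      obtain v where v: "ratmap_defined \<phi> v" and w: "w = ratmap_eval \<phi> v"
        using w by (auto simp: ratmap_image_def)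
      show ?thesis
        using ratmap_mpoly_eval(2)[OF v, of p] ratfun_const(2)[of 0 "($) v"] by (simp add: P w p)
    qed
    then have "mpoly_eval id (($) w) P = 0" if "w \<in> zariski_closure (ratmap_image \<phi>)" for w
      using zariski_closure_vanishes that by blast
    from lie_algebra_stabilizer_tangent[OF A this zX]
    have "0 = (\<Sum>i\<in>UNIV. mpoly_eval of_rat (($) z) (mpoly_deriv i p) * (?A *v z) $ i)" by (simp add: P)
    also have "\<dots> = (\<Sum>i\<in>UNIV. of_rat (mpoly_eval of_rat (($) y) (mpoly_deriv i p)) *
        (\<Sum>c\<in>C. of_rat ((Q c *v y) $ i) * c))"
    proof (intro sum.cong refl arg_cong2[where f = "(*)"])
      fix i
      show "mpoly_eval of_rat (($) z) (mpoly_deriv i p) = (of_rat (mpoly_eval of_rat (($) y) (mpoly_deriv i p)) :: complex)"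
        unfolding z by (rule mpoly_eval_of_rat_point)
      have "(?A *v z) $ i = (\<Sum>j\<in>UNIV. \<Sum>c\<in>C. c * of_rat (Q c $ i $ j) * of_rat (y $ j))"
        by (simp add: matrix_vector_mult_def matrix_sum_nth z sum_distrib_right)
      also have "\<dots> = (\<Sum>c\<in>C. \<Sum>j\<in>UNIV. c * of_rat (Q c $ i $ j) * of_rat (y $ j))" by (rule sum.swap)
      also have "\<dots> = (\<Sum>c\<in>C. of_rat ((Q c *v y) $ i) * c)"
        by (simp add: matrix_vector_mult_def of_rat_sum of_rat_mult sum_distrib_left mult_ac)
      finally show "(?A *v z) $ i = (\<Sum>c\<in>C. of_rat ((Q c *v y) $ i) * c)" .
    qed
    also have "\<dots> = (\<Sum>i\<in>UNIV. \<Sum>c\<in>C. of_rat (mpoly_eval of_rat (($) y) (mpoly_deriv i p)) * of_rat ((Q c *v y) $ i) * c)"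
      by (simp add: sum_distrib_left mult.assoc)
    also have "\<dots> = (\<Sum>c\<in>C. \<Sum>i\<in>UNIV. of_rat (mpoly_eval of_rat (($) y) (mpoly_deriv i p)) * of_rat ((Q c *v y) $ i) * c)"
      by (rule sum.swap)
    also have "\<dots> = (\<Sum>c\<in>C. of_rat (\<Sum>i\<in>UNIV. mpoly_eval of_rat (($) y) (mpoly_deriv i p) * (Q c *v y) $ i) * c)"
      by (simp add: of_rat_sum of_rat_mult sum_distrib_right)
    finally have zero: "(\<Sum>c\<in>C. of_rat (\<Sum>i\<in>UNIV. mpoly_eval of_rat (($) y) (mpoly_deriv i p) * (Q c *v y) $ i) * c) = 0"
      by (rule sym)
    have "(\<Sum>i\<in>UNIV. mpoly_eval of_rat (($) y) (mpoly_deriv i p) * (Q c *v y) $ i) = 0"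
      by (rule rat_independent_zero[OF C _ c]) (fact zero)
    moreover have "map_matrix of_rat (Q c) = Q c" by (simp add: vec_eq_iff)
    ultimately show "ratfun_eval (generic_derivative \<phi> (Q c) p) (($) u) = 0"
      by (simp add: generic_derivative_eval[OF u] y_def)
  qed
  then have "\<exists>k. \<forall>i. (map_matrix of_rat (Q c) *v \<phi>) $ i = (\<Sum>j\<in>UNIV. k j * ratfun_deriv j (\<phi> $ i))"
    unfolding generic_derivative_def by (rule annihilates_relations_imp_jacobian_span)
  then show ?thesis by (simp add: generic_lie_algebra_def generic_tangent_space_iff)
qed

lemma subspace_lie_algebra: "mat.subspace (lie_algebra G)"
proof (rule mat.subspaceI)
  show "0 \<in> lie_algebra G" by (simp add: lie_algebra_def)
next
  fix A B assume "A \<in> lie_algebra G" "B \<in> lie_algebra G"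
  then show "A + B \<in> lie_algebra G"
    by (simp add: lie_algebra_def distrib_right case_prod_unfold sum.distrib)
next
  fix c A assume "A \<in> lie_algebra G"
  then show "mscale c A \<in> lie_algebra G"
    by (simp add: lie_algebra_def case_prod_unfold mult.assoc flip: sum_distrib_left)
qed

theorem generic_basis_imp_lie_algebra_basis:
  assumes "is_basis mscale B (generic_lie_algebra \<phi>)"
  shows "is_basis mscale (map_matrix of_rat ` B)
    (lie_algebra (stabilizer (zariski_closure (ratmap_image \<phi>))))"
  using assms subspace_lie_algebra generic_lie_algebra_imp_lie_algebra lie_algebra_imp_generic_lie_algebra
  by (rule is_basis_complexification)

section \<open>Specialization at a rational point\<close>

lemma matrix_vector_mult_axis: "(M :: 'a::field ^ 'm ^ 'n) *v axis k 1 = column k M"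
  by (simp add: vec_eq_iff matrix_vector_mult_def column_def axis_def if_distrib[of "\<lambda>c. _ * c"] cong: if_cong)

lemma column_combination_in_span:
  fixes M :: "'a::field ^ 'm ^ 'n"
  assumes "\<And>k. k \<notin> T \<Longrightarrow> y $ k = 0"
  shows "M *v y \<in> vec.span ((\<lambda>k. column k M) ` T)"
proof -
  have "M *v y = (\<Sum>k\<in>T. y $ k *s column k M)"
    unfolding matrix_mult_sum using assms by (intro sum.mono_neutral_right) auto
  then show ?thesis by (simp only:) (intro vec.span_sum vec.span_scale vec.span_base imageI)
qed

lemma in_span_columns_obtain:
  fixes M :: "'a::field ^ 'm ^ 'n"
  assumes "v \<in> vec.span ((\<lambda>k. column k M) ` T)"
  obtains y where "v = M *v y" "\<And>k. k \<notin> T \<Longrightarrow> y $ k = 0"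
proof -
  from assms have "\<exists>y. v = M *v y \<and> (\<forall>k. k \<notin> T \<longrightarrow> y $ k = 0)"
  proof (induction rule: vec.span_induct_alt)
    case base
    show ?case by (rule exI[of _ 0]) simp
  next
    case (step c x v)
    then obtain k y where k: "k \<in> T" "x = column k M" and y: "v = M *v y" "\<forall>k. k \<notin> T \<longrightarrow> y $ k = 0"
      by blast
    have "c *s x + v = M *v (c *s axis k 1 + y)"
      by (simp add: k y matrix_vector_right_distrib vec.scale matrix_vector_mult_axis)
    then show ?case using k y by (intro exI[of _ "c *s axis k 1 + y"]) (auto simp: axis_def)
  qed
  then show thesis using that by blast
qed

lemma column_not_in_span_columns:
  fixes M :: "'a::field ^ 'n ^ 'n"
  assumes "det M \<noteq> 0" "k \<notin> T"
  shows "column k M \<notin> vec.span ((\<lambda>k. column k M) ` T)"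
proof
  assume "column k M \<in> vec.span ((\<lambda>k. column k M) ` T)"
  then obtain y where y: "column k M = M *v y" "\<And>k. k \<notin> T \<Longrightarrow> y $ k = 0"
    by (rule in_span_columns_obtain) blast
  have "M *v axis k 1 = M *v y" using y(1) by (simp add: matrix_vector_mult_axis)
  moreover have "inj ((*v) M)"
    using assms(1) det_nz_iff_inj_gen[of "(*v) M"] by simp
  ultimately have "axis k 1 = y" by (simp add: inj_eq)
  then show False using y(2)[OF assms(2)] by (auto simp: axis_def)
qed

definition specialize :: "('m::{finite,linorder} ratfun) ^ 'n \<Rightarrow> 'k::field_char_0 ^ 'm::{finite,linorder} \<Rightarrow> 'k ^ 'n" where
  "specialize v x = (\<chi> i. ratfun_eval (v $ i) (($) x))"

text \<open>Membership in the span of some columns of \<open>M\<close> survives specialization as long as \<open>M\<close> stays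
  invertible. By Cramer's rule the coefficient of a column outside \<open>T\<close> is a quotient of
  determinants with numerator \<open>0\<close>, and determinants commute with evaluation.\<close>

lemma span_columns_specialize:
  fixes M :: "('m::{finite,linorder} ratfun) ^ 'n ^ 'n" and x :: "'k::field_char_0 ^ 'm::{finite,linorder}"
  assumes M: "\<And>i k. ratfun_defined (M $ i $ k) (($) x)" and v: "\<And>i. ratfun_defined (v $ i) (($) x)"
    and det: "det (\<chi> i k. ratfun_eval (M $ i $ k) (($) x)) \<noteq> 0"
    and span: "v \<in> vec.span ((\<lambda>k. column k M) ` T)"
  shows "specialize v x \<in> vec.span ((\<lambda>k. specialize (column k M) x) ` T)"
proof -
  define Mx where "Mx = (\<chi> i k. ratfun_eval (M $ i $ k) (($) x))"
  have col: "specialize (column k M) x = column k Mx" for k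
    by (simp add: specialize_def column_def Mx_def)
  obtain y where y: "v = M *v y" "\<And>k. k \<notin> T \<Longrightarrow> y $ k = 0"
    using span by (rule in_span_columns_obtain) blast
  have "invertible Mx" using det by (simp add: invertible_det_nz Mx_def)
  then obtain z where z: "specialize v x = Mx *v z"
    by (metis invertible_def matrix_vector_mul_assoc matrix_vector_mul_lid)
  have vx: "ratfun_eval (v $ i) (($) x) = (Mx *v z) $ i" for i
    by (simp add: specialize_def flip: z)
  have "z $ k = 0" if k: "k \<notin> T" for k
  proof -
    let ?N = "\<chi> i j. if j = k then (M *v y) $ i else M $ i $ j"
    have "det ?N = 0" using y(2)[OF k] by (simp add: cramer_lemma)
    moreover have "ratfun_eval (det ?N) (($) x) = det (\<chi> i j. ratfun_eval (?N $ i $ j) (($) x))"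
      by (rule ratfun_det[THEN conjunct2]) (use M v y(1) in auto)
    moreover have "(\<chi> i j. ratfun_eval (?N $ i $ j) (($) x)) = (\<chi> i j. if j = k then (Mx *v z) $ i else Mx $ i $ j)"
      by (simp add: vec_eq_iff vx flip: y(1)) (simp add: Mx_def)
    ultimately have "det (\<chi> i j. if j = k then (Mx *v z) $ i else Mx $ i $ j) = 0"
      using ratfun_const(2)[of 0 "($) x"] by simp
    then show ?thesis using det by (simp add: cramer_lemma Mx_def)
  qed
  then show ?thesis unfolding col z by (rule column_combination_in_span)
qed

lemma det_scale_rows_columns:
  fixes M :: "'a::comm_ring_1 ^ 'n ^ 'n"
  shows "det (\<chi> i k. r i * c k * M $ i $ k) = (\<Prod>i\<in>UNIV. r i) * (\<Prod>k\<in>UNIV. c k) * det M"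
proof -
  have "(\<Prod>i\<in>UNIV. r i * c (p i) * M $ i $ p i) = (\<Prod>i\<in>UNIV. r i) * (\<Prod>k\<in>UNIV. c k) * (\<Prod>i\<in>UNIV. M $ i $ p i)"
    if "p permutes UNIV" for p
    using prod.permute[OF that, of c] by (simp add: prod.distrib o_def)
  then show ?thesis by (simp add: det_def sum_distrib_left mult_ac)
qed

lemma Fract_sum:
  fixes f :: "'i \<Rightarrow> ('v::linorder, rat) mpoly"
  shows "Fract (\<Sum>i\<in>I. f i) 1 = (\<Sum>i\<in>I. Fract (f i) 1)"
  using mpoly_eval_sum[OF coeff_hom_of_rat, of "\<lambda>v. Fract (mvar v) 1 :: 'v ratfun" f I]
  by (simp only: mpoly_eval_generic)

lemma Fract_det:
  fixes M :: "('v::linorder, rat) mpoly ^ 'n ^ 'n"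
  shows "Fract (det M) 1 = det (\<chi> i k. Fract (M $ i $ k) 1)"
  using mpoly_eval_det[OF coeff_hom_of_rat, of "\<lambda>v. Fract (mvar v) 1 :: 'v ratfun" M]
  by (simp only: mpoly_eval_generic)

text \<open>Denominators are cleared by row factors \<open>s i\<close> common to all columns, which keeps the degree of a
  cleared determinant linear in \<open>n\<close>, and by a factor \<open>t\<close> for columns with further denominators.\<close>

definition clears_column ::
    "('n \<Rightarrow> ('m, rat) mpoly) \<Rightarrow> ('m::{finite,linorder}, rat) mpoly \<Rightarrow> ('m ratfun) ^ 'n \<Rightarrow> ('n \<Rightarrow> ('m, rat) mpoly) \<Rightarrow> bool" where
  "clears_column s t v n \<longleftrightarrow> (\<forall>i. Fract (n i) 1 = Fract (s i * t) 1 * v $ i)"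

context
  fixes \<phi> :: "('m::{finite,linorder} ratfun) ^ 'n" and a b :: "'n \<Rightarrow> ('m, rat) mpoly" and d :: nat
  assumes b_nz: "\<And>i. b i \<noteq> 0" and \<phi>_eq: "\<And>i. \<phi> $ i = Fract (a i) (b i)"
    and deg_a: "\<And>i. mpoly_degree_le (a i) d" and deg_b: "\<And>i. mpoly_degree_le (b i) d"
begin

lemma clear_jacobian_column:
  "\<exists>n. clears_column (\<lambda>i. b i * b i) 1 (generic_jacobian_column \<phi> j) n \<and> (\<forall>i. mpoly_degree_le (n i) (2 * d))"
proof (intro exI conjI allI)
  show "clears_column (\<lambda>i. b i * b i) 1 (generic_jacobian_column \<phi> j)
      (\<lambda>i. mpoly_deriv j (a i) * b i - a i * mpoly_deriv j (b i))"
    using b_nz by (simp add: clears_column_def generic_jacobian_column_def \<phi>_eq ratfun_deriv_Fract eq_fract)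
  show "mpoly_degree_le (mpoly_deriv j (a i) * b i - a i * mpoly_deriv j (b i)) (2 * d)" for i
    unfolding mult_2 by (intro mpoly_degree_le_diff mpoly_degree_le_mult mpoly_degree_le_deriv deg_a deg_b)
qed

lemma clear_unit_column:
  "\<exists>n. clears_column (\<lambda>i. b i * b i) 1 (axis l 1) n \<and> (\<forall>i. mpoly_degree_le (n i) (2 * d))"
proof (intro exI conjI allI)
  show "clears_column (\<lambda>i. b i * b i) 1 (axis l 1) (\<lambda>i. if i = l then b i * b i else 0)"
    by (auto simp: clears_column_def axis_def Zero_fract_def)
  show "mpoly_degree_le (if i = l then b i * b i else 0) (2 * d)" for i
    by (auto simp: mult_2 intro: mpoly_degree_le_zero mpoly_degree_le_mult deg_b)
qed

text \<open>The entries of \<open>A \<phi>\<close> involve all denominators \<open>b j\<close> at once, hence the factor \<open>\<Prod>i. b i\<close>.\<close>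

lemma clear_image_column:
  fixes A :: "rat ^ 'n ^ 'n"
  shows "\<exists>n. clears_column (\<lambda>i. b i * b i) (\<Prod>i\<in>UNIV. b i) (map_matrix of_rat A *v \<phi>) n \<and>
     (\<forall>i. mpoly_degree_le (n i) (2 * d + CARD('n) * d))"
proof (intro exI conjI allI)
  let ?n = "\<lambda>i. b i * b i * (\<Sum>j\<in>UNIV. mconst (A $ i $ j) * (a j * (\<Prod>l\<in>UNIV - {j}. b l)))"
  have prod: "(\<Prod>l\<in>UNIV. b l) = b j * (\<Prod>l\<in>UNIV - {j}. b l)" for j
    by (rule prod.remove) simp_all
  have summand: "Fract (mconst (A $ i $ j) * (a j * (\<Prod>l\<in>UNIV - {j}. b l))) 1
      = Fract (\<Prod>l\<in>UNIV. b l) 1 * (of_rat (A $ i $ j) * \<phi> $ j)" for i j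
    using b_nz[of j] by (simp add: prod[of j] \<phi>_eq of_rat_ratfun eq_fract mult_ac)
  show "clears_column (\<lambda>i. b i * b i) (\<Prod>i\<in>UNIV. b i) (map_matrix of_rat A *v \<phi>) ?n"
    unfolding clears_column_def
  proof
    fix i
    have "Fract (?n i) 1 = Fract (b i * b i) 1 * Fract (\<Sum>j\<in>UNIV. mconst (A $ i $ j) * (a j * (\<Prod>l\<in>UNIV - {j}. b l))) 1"
      by simp
    also have "\<dots> = Fract (b i * b i) 1 * (Fract (\<Prod>l\<in>UNIV. b l) 1 * (map_matrix of_rat A *v \<phi>) $ i)"
      by (simp only: Fract_sum summand) (simp add: matrix_vector_mult_def sum_distrib_left)
    also have "\<dots> = Fract (b i * b i * (\<Prod>l\<in>UNIV. b l)) 1 * (map_matrix of_rat A *v \<phi>) $ i"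
      by (simp flip: mult.assoc)
    finally show "Fract (?n i) 1 = Fract (b i * b i * (\<Prod>l\<in>UNIV. b l)) 1 * (map_matrix of_rat A *v \<phi>) $ i" .
  qed
  show "mpoly_degree_le (?n i) (2 * d + CARD('n) * d)" for i
  proof (intro mpoly_degree_le_mult mpoly_degree_le_sum)
    show "mpoly_degree_le (b i * b i) (2 * d)" unfolding mult_2 by (intro mpoly_degree_le_mult deg_b)
    fix j
    have "mpoly_degree_le (mconst (A $ i $ j) * (a j * (\<Prod>l\<in>UNIV - {j}. b l))) (0 + (d + (\<Sum>l\<in>UNIV - {j}. d)))"
      by (intro mpoly_degree_le_mult mpoly_degree_le_prod mpoly_degree_le_const deg_a deg_b)
    moreover have "d + (\<Sum>l\<in>UNIV - {j}. d) = CARD('n) * d"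
      using sum.remove[of UNIV j "\<lambda>_. d"] by simp
    ultimately show "mpoly_degree_le (mconst (A $ i $ j) * (a j * (\<Prod>l\<in>UNIV - {j}. b l))) (CARD('n) * d)"
      by simp
  qed
qed

lemma generic_jacobian_column_defined:
  fixes x :: "rat ^ 'm::{finite,linorder}"
  assumes "\<And>i. mpoly_eval of_rat (($) x) (b i) \<noteq> 0"
  shows "ratfun_defined (generic_jacobian_column \<phi> j $ i) (($) x)"
  unfolding generic_jacobian_column_def vec_lambda_beta \<phi>_eq ratfun_deriv_Fract[OF b_nz]
  by (rule ratfun_Fract) (use assms in \<open>simp add: mpoly_eval_simps\<close>)

lemma ratmap_defined_if_denominators_nonzero:
  fixes x :: "rat ^ 'm::{finite,linorder}"
  assumes "\<And>i. mpoly_eval of_rat (($) x) (b i) \<noteq> 0"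
  shows "ratmap_defined \<phi> x"
  unfolding ratmap_defined_def \<phi>_eq using ratfun_Fract(1)[OF assms] by blast

lemma specialize_image:
  fixes x :: "rat ^ 'm::{finite,linorder}" and A :: "rat ^ 'n ^ 'n"
  assumes "ratmap_defined \<phi> x"
  shows "specialize (map_matrix of_rat A *v \<phi>) x = A *v ratmap_eval \<phi> x"
proof -
  have "map_matrix of_rat A = A" by (simp add: vec_eq_iff)
  note ratmap_linear(2)[OF assms, of A, unfolded this]
  then show ?thesis by (simp add: specialize_def vec_eq_iff)
qed

lemma specialize_jacobian_column: "specialize (generic_jacobian_column \<phi> j) x = column j (jacobian \<phi> x)"
  by (simp add: specialize_def generic_jacobian_column_def column_def jacobian_def vec_eq_iff)

text \<open>Choose columns of the generic Jacobian that form a basis of \<open>W\<close>, adjoin \<open>A \<phi>\<close> if it is not in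
  \<open>W\<close>, and complete them by unit vectors to a basis of \<open>K\<^sup>n\<close>, the columns of an invertible matrix
  \<open>M\<close>. Let \<open>Z\<close> be the product of the denominators with the determinant of \<open>M\<close> after clearing
  denominators. Where \<open>Z\<close> does not vanish, \<open>M\<close> specializes to an invertible matrix, so the column
  space of the Jacobian is exactly the span of the chosen columns: it contains \<open>A' \<phi>\<close> for all
  \<open>A' \<in> V\<close>, and the adjoined column \<open>A \<phi>\<close> remains independent of it.\<close>

lemma good_polynomial_exists:
  fixes A :: "rat ^ 'n ^ 'n"
  obtains Z where "Z \<noteq> 0" "mpoly_degree_le Z (4 * CARD('n) * d)"
    "\<And>x :: rat ^ 'm::{finite,linorder}. mpoly_eval of_rat (($) x) Z \<noteq> 0 \<Longrightarrow> ratmap_defined \<phi> x \<and>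
       (\<forall>A'\<in>generic_lie_algebra \<phi>. A' *v ratmap_eval \<phi> x \<in> vec.span (columns (jacobian \<phi> x))) \<and>
       (A \<notin> generic_lie_algebra \<phi> \<longrightarrow> A *v ratmap_eval \<phi> x \<notin> vec.span (columns (jacobian \<phi> x)))"
proof -
  let ?J = "range (generic_jacobian_column \<phi>)" and ?W = "generic_tangent_space \<phi>"
  let ?w = "map_matrix of_rat A *v \<phi>"
  \<comment> \<open>The additional basis vector, if there is one.\<close>
  define X where "X = (if A \<in> generic_lie_algebra \<phi> then {} else {?w})"
  obtain B where B: "B \<subseteq> ?J" "vec.independent B" "?J \<subseteq> vec.span B"
    by (rule vec.maximal_independent_subset)
  have W: "?W = vec.span B"
    unfolding generic_tangent_space_def
    using vec.span_mono[OF B(1)] vec.span_minimal[OF B(3) vec.subspace_span] by blast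
  have XW: "v \<notin> ?W" if "v \<in> X" for v
    using that by (auto simp: X_def generic_lie_algebra_def split: if_splits)
  have "vec.independent (B \<union> X)"
    using B(2) XW W by (auto simp: X_def vec.independent_insert)
  then obtain B' where B': "B \<union> X \<subseteq> B'" "B' \<subseteq> B \<union> X \<union> cart_basis" "vec.independent B'"
     "B \<union> X \<union> cart_basis \<subseteq> vec.span B'"
    by (rule vec.maximal_independent_subset_extend[OF Un_upper1])
  have spanB': "vec.span B' = UNIV"
    using B'(4) vec.span_mono[of cart_basis "vec.span B'"] by (auto simp: vec.span_span)
  have "card B' = CARD('n)"
    using vec.dim_eq_card[OF _ B'(3), of UNIV] spanB' by (simp add: card_cart_basis)
  moreover have "finite B'" using B'(3) by (rule vec.finiteI_independent)
  ultimately obtain c :: "'n \<Rightarrow> ('m ratfun) ^ 'n" where c: "bij_betw c UNIV B'"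
    using finite_same_card_bij[of "UNIV :: 'n set" B'] by auto
  then have c_range: "range c = B'" and c_inj: "inj c" by (auto simp: bij_betw_def)
  define M where "M = (\<chi> i k. c k $ i)"
  have col: "column k M = c k" for k by (simp add: M_def column_def vec_eq_iff)
  have "columns M = B'" using c_range by (auto simp: columns_def col)
  then obtain M' where "M ** M' = mat 1"
    using matrix_right_invertible_span_columns[of M] spanB' by auto
  then have "invertible M" by (metis invertible_def matrix_left_right_inverse)
  then have detM: "det M \<noteq> 0" by (simp add: invertible_det_nz)
  define T where "T = {k. c k \<in> B}"
  have cT: "c ` T = B" using c_range B'(1) by (auto simp: T_def image_iff)
  let ?\<beta> = "\<Prod>i\<in>UNIV. b i"
  let ?t = "\<lambda>k. if c k \<in> X then ?\<beta> else 1" and ?e = "\<lambda>k. if c k \<in> X then CARD('n) * d else 0"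
  have "\<forall>k. \<exists>n. clears_column (\<lambda>i. b i * b i) (?t k) (c k) n \<and> (\<forall>i. mpoly_degree_le (n i) (2 * d + ?e k))"
  proof
    fix k
    show "\<exists>n. clears_column (\<lambda>i. b i * b i) (?t k) (c k) n \<and> (\<forall>i. mpoly_degree_le (n i) (2 * d + ?e k))"
    proof (cases "c k \<in> X")
      case True
      then have "c k = ?w" by (auto simp: X_def split: if_splits)
      then show ?thesis using clear_image_column[of A] True by simp
    next
      case False
      have "c k \<in> B'" using c_range by blast
      then consider j where "c k = generic_jacobian_column \<phi> j" | l where "c k = axis l 1"
        using B'(2) B(1) False unfolding cart_basis_def by blast
      then show ?thesis
      proof cases
        case 1
        then show ?thesis using False clear_jacobian_column[of j] by simp
      next
        case 2
        then show ?thesis using False clear_unit_column[of l] by simp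
      qed
    qed
  qed
  then have "\<exists>n. \<forall>k. clears_column (\<lambda>i. b i * b i) (?t k) (c k) (n k) \<and>
      (\<forall>i. mpoly_degree_le (n k i) (2 * d + ?e k))" by (rule choice)
  then obtain n where n: "\<And>k. clears_column (\<lambda>i. b i * b i) (?t k) (c k) (n k)"
    and deg_n: "\<And>k i. mpoly_degree_le (n k i) (2 * d + ?e k)" by blast
  define N where "N = (\<chi> i k. n k i)"
  have N: "Fract (N $ i $ k) 1 = Fract (b i * b i) 1 * Fract (?t k) 1 * M $ i $ k" for i k
    using n[of k] by (simp add: clears_column_def N_def M_def)
  define Z where "Z = ?\<beta> * det N"
  show thesis
  proof (rule that[of Z])
    have "Fract (det N) 1 = det (\<chi> i k. Fract (N $ i $ k) 1)"
      by (rule Fract_det)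
    also have "\<dots> = (\<Prod>i\<in>UNIV. Fract (b i * b i) 1) * (\<Prod>k\<in>UNIV. Fract (?t k) 1) * det M"
      unfolding N by (rule det_scale_rows_columns)
    also have "\<dots> \<noteq> 0"
    proof -
      have "Fract q 1 = 0 \<longleftrightarrow> q = 0" for q :: "('m, rat) mpoly"
        by (simp add: Zero_fract_def eq_fract)
      then show ?thesis using detM b_nz by simp
    qed
    finally have "det N \<noteq> 0" by (auto simp: Zero_fract_def)
    then show "Z \<noteq> 0" using b_nz by (simp add: Z_def)
    \<comment> \<open>At most one column is \<open>A \<phi>\<close>, so the expensive factor occurs at most once.\<close>
    have "(\<Sum>k\<in>UNIV. ?e k) \<le> CARD('n) * d"
    proof -
      have "(\<Sum>k\<in>UNIV. ?e k) = card {k. c k \<in> X} * (CARD('n) * d)" by (simp add: sum.If_cases)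
      moreover have "card {k. c k \<in> X} \<le> card X"
        using c_inj by (intro card_inj_on_le[of c]) (auto simp: X_def inj_on_def)
      moreover have "card X \<le> 1" by (simp add: X_def)
      ultimately show ?thesis using mult_le_mono1[of "card {k. c k \<in> X}" 1 "CARD('n) * d"] by linarith
    qed
    moreover have "mpoly_degree_le (det N) ((\<Sum>i\<in>(UNIV :: 'n set). 2 * d) + (\<Sum>k\<in>UNIV. ?e k))"
      by (rule mpoly_degree_le_det) (simp only: N_def vec_lambda_beta deg_n)
    ultimately have "mpoly_degree_le (det N) (3 * CARD('n) * d)"
      by (elim mpoly_degree_le_mono) (simp add: mult_ac)
    moreover have "mpoly_degree_le ?\<beta> (CARD('n) * d)"
      using mpoly_degree_le_prod[of UNIV b "\<lambda>_. d"] deg_b by simp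
    ultimately have "mpoly_degree_le Z (CARD('n) * d + 3 * CARD('n) * d)"
      unfolding Z_def by (intro mpoly_degree_le_mult)
    then show "mpoly_degree_le Z (4 * CARD('n) * d)" by (simp add: algebra_simps)
  next
    fix x :: "rat ^ 'm::{finite,linorder}"
    assume Zx: "mpoly_eval of_rat (($) x) Z \<noteq> 0"
    let ?ev = "mpoly_eval of_rat (($) x)"
    have bx: "?ev (b i) \<noteq> 0" for i
      using Zx by (simp add: Z_def mpoly_eval_simps mpoly_eval_prod)
    have detN: "?ev (det N) \<noteq> 0"
      using Zx by (simp add: Z_def mpoly_eval_simps)
    have def_x: "ratmap_defined \<phi> x" using bx by (rule ratmap_defined_if_denominators_nonzero)
    have def_c: "ratfun_defined (c k $ i) (($) x)" for k i
    proof -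
      have "c k \<in> B \<union> X \<union> cart_basis" using c_range B'(2) by blast
      then consider "c k \<in> ?J" | "c k = ?w" | l where "c k = axis l 1"
        using B(1) by (auto simp: X_def cart_basis_def split: if_splits)
      then show ?thesis
      proof cases
        case 1
        then show ?thesis using generic_jacobian_column_defined[OF bx] by auto
      next
        case 2
        then show ?thesis using ratmap_linear(1)[OF def_x] by simp
      next
        case 3
        then show ?thesis using ratfun_const(1)[of 0] ratfun_const(1)[of 1] by (auto simp: axis_def)
      qed
    qed
    then have def_M: "ratfun_defined (M $ i $ k) (($) x)" for i k by (simp add: M_def)
    define Mx where "Mx = (\<chi> i k. ratfun_eval (M $ i $ k) (($) x))"
    have Nx: "?ev (N $ i $ k) = ?ev (b i * b i) * ?ev (?t k) * Mx $ i $ k" for i k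
    proof -
      have "?ev (N $ i $ k) = ratfun_eval (Fract (N $ i $ k) 1) (($) x)" by (simp only: ratfun_poly)
      also have "\<dots> = ?ev (b i * b i) * ?ev (?t k) * Mx $ i $ k"
        unfolding N by (simp only: ratfun_mult ratfun_poly def_M Mx_def vec_lambda_beta)
      finally show ?thesis .
    qed
    have "?ev (det N) = det (\<chi> i k. ?ev (b i * b i) * ?ev (?t k) * Mx $ i $ k)"
      using Nx by (simp add: mpoly_eval_det)
    also have "\<dots> = (\<Prod>i\<in>UNIV. ?ev (b i * b i)) * (\<Prod>k\<in>UNIV. ?ev (?t k)) * det Mx"
      by (rule det_scale_rows_columns)
    finally have detMx: "det Mx \<noteq> 0" using detN by auto
    have colx: "specialize (c k) x = column k Mx" for k
      by (simp add: specialize_def column_def Mx_def M_def)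
    have spec: "specialize v x \<in> vec.span ((\<lambda>k. column k Mx) ` T)"
      if "v \<in> ?W" "\<And>i. ratfun_defined (v $ i) (($) x)" for v
      using span_columns_specialize[OF def_M that(2) detMx[unfolded Mx_def], of T] that(1)
      by (simp add: col colx cT W)
    have sub: "vec.span ((\<lambda>k. column k Mx) ` T) \<subseteq> vec.span (columns (jacobian \<phi> x))"
    proof (rule vec.span_mono, rule image_subsetI)
      fix k assume "k \<in> T"
      then obtain j where "c k = generic_jacobian_column \<phi> j" using B(1) by (auto simp: T_def)
      then show "column k Mx \<in> columns (jacobian \<phi> x)"
        using colx[of k] by (auto simp: specialize_jacobian_column columns_def intro: sym)
    qed
    have sup: "vec.span (columns (jacobian \<phi> x)) \<subseteq> vec.span ((\<lambda>k. column k Mx) ` T)"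
    proof (rule vec.span_minimal)
      show "columns (jacobian \<phi> x) \<subseteq> vec.span ((\<lambda>k. column k Mx) ` T)"
        using spec[OF _ generic_jacobian_column_defined[OF bx]]
        by (auto simp: columns_def generic_tangent_space_def vec.span_base simp flip: specialize_jacobian_column)
    qed (rule vec.subspace_span)
    show "ratmap_defined \<phi> x \<and>
       (\<forall>A'\<in>generic_lie_algebra \<phi>. A' *v ratmap_eval \<phi> x \<in> vec.span (columns (jacobian \<phi> x))) \<and>
       (A \<notin> generic_lie_algebra \<phi> \<longrightarrow> A *v ratmap_eval \<phi> x \<notin> vec.span (columns (jacobian \<phi> x)))"
    proof (intro conjI ballI impI)
      fix A' assume "A' \<in> generic_lie_algebra \<phi>"
      then show "A' *v ratmap_eval \<phi> x \<in> vec.span (columns (jacobian \<phi> x))"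
        using spec[of "map_matrix of_rat A' *v \<phi>"] ratmap_linear(1)[OF def_x, of A'] sub
        by (auto simp: generic_lie_algebra_def specialize_image[OF def_x])
    next
      assume A: "A \<notin> generic_lie_algebra \<phi>"
      then have "?w \<in> B'" "?w \<notin> B" using B'(1) XW W vec.span_base[of ?w B] by (auto simp: X_def)
      then obtain k where k: "c k = ?w" "k \<notin> T" using c_range by (metis T_def imageE mem_Collect_eq)
      have "A *v ratmap_eval \<phi> x = column k Mx"
        using colx[of k] k(1) by (simp add: specialize_image[OF def_x])
      then show "A *v ratmap_eval \<phi> x \<notin> vec.span (columns (jacobian \<phi> x))"
        using column_not_in_span_columns[OF detMx k(2)] sup by auto
    qed (fact def_x)
  qed
qed

end

section \<open>Success probability of the algorithm\<close>

definition solutions :: "(rat ^ 'n ^ 'n \<Rightarrow> rat) set \<Rightarrow> (rat ^ 'n ^ 'n) set" where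
  "solutions L = {A. \<forall>l\<in>L. l A = 0}"

definition linear_system :: "(rat ^ 'n ^ 'n \<Rightarrow> rat) set \<Rightarrow> bool" where
  "linear_system L \<longleftrightarrow> finite L \<and> (\<forall>l\<in>L. Vector_Spaces.linear mscale (*) l)"

lemma subspace_solutions:
  assumes "linear_system L"
  shows "mat.subspace (solutions L)"
proof (rule mat.subspaceI)
  have lin: "l (x + y) = l x + l y" "l (mscale c x) = c * l x" "l 0 = 0" if "l \<in> L" for l x y c
  proof -
    have l: "Vector_Spaces.linear mscale (*) l" using assms that by (simp add: linear_system_def)
    then show add: "l (x + y) = l x + l y" and "l (mscale c x) = c * l x" for x y
      by (simp_all add: Vector_Spaces.linear_iff)
    show "l 0 = 0" using add[of 0 0] by simp
  qed
  show "0 \<in> solutions L" using lin(3) by (simp add: solutions_def)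
  show "x + y \<in> solutions L" if "x \<in> solutions L" "y \<in> solutions L" for x y
    unfolding solutions_def
  proof (intro CollectI ballI)
    fix l assume l: "l \<in> L"
    then have "l x = 0" "l y = 0" using that unfolding solutions_def by blast+
    then show "l (x + y) = 0" using lin(1)[OF l, of x y] by simp
  qed
  show "mscale c x \<in> solutions L" if "x \<in> solutions L" for c x
    unfolding solutions_def
  proof (intro CollectI ballI)
    fix l assume l: "l \<in> L"
    then have "l x = 0" using that unfolding solutions_def by blast
    then show "l (mscale c x) = 0" using lin(2)[OF l, of c x] by simp
  qed
qed

text \<open>Matrices are flattened to vectors in order to measure the dimension of spaces of matrices with
  the dimension theory of \<open>\<rat>\<^sup>k\<close>.\<close>

definition flatten :: "rat ^ 'n ^ 'n \<Rightarrow> rat ^ ('n \<times> 'n)" where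
  "flatten A = (\<chi> ij. A $ fst ij $ snd ij)"

definition matrix_dim :: "(rat ^ 'n ^ 'n) set \<Rightarrow> nat" where
  "matrix_dim U = vec.dim (flatten ` U)"

lemma inj_flatten: "inj flatten"
proof (rule injI)
  fix A B :: "rat ^ 'n ^ 'n" assume "flatten A = flatten B"
  then have "flatten A $ (i, j) = flatten B $ (i, j)" for i j by simp
  then show "A = B" by (simp add: flatten_def vec_eq_iff)
qed

lemma subspace_flatten:
  assumes "mat.subspace U"
  shows "vec.subspace (flatten ` U)"
proof (rule vec.subspaceI)
  have z: "flatten 0 = 0" by (simp add: flatten_def vec_eq_iff)
  have a: "flatten A + flatten B = flatten (A + B)" for A B :: "rat ^ 'n ^ 'n"
    by (simp add: flatten_def vec_eq_iff)
  have s: "c *s flatten A = flatten (mscale c A)" for c and A :: "rat ^ 'n ^ 'n"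
    by (simp add: flatten_def vec_eq_iff)
  show "0 \<in> flatten ` U" using mat.subspace_0[OF assms] z by (metis imageI)
  show "x + y \<in> flatten ` U" if "x \<in> flatten ` U" "y \<in> flatten ` U" for x y
    using that mat.subspace_add[OF assms] by (auto simp: a)
  show "c *s x \<in> flatten ` U" if "x \<in> flatten ` U" for c x
    using that mat.subspace_scale[OF assms] by (auto simp: s)
qed

lemma matrix_dim_strict_mono:
  fixes U V :: "(rat ^ 'n ^ 'n) set"
  assumes "mat.subspace U" "mat.subspace V" "U \<subset> V"
  shows "matrix_dim U < matrix_dim V"
  unfolding matrix_dim_def
proof (rule vec.dim_psubset)
  have "flatten ` U \<subset> flatten ` V" using assms(3)
    by (simp add: psubset_eq inj_image_subset_iff[OF inj_flatten] inj_image_eq_iff[OF inj_flatten])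
  moreover have span: "vec.span (flatten ` W) = flatten ` W" if "mat.subspace W" for W :: "(rat ^ 'n ^ 'n) set"
    using subspace_flatten[OF that] by (simp only: vec.span_eq_iff)
  ultimately show "vec.span (flatten ` U) \<subset> vec.span (flatten ` V)"
    by (simp only: span[OF assms(1)] span[OF assms(2)])
qed

lemma matrix_dim_le: "matrix_dim (U :: (rat ^ 'n ^ 'n) set) \<le> (CARD('n))\<^sup>2"
proof -
  have "vec.dim (flatten ` U) \<le> vec.dim (UNIV :: (rat ^ ('n \<times> 'n)) set)"
    by (rule vec.dim_subset) simp
  also have "\<dots> = (CARD('n))\<^sup>2" by (simp add: card_cart_basis power2_eq_square)
  finally show ?thesis by (simp add: matrix_dim_def)
qed

text \<open>If \<open>y \<notin> U\<close>, then some linear functional vanishes on \<open>U\<close> but not at \<open>y\<close>. It is the scalar product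
  with a vector of the orthogonal complement, and so with a combination of elements of \<open>E\<close>.\<close>

lemma double_orthogonal_complement:
  fixes U :: "(rat ^ 'n) set"
  assumes U: "vec.subspace U" and E: "is_basis (*s) E (orthogonal_complement U)"
  shows "(\<forall>e\<in>E. scalar_product e y = 0) \<longleftrightarrow> y \<in> U"
proof
  have spanE: "vec.span E = orthogonal_complement U" using E by (simp add: is_basis_def)
  show "\<forall>e\<in>E. scalar_product e y = 0" if "y \<in> U"
    using that spanE vec.span_superset[of E] by (auto simp: orthogonal_complement_def)
  assume y: "\<forall>e\<in>E. scalar_product e y = 0"
  show "y \<in> U"
  proof (rule ccontr)
    assume yU: "y \<notin> U"
    obtain B where B: "B \<subseteq> U" "vec.independent B" "U \<subseteq> vec.span B"
      by (rule vec.maximal_independent_subset)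
    have "vec.span B \<subseteq> U" by (rule vec.span_minimal[OF B(1) U])
    then have yB: "y \<notin> vec.span B" using yU by blast
    then have "vec.independent (insert y B)" using B(2) by (simp add: vec.independent_insert)
    from vec.linear_independent_extend[OF this, of "\<lambda>x. if x = y then y else 0"]
    obtain g :: "rat ^ 'n \<Rightarrow> rat ^ 'n" where g: "Vector_Spaces.linear (*s) (*s) g"
      and gy: "\<And>x. x \<in> insert y B \<Longrightarrow> g x = (if x = y then y else 0)" by blast
    have gB: "g x = 0" if "x \<in> B" for x using gy[of x] that yB vec.span_base by auto
    have G: "matrix g *v x = g x" for x using g by (rule matrix_works)
    have "y \<noteq> 0" using yB vec.span_zero by blast
    then obtain i where i: "y $ i \<noteq> 0" by (auto simp: vec_eq_iff)
    let ?e = "matrix g $ i"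
    have sp: "scalar_product ?e x = g x $ i" for x
      by (simp add: scalar_product_def flip: G) (simp add: matrix_vector_mult_def)
    have "g x = 0" if "x \<in> vec.span B" for x
      using that
    proof (induction rule: vec.span_induct_alt)
      case base
      show ?case by (simp flip: G)
    next
      case (step c x z)
      then show ?case using gB[of x] by (simp add: vec.linear_add[OF g] vec.linear_scale[OF g])
    qed
    then have "?e \<in> orthogonal_complement U" using B(3) sp by (auto simp: orthogonal_complement_def)
    then have "?e \<in> vec.span E" by (simp add: spanE)
    then have "scalar_product ?e y = 0"
    proof (induction rule: vec.span_induct_alt)
      case base
      show ?case by (simp add: scalar_product_def)
    next
      case (step c x z)
      have "scalar_product (c *s x + z) y = c * scalar_product x y + scalar_product z y"
        by (simp add: scalar_product_def distrib_right sum.distrib sum_distrib_left mult.assoc)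
      then show ?case using step y by simp
    qed
    then show False using sp[of y] gy[of y] i by simp
  qed
qed

lemma linear_system_extend:
  assumes "linear_system L" and E: "complement_basis_choice E"
  shows "linear_system (L \<union> (\<lambda>e A. scalar_product e (A *v q)) ` E J)"
proof -
  have "vec.independent (E J)" using E by (auto simp: complement_basis_choice_def is_basis_def)
  then have "finite (E J)" by (rule vec.finiteI_independent)
  moreover have "Vector_Spaces.linear mscale (*) (\<lambda>A. scalar_product e (A *v q))" for e
  proof -
    have "scalar_product e ((A + B) *v q) = scalar_product e (A *v q) + scalar_product e (B *v q)" for A B
      by (simp add: scalar_product_def matrix_vector_mult_add_rdistrib distrib_left sum.distrib)
    moreover have "mscale c A *v q = c *s (A *v q)" for c A
      by (simp add: matrix_vector_mult_def vec_eq_iff sum_distrib_left mult.assoc)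
    moreover have "scalar_product e (c *s x) = c * scalar_product e x" for c x
      by (simp add: scalar_product_def sum_distrib_left mult_ac)
    ultimately show ?thesis
      using mat.vector_space_axioms vector_space_over_itself.vector_space_axioms
      by (simp add: Vector_Spaces.linear_iff)
  qed
  ultimately show ?thesis using assms(1) by (auto simp: linear_system_def)
qed

text \<open>The forms added in a round express that \<open>A q\<close> lies in the column space of \<open>J\<close>.\<close>

lemma solutions_extend:
  assumes E: "complement_basis_choice E"
  shows "solutions (L \<union> (\<lambda>e A. scalar_product e (A *v q)) ` E J)
    = solutions L \<inter> {A. A *v q \<in> vec.span (columns J)}"
proof -
  have "is_basis (*s) (E J) (orthogonal_complement (vec.span (columns J)))"
    using E by (simp add: complement_basis_choice_def)
  from double_orthogonal_complement[OF vec.subspace_span this] show ?thesis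
    by (simp add: solutions_def set_eq_iff ball_Un)
qed

lemma prob_bind_pmf_of_set:
  assumes "finite G" "G \<noteq> {}"
  shows "measure_pmf.prob (bind_pmf (pmf_of_set G) f) X
    = (\<Sum>p\<in>G. measure_pmf.prob (f p) X) / card G"
proof -
  have "ennreal (measure_pmf.prob (bind_pmf (pmf_of_set G) f) X)
      = (\<Sum>p\<in>G. ennreal (measure_pmf.prob (f p) X)) / card G"
    using assms by (simp add: nn_integral_pmf_of_set flip: measure_pmf.emeasure_eq_measure)
  also have "\<dots> = ennreal ((\<Sum>p\<in>G. measure_pmf.prob (f p) X) / card G)"
    using assms by (simp add: sum_ennreal divide_ennreal card_gt_0_iff sum_nonneg ennreal_of_nat_eq_real_of_nat)
  finally show ?thesis by (simp add: sum_nonneg)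
qed

lemma subspace_generic_lie_algebra:
  fixes \<phi> :: "('m::{finite,linorder} ratfun) ^ 'b"
  shows "mat.subspace (generic_lie_algebra \<phi>)"
proof (rule mat.subspaceI)
  have "map_matrix of_rat (0 :: rat ^ 'b ^ 'b) *v \<phi> = 0"
    by (simp add: vec_eq_iff matrix_vector_mult_def)
  then show "0 \<in> generic_lie_algebra \<phi>"
    by (simp add: generic_lie_algebra_def generic_tangent_space_def vec.span_zero)
next
  fix A B assume "A \<in> generic_lie_algebra \<phi>" "B \<in> generic_lie_algebra \<phi>"
  moreover have "map_matrix of_rat (A + B) *v \<phi> = map_matrix of_rat A *v \<phi> + map_matrix of_rat B *v \<phi>"
    by (simp add: vec_eq_iff matrix_vector_mult_def of_rat_add distrib_right sum.distrib)
  ultimately show "A + B \<in> generic_lie_algebra \<phi>"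
    by (simp add: generic_lie_algebra_def generic_tangent_space_def vec.span_add)
next
  fix c A assume "A \<in> generic_lie_algebra \<phi>"
  moreover have "map_matrix of_rat (mscale c A) *v \<phi> = of_rat c *s (map_matrix of_rat A *v \<phi>)"
    by (simp add: vec_eq_iff matrix_vector_mult_def of_rat_mult sum_distrib_left mult.assoc)
  ultimately show "mscale c A \<in> generic_lie_algebra \<phi>"
    by (simp add: generic_lie_algebra_def generic_tangent_space_def vec.span_scale)
qed

definition correct_outcome :: "('m::{finite,linorder} ratfun) ^ 'n \<Rightarrow> (rat ^ 'n ^ 'n \<Rightarrow> rat) set option \<Rightarrow> bool" where
  "correct_outcome \<phi> out \<longleftrightarrow>
     (\<exists>L. out = Some L \<and> linear_system L \<and> solutions L = generic_lie_algebra \<phi>)"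

text \<open>Each round goes wrong with probability at most \<open>4nd/N\<close>, and \<open>k\<close> good rounds are enough if the
  dimension of the solution space exceeds that of \<open>V\<close> by at most \<open>k\<close>.\<close>

lemma collect_forms_failure_prob:
  fixes \<phi> :: "('m::{finite,linorder} ratfun) ^ 'n" and a b :: "'n \<Rightarrow> ('m, rat) mpoly"
  assumes b_nz: "\<And>i. b i \<noteq> 0" and \<phi>_eq: "\<And>i. \<phi> $ i = Fract (a i) (b i)"
    and deg_a: "\<And>i. mpoly_degree_le (a i) d" and deg_b: "\<And>i. mpoly_degree_le (b i) d"
    and E: "complement_basis_choice E" and N: "N \<ge> 1"
    and L: "linear_system L" "generic_lie_algebra \<phi> \<subseteq> solutions L"
    and dim: "matrix_dim (solutions L) \<le> matrix_dim (generic_lie_algebra \<phi>) + k"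
  shows "measure_pmf.prob (collect_forms \<phi> E N k L) {out. \<not> correct_outcome \<phi> out}
    \<le> real k * (4 * CARD('n) * d) / N"
  using L dim
proof (induction k arbitrary: L)
  case 0
  have "solutions L = generic_lie_algebra \<phi>"
    using matrix_dim_strict_mono[OF subspace_generic_lie_algebra subspace_solutions[OF "0.prems"(1)]]
      "0.prems" by fastforce
  then show ?case using "0.prems"(1) by (simp add: correct_outcome_def)
next
  case (Suc k)
  let ?V = "generic_lie_algebra \<phi>" and ?G = "grid N :: (rat ^ 'm::{finite,linorder}) set"
  let ?D = "4 * CARD('n) * d" and ?F = "{out. \<not> correct_outcome \<phi> out}"
  \<comment> \<open>A solution outside \<open>V\<close> if there is one; the polynomial for this \<open>A\<close> detects whether the next round
  is good.\<close>
  obtain A where A: "A \<in> solutions L" "A \<in> ?V \<Longrightarrow> solutions L = ?V"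
    using mat.subspace_0[OF subspace_solutions[OF Suc.prems(1)]] Suc.prems(2) by blast
  obtain Z where Z: "Z \<noteq> 0" "mpoly_degree_le Z ?D"
    and good: "\<And>x :: rat ^ 'm::{finite,linorder}. mpoly_eval of_rat (($) x) Z \<noteq> 0 \<Longrightarrow> ratmap_defined \<phi> x \<and>
       (\<forall>A'\<in>?V. A' *v ratmap_eval \<phi> x \<in> vec.span (columns (jacobian \<phi> x))) \<and>
       (A \<notin> ?V \<longrightarrow> A *v ratmap_eval \<phi> x \<notin> vec.span (columns (jacobian \<phi> x)))"
    by (rule good_polynomial_exists[OF b_nz \<phi>_eq deg_a deg_b]) blast
  define f where "f x = (if ratmap_defined \<phi> x
       then let q = ratmap_eval \<phi> x
            in collect_forms \<phi> E N k (L \<union> (\<lambda>e A. scalar_product e (A *v q)) ` E (jacobian \<phi> x))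
       else return_pmf None)" for x :: "rat ^ 'm::{finite,linorder}"
  define bad where "bad = {x \<in> ?G. mpoly_eval of_rat (($) x) Z = 0}"
  have G: "finite ?G" "?G \<noteq> {}" using grid_finite_nonempty[OF N] by auto
  then have cardG: "card ?G > 0" by (simp add: card_gt_0_iff)
  have step: "measure_pmf.prob (f x) ?F \<le> real k * ?D / N" if x: "x \<in> ?G - bad" for x
  proof -
    have Zx: "mpoly_eval of_rat (($) x) Z \<noteq> 0" using x by (auto simp: bad_def)
    let ?L = "L \<union> (\<lambda>e A. scalar_product e (A *v ratmap_eval \<phi> x)) ` E (jacobian \<phi> x)"
    have sol: "solutions ?L = solutions L \<inter> {A. A *v ratmap_eval \<phi> x \<in> vec.span (columns (jacobian \<phi> x))}"
      by (rule solutions_extend[OF E])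
    have L': "linear_system ?L" by (rule linear_system_extend[OF Suc.prems(1) E])
    have sub: "?V \<subseteq> solutions ?L" using good[OF Zx] Suc.prems(2) by (auto simp: sol)
    have "matrix_dim (solutions ?L) \<le> matrix_dim ?V + k"
    proof (cases "A \<in> ?V")
      case True
      then have "solutions ?L = ?V" using A(2) sub sol by blast
      then show ?thesis by simp
    next
      case False
      then have "solutions ?L \<subset> solutions L" using good[OF Zx] A(1) sol by blast
      from matrix_dim_strict_mono[OF subspace_solutions[OF L'] subspace_solutions[OF Suc.prems(1)] this]
      show ?thesis using Suc.prems(3) by simp
    qed
    from Suc.IH[OF L' sub this] show ?thesis using good[OF Zx] by (simp add: f_def Let_def)
  qed
  have "measure_pmf.prob (collect_forms \<phi> E N (Suc k) L) ?F = (\<Sum>x\<in>?G. measure_pmf.prob (f x) ?F) / card ?G"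
    unfolding collect_forms.simps f_def[symmetric] by (rule prob_bind_pmf_of_set[OF G])
  also have "(\<Sum>x\<in>?G. measure_pmf.prob (f x) ?F)
      = (\<Sum>x\<in>?G - bad. measure_pmf.prob (f x) ?F) + (\<Sum>x\<in>bad. measure_pmf.prob (f x) ?F)"
    using G by (intro sum.subset_diff) (auto simp: bad_def)
  also have "\<dots> \<le> (\<Sum>x\<in>?G - bad. real k * ?D / N) + (\<Sum>x\<in>bad. 1)"
    by (intro add_mono sum_mono step) auto
  also have "\<dots> \<le> card ?G * (real k * ?D / N) + card bad"
  proof -
    have "real (card (?G - bad)) * (real k * ?D / N) \<le> real (card ?G) * (real k * ?D / N)"
      using card_mono[OF G(1), of "?G - bad"] by (intro mult_right_mono) auto
    then show ?thesis by simp
  qed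
  also have "real (card bad) \<le> card ?G * (real ?D / N)"
  proof -
    have "real (card bad * N) \<le> real (?D * card ?G)"
      unfolding of_nat_le_iff bad_def by (rule card_grid_zeros[OF Z])
    then show ?thesis using N by (simp add: field_simps)
  qed
  finally have "measure_pmf.prob (collect_forms \<phi> E N (Suc k) L) ?F
      \<le> (card ?G * (real k * ?D / N) + card ?G * (real ?D / N)) / card ?G"
    by (simp add: divide_right_mono)
  also have "\<dots> = real (Suc k) * ?D / N"
    using cardG N by (simp add: field_simps)
  finally show ?case .
qed

theorem proposition3p1:
  fixes \<phi> :: "('m::{finite,linorder} ratfun) ^ 'n"
    and a b :: "'n \<Rightarrow> ('m, rat) mpoly"
    and d :: nat and \<epsilon> :: real
    and E :: "rat ^ ('m::{finite,linorder}) ^ 'n \<Rightarrow> (rat ^ 'n) set"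
    and S :: "(rat ^ 'n ^ 'n \<Rightarrow> rat) set \<Rightarrow> (rat ^ 'n ^ 'n) set"
  assumes "\<epsilon> > 0"
    and "\<And>i. b i \<noteq> 0" and "\<And>i. \<phi> $ i = Fract (a i) (b i)"
    and "d \<ge> 1"
    and "\<And>i. mpoly_degree_le (a i) d" and "\<And>i. mpoly_degree_le (b i) d"
    and "complement_basis_choice E" and "solution_basis_choice S"
  shows "measure_pmf.prob (algorithm1 E S d \<phi> \<epsilon>)
      {out. \<exists>B. out = Some B \<and>
         is_basis mscale (map_matrix of_rat ` B)
           (lie_algebra (stabilizer (zariski_closure (ratmap_image \<phi>))))}
    \<ge> 1 - \<epsilon>"
proof -
  let ?n = "real CARD('n)" and ?m = "real CARD('m)" and ?V = "generic_lie_algebra \<phi>"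
  let ?success = "{out. \<exists>B. out = Some B \<and> is_basis mscale (map_matrix of_rat ` B)
           (lie_algebra (stabilizer (zariski_closure (ratmap_image \<phi>))))}"
  define N where "N = nat \<lceil>inverse \<epsilon> * 2 * ?n ^ 3 * real d * (2 * ?m + 1)\<rceil>"
  define M where "M = collect_forms \<phi> E N ((CARD('n))\<^sup>2) {}"
  have n: "?n \<ge> 1" and m: "?m \<ge> 1" by (simp_all add: Suc_le_eq)
  have bound: "inverse \<epsilon> * 2 * ?n ^ 3 * real d * (2 * ?m + 1) \<le> real N"
    unfolding N_def by (rule real_nat_ceiling_ge)
  have "0 < inverse \<epsilon> * 2 * ?n ^ 3 * real d * (2 * ?m + 1)"
    using assms(1,4) n m by (intro mult_pos_pos) auto
  then have N: "N \<ge> 1" using bound by linarith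
  have "measure_pmf.prob M {out. \<not> correct_outcome \<phi> out} \<le> real ((CARD('n))\<^sup>2) * (4 * CARD('n) * d) / N"
    unfolding M_def
  proof (rule collect_forms_failure_prob[OF assms(2,3,5,6,7) N])
    show "linear_system ({} :: (rat ^ 'n ^ 'n \<Rightarrow> rat) set)" by (simp add: linear_system_def)
    show "?V \<subseteq> solutions {}" by (simp add: solutions_def)
    show "matrix_dim (solutions {} :: (rat ^ 'n ^ 'n) set) \<le> matrix_dim ?V + (CARD('n))\<^sup>2"
      using matrix_dim_le[of "solutions {} :: (rat ^ 'n ^ 'n) set"] by linarith
  qed
  also have "\<dots> \<le> \<epsilon>"
  proof -
    \<comment> \<open>Since \<open>2m + 1 \<ge> 2\<close>, the number \<open>N\<close> exceeds the required \<open>4n\<^sup>3d/\<epsilon>\<close>.\<close>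
    have "4 * ?n ^ 3 * real d \<le> 2 * ?n ^ 3 * real d * (2 * ?m + 1)"
      using mult_left_mono[of 2 "2 * ?m + 1" "2 * ?n ^ 3 * real d"] m by simp
    also have "\<dots> \<le> \<epsilon> * real N"
      using bound assms(1) by (simp add: field_simps)
    finally show ?thesis using N by (simp add: field_simps power2_eq_square power3_eq_cube)
  qed
  finally have fail: "measure_pmf.prob M {out. \<not> correct_outcome \<phi> out} \<le> \<epsilon>" .
  have "map_option S out \<in> ?success" if correct: "correct_outcome \<phi> out" for out
  proof -
    obtain L where L: "out = Some L" "linear_system L" "solutions L = ?V"
      using correct by (auto simp: correct_outcome_def)
    then have "is_basis mscale (S L) ?V"
      using assms(8) by (auto simp: solution_basis_choice_def linear_system_def solutions_def)
    from generic_basis_imp_lie_algebra_basis[OF this] show ?thesis using L(1) by simp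
  qed
  then have "measure_pmf.prob M {out. correct_outcome \<phi> out} \<le> measure_pmf.prob M (map_option S -` ?success)"
    by (intro measure_pmf.finite_measure_mono) auto
  moreover have "measure_pmf.prob M {out. correct_outcome \<phi> out} = 1 - measure_pmf.prob M {out. \<not> correct_outcome \<phi> out}"
    using measure_pmf.prob_compl[of "{out. \<not> correct_outcome \<phi> out}" M]
    by (simp add: Compl_eq_Diff_UNIV[symmetric] Collect_neg_eq[symmetric])
  ultimately show ?thesis
    using fail by (simp add: algorithm1_def Let_def M_def N_def)
qed

end
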